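(* Let $K\ge0$, let $X$ be a two-dimensional Alexandrov space of curvature bounded below by $K$ which is homeomorphic to the closed unit disk, and let $\gamma=\partial X$, assumed rectifiable. Let $\kappa\ge0$. Then $\underline\chi_\gamma(q)\ge\kappa$ for almost every $q\in\gamma$ if and only if $\chi_{\gamma,K}\ge\kappa$ globally.
   Context: $S_K$: model surface of constant curvature $K$ (sphere of radius $1/\sqrt K$ if $K>0$, plane if $K=0$). For three points $a,b,c$ of $X$ with a comparison triangle in $S_K$, $\chi_K(a,b,c)$ is the $\kappa'\ge0$ such that the comparison triangle's vertices lie on a circle in $S_K$ of constant geodesic curvature $\kappa'$. $\underline\chi_\gamma(q)=\liminf\chi_K(a,q,c)$ as $a,c\to q$ along $\gamma$ from opposite sides of $q$. "$\chi_{\gamma,K}\ge\kappa$ globally" means $\chi_K(p,q,m)\ge\kappa$ for all $p,q,m\in\gamma$ whose triangle has perimeter at most $2\pi/\sqrt K$ when $K>0$. *)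

theory Defs
  imports "HOL-Analysis.Analysis"
begin

text \<open>All definitions below are intended for curvature bounds K \<ge> 0 only.\<close>

definition curve_length :: "(real \<Rightarrow> 'a::metric_space) \<Rightarrow> real \<Rightarrow> real \<Rightarrow> ereal" where
  "curve_length g s t =
     (SUP np \<in> {(n::nat, p::nat \<Rightarrow> real). p 0 = s \<and> p n = t \<and> (\<forall>i<n. p i \<le> p (Suc i))}.
        ereal (\<Sum>i<fst np. dist (g (snd np i)) (g (snd np (Suc i)))))"

definition length_space :: "'a::metric_space set \<Rightarrow> bool" where
  "length_space X \<longleftrightarrow>
     (\<forall>x\<in>X. \<forall>y\<in>X. \<forall>e>0. \<exists>\<sigma>. continuous_on {0..1} \<sigma> \<and> \<sigma> ` {0..1} \<subseteq> X \<and>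
        \<sigma> 0 = x \<and> \<sigma> 1 = y \<and> curve_length \<sigma> 0 1 < ereal (dist x y + e))"

definition shortest_path :: "'a::metric_space set \<Rightarrow> (real \<Rightarrow> 'a) \<Rightarrow> 'a \<Rightarrow> 'a \<Rightarrow> bool" where
  "shortest_path X \<sigma> x y \<longleftrightarrow> continuous_on {0..1} \<sigma> \<and> \<sigma> ` {0..1} \<subseteq> X \<and>
     \<sigma> 0 = x \<and> \<sigma> 1 = y \<and> curve_length \<sigma> 0 1 = ereal (dist x y)"

text \<open>K = 0: the plane x3 = 0 with Euclidean distance;
      K > 0: the sphere of radius 1/sqrt K about 0 with its great-circle distance.\<close>

definition model_space :: "real \<Rightarrow> (real^3) set" where
  "model_space K = (if K = 0 then {x. x$3 = 0} else sphere 0 (1 / sqrt K))"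

definition model_dist :: "real \<Rightarrow> real^3 \<Rightarrow> real^3 \<Rightarrow> real" where
  "model_dist K x y = (if K = 0 then dist x y else (1 / sqrt K) * arccos (K * (x \<bullet> y)))"

text \<open>C is a circle in S_K of constant geodesic curvature k \<ge> 0: a metric circle of
  radius r (curvature 1/r in the plane, sqrt K * cot (sqrt K * r) on the sphere, where
  the centre is chosen so that r \<le> pi/(2 sqrt K)), or a straight line (curvature 0) in the plane.\<close>

definition model_circle :: "real \<Rightarrow> (real^3) set \<Rightarrow> real \<Rightarrow> bool" where
  "model_circle K C k \<longleftrightarrow>
     (\<exists>c r. c \<in> model_space K \<and> 0 < r \<and> C = {x \<in> model_space K. model_dist K c x = r} \<and>
        (if K = 0 then k = 1 / r else r \<le> pi / (2 * sqrt K) \<and> k = sqrt K * cot (sqrt K * r)))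
   \<or> (K = 0 \<and> k = 0 \<and> (\<exists>u v. u$3 = 0 \<and> v$3 = 0 \<and> v \<noteq> 0 \<and> C = {u + t *\<^sub>R v | t. True}))"

definition comparison_triangle ::
  "real \<Rightarrow> 'a::metric_space \<Rightarrow> 'a \<Rightarrow> 'a \<Rightarrow> real^3 \<Rightarrow> real^3 \<Rightarrow> real^3 \<Rightarrow> bool" where
  "comparison_triangle K a b c a' b' c' \<longleftrightarrow>
     a' \<in> model_space K \<and> b' \<in> model_space K \<and> c' \<in> model_space K \<and>
     model_dist K a' b' = dist a b \<and> model_dist K b' c' = dist b c \<and> model_dist K c' a' = dist c a"

definition chi :: "real \<Rightarrow> 'a::metric_space \<Rightarrow> 'a \<Rightarrow> 'a \<Rightarrow> real" where
  "chi K a b c = (THE k. 0 \<le> k \<and> (\<exists>a' b' c' C. comparison_triangle K a b c a' b' c' \<and>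
       model_circle K C k \<and> a' \<in> C \<and> b' \<in> C \<and> c' \<in> C))"

text \<open>Complete length space satisfying (global) Toponogov distance comparison: for every
  triangle of perimeter < 2 pi / sqrt K (if K > 0), every shortest path from b to c and every
  point d on it, dist a d is at least the distance from a' to the corresponding point d'
  on the side b'c' of a comparison triangle.\<close>

definition alexandrov_curv_ge :: "real \<Rightarrow> 'a::metric_space set \<Rightarrow> bool" where
  "alexandrov_curv_ge K X \<longleftrightarrow> complete X \<and> length_space X \<and>
     (\<forall>a\<in>X. \<forall>b\<in>X. \<forall>c\<in>X. \<forall>\<sigma> \<tau>.
        (K > 0 \<longrightarrow> dist a b + dist b c + dist c a < 2 * pi / sqrt K) \<and>
        shortest_path X \<sigma> b c \<and> \<tau> \<in> {0..1} \<longrightarrow>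
        (\<forall>a' b' c' d'. comparison_triangle K a b c a' b' c' \<and> d' \<in> model_space K \<and>
            model_dist K b' d' = dist b (\<sigma> \<tau>) \<and> model_dist K d' c' = dist (\<sigma> \<tau>) c \<longrightarrow>
            model_dist K a' d' \<le> dist a (\<sigma> \<tau>)))"

definition lower_chi :: "real \<Rightarrow> (real \<Rightarrow> 'a::metric_space) \<Rightarrow> real \<Rightarrow> ereal" where
  "lower_chi K g t =
     Liminf (at_left t \<times>\<^sub>F at_right t) (\<lambda>(s, u). ereal (chi K (g s) (g t) (g u)))"

definition chi_global_ge :: "real \<Rightarrow> 'a::metric_space set \<Rightarrow> real \<Rightarrow> bool" where
  "chi_global_ge K \<Gamma> k \<longleftrightarrow>
     (\<forall>p\<in>\<Gamma>. \<forall>q\<in>\<Gamma>. \<forall>m\<in>\<Gamma>. p \<noteq> q \<and> q \<noteq> m \<and> p \<noteq> m \<and>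
        (K > 0 \<longrightarrow> dist p q + dist q m + dist m p \<le> 2 * pi / sqrt K) \<longrightarrow> k \<le> chi K p q m)"

end

theory Submission
  imports Defs
begin

text \<open>Shortest paths with interlaced end points on the boundary of a disk cross, so Toponogov comparison makes
  comparison angles between boundary points superadditive in their cyclic order. Hence the total turning of a
  boundary arc, measured by its angles with its chord, is at least the sum of the exterior comparison angles
  of any inscribed polygon, and the almost everywhere bound on the osculating curvature yields turning at
  least \<open>kappa\<close> times the chord. Splitting an arc at a point equidistant from its ends distributes the turning
  evenly: first the angle of an arc with its chord \<open>d\<close> is at least \<open>kappa * d / 2\<close>, and then, by reducing
  long arcs to short ones, at least the corresponding angle of a circle of curvature \<open>k < kappa\<close>.
  At the vertex opposite to the largest side of a triangle inscribed in the boundary these angles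
  and the angle of the triangle add up to at most \<open>pi\<close>, which says that its circumscribed circle has curvature
  at least \<open>k\<close>.\<close>

section \<open>Comparison angles\<close>

text \<open>Angles are used because they add up along the curve, which \<open>chi\<close> does not.
  The total turning, however, bounds only the sum of the two angles of an arc with its chord,
  whereas the circumscribed circle needs each of them. A point equidistant from the ends repairs
  this because its comparison triangle is isosceles, so that both ends gain the same base angle. Two
  gaps \<open>k < k1 < kappa\<close> are opened on the way: \<open>k1 < kappa\<close> turns a lower
  limit into a bound on a neighbourhood, and \<open>k < k1\<close> lets the linear angle
  \<open>k1 * d / 2\<close> dominate the angle of a circle of curvature \<open>k\<close>, for short
  chords \<open>d\<close> only. For \<open>K > 0\<close> the obstacle is that comparison is
  available only for perimeters below \<open>2 * pi / sqrt K\<close>, and the triangles inscribed in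
  a long arc are not known to satisfy this beforehand. The angle bounds themselves supply it: they
  keep the perimeter a fixed amount below the limit, so that arcs can be lengthened in steps of
  fixed size.\<close>

definition clamped_arccos :: "real \<Rightarrow> real" where
  "clamped_arccos x = arccos (max (-1) (min 1 x))"

definition cos_angle :: "real \<Rightarrow> real \<Rightarrow> real \<Rightarrow> real \<Rightarrow> real" where
  "cos_angle K b c a = (if K = 0 then (b\<^sup>2 + c\<^sup>2 - a\<^sup>2) / (2 * b * c)
     else (cos (sqrt K * a) - cos (sqrt K * b) * cos (sqrt K * c)) / (sin (sqrt K * b) * sin (sqrt K * c)))"

definition model_angle :: "real \<Rightarrow> real \<Rightarrow> real \<Rightarrow> real \<Rightarrow> real" where
  "model_angle K b c a = clamped_arccos (cos_angle K b c a)"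

definition small_perimeter :: "real \<Rightarrow> real \<Rightarrow> bool" where
  "small_perimeter K p \<longleftrightarrow> (K > 0 \<longrightarrow> p < 2 * pi / sqrt K)"

text \<open>A chord of length \<open>x\<close> of a circle of geodesic curvature \<open>k\<close> makes the angle
  \<open>arcsin (k * half_tan K x)\<close> with the circle.\<close>

definition half_tan :: "real \<Rightarrow> real \<Rightarrow> real" where
  "half_tan K x = (if K = 0 then x / 2 else tan (sqrt K * x / 2) / sqrt K)"

lemma clamped_arccos_bounds: "0 \<le> clamped_arccos x" "clamped_arccos x \<le> pi"
  unfolding clamped_arccos_def by (auto intro!: arccos_lbound arccos_ubound)

lemma clamped_arccos_antimono: "x \<le> y \<Longrightarrow> clamped_arccos y \<le> clamped_arccos x"
  unfolding clamped_arccos_def by (intro arccos_le_arccos) auto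

lemma cos_clamped_arccos: "\<bar>x\<bar> \<le> 1 \<Longrightarrow> cos (clamped_arccos x) = x"
  unfolding clamped_arccos_def by (auto simp: cos_arccos_abs max_def min_def abs_le_iff)

lemma clamped_arccos_cos: "0 \<le> t \<Longrightarrow> t \<le> pi \<Longrightarrow> clamped_arccos (cos t) = t"
  unfolding clamped_arccos_def by (simp add: arccos_cos)

lemma continuous_on_clamped_arccos: "continuous_on S clamped_arccos"
  unfolding clamped_arccos_def [abs_def]
  by (rule continuous_on_subset[OF _ subset_UNIV])
     (intro continuous_intros; auto)

lemma model_angle_bounds: "0 \<le> model_angle K b c a" "model_angle K b c a \<le> pi"
  unfolding model_angle_def by (rule clamped_arccos_bounds)+

lemma cos_angle_commute: "cos_angle K b c a = cos_angle K c b a"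
  unfolding cos_angle_def by (simp add: algebra_simps)

lemma model_angle_commute: "model_angle K b c a = model_angle K c b a"
  unfolding model_angle_def by (simp add: cos_angle_commute)

text \<open>The clamping absorbs values of \<open>x\<close> below -1, so an upper bound on the
  cosine bounds the angle from below before the cosine is known to lie in the domain of
  \<open>arccos\<close>.\<close>

lemma le_clamped_arccos: 
  assumes "0 \<le> t" "t \<le> pi" "x \<le> cos t" shows "t \<le> clamped_arccos x"
  using clamped_arccos_antimono[OF assms(3)] clamped_arccos_cos[OF assms(1,2)] by simp

text \<open>The side \<open>a\<close> opposite to the angle may vanish: the crossing point of two
  shortest paths can be an end point of one of them.\<close>

definition triangle_sides :: "real \<Rightarrow> real \<Rightarrow> real \<Rightarrow> real \<Rightarrow> bool" where
  "triangle_sides K b c a \<longleftrightarrow> 0 < b \<and> 0 < c \<and> 0 \<le> a \<and> a \<le> b + c \<and> b \<le> a + c \<and> c \<le> a + b \<and> small_perimeter K (a + b + c)"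

lemma small_perimeter_scaled: "K > 0 \<Longrightarrow> small_perimeter K p \<longleftrightarrow> sqrt K * p < 2 * pi"
  unfolding small_perimeter_def by (simp add: field_simps)

lemma triangle_sides_scaled:
  assumes "K > 0" "triangle_sides K b c a"
  defines "s \<equiv> sqrt K"
  shows "0 < s * b" "0 < s * c" "0 \<le> s * a" "s * a \<le> s * b + s * c" "s * b \<le> s * a + s * c"
    "s * c \<le> s * a + s * b" "s * a + s * b + s * c < 2 * pi" "s * a < pi" "s * b < pi" "s * c < pi"
proof -
  have s: "s > 0" using assms by simp
  note t = assms(2)[unfolded triangle_sides_def]
  show "0 < s * b" "0 < s * c" "0 \<le> s * a" using t s by auto
  show 1: "s * a \<le> s * b + s * c" "s * b \<le> s * a + s * c" "s * c \<le> s * a + s * b" 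
    using t s by (simp_all flip: distrib_left)
  show 2: "s * a + s * b + s * c < 2 * pi" using t small_perimeter_scaled[OF assms(1)] unfolding s_def by (simp add: algebra_simps)
  show "s * a < pi" "s * b < pi" "s * c < pi" using 1 2 by auto
qed

lemma cos_angle_abs_le_1:
  assumes K: "K \<ge> 0" and t: "triangle_sides K b c a"
  shows "\<bar>cos_angle K b c a\<bar> \<le> 1"
proof (cases "K = 0")
  case True
  have p: "0 < b * c" using t unfolding triangle_sides_def by simp
  have "(a - (b + c)) * (a + (b + c)) \<le> 0" using t unfolding triangle_sides_def
    by (intro mult_nonpos_nonneg) auto
  moreover have "(b - c - a) * (b - c + a) \<le> 0" using t unfolding triangle_sides_def
    by (intro mult_nonpos_nonneg) auto
  ultimately show ?thesis using p True unfolding cos_angle_def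
    by (simp add: abs_le_iff field_simps power2_eq_square)
next
  case False
  then have K0: "K > 0" using K by simp
  note f = triangle_sides_scaled[OF K0 t]
  define x y z where "x = sqrt K * b" "y = sqrt K * c" "z = sqrt K * a"
  note f = f[folded x_y_z_def]
  have p: "0 < sin x * sin y" using f by (simp add: sin_gt_zero)
  have "cos z \<le> cos \<bar>x - y\<bar>" using f by (intro cos_monotone_0_pi_le) auto
  then have 1: "cos z \<le> cos x * cos y + sin x * sin y" by (simp add: cos_diff)
  have "cos (x + y) \<le> cos z"
  proof (cases "x + y \<le> pi")
    case True then show ?thesis using f by (intro cos_monotone_0_pi_le) auto
  next
    case False
    \<comment> \<open>For \<open>x + y > pi\<close> the comparison is with the complementary arc,
      and the perimeter bound is exactly \<open>z < 2 * pi - (x + y)\<close>.\<close>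
    have "cos (2 * pi - (x + y)) \<le> cos z" using f False by (intro cos_monotone_0_pi_le) auto
    then show ?thesis by (simp add: cos_diff)
  qed
  then have 2: "cos x * cos y - sin x * sin y \<le> cos z" by (simp add: cos_add)
  show ?thesis using 1 2 p False unfolding cos_angle_def x_y_z_def[symmetric]
    by (simp add: abs_le_iff field_simps)
qed

lemma cos_model_angle:
  "K \<ge> 0 \<Longrightarrow> triangle_sides K b c a \<Longrightarrow> cos (model_angle K b c a) = cos_angle K b c a"
  unfolding model_angle_def by (simp add: cos_clamped_arccos cos_angle_abs_le_1)

section \<open>Angle sums and gluing of comparison triangles\<close>

lemma angle_sum_ge_pi_aux:
  fixes A B C :: real
  assumes "0 \<le> A" "0 \<le> B" "0 \<le> C" "C \<le> pi" "cos C \<le> - cos (A + B)"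
  shows "pi \<le> A + B + C"
proof (rule ccontr)
  assume "\<not> ?thesis"
  then have "C < pi - (A + B)" "pi - (A+B) \<le> pi" using assms by auto
  then have "cos (pi - (A + B)) < cos C" using assms by (intro cos_monotone_0_pi) auto
  then show False using assms by simp
qed

text \<open>The right side is the Gram determinant of the unit vectors at the three vertices. Both
  \<open>sin A * (sin x * sin y)\<close> and \<open>sin B * (sin x * sin z)\<close> are its
  nonnegative square root, which is the law of sines.\<close>

lemma spherical_sin_mult:
  fixes x y z :: real
  assumes "0 < sin x" "0 < sin y" "0 < sin z" and A: "0 \<le> A" "A \<le> pi" "cos A = (cos z - cos x * cos y) / (sin x * sin y)"
    and B: "0 \<le> B" "B \<le> pi" "cos B = (cos y - cos x * cos z) / (sin x * sin z)"
  shows "sin A * sin B * (sin y * sin z * (sin x)\<^sup>2) = 1 - (cos x)\<^sup>2 - (cos y)\<^sup>2 - (cos z)\<^sup>2 + 2 * cos x * cos y * cos z"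
    (is "_ = ?G")
proof -
  have sx: "(sin x)\<^sup>2 = 1 - (cos x)\<^sup>2" "(sin y)\<^sup>2 = 1 - (cos y)\<^sup>2" "(sin z)\<^sup>2 = 1 - (cos z)\<^sup>2" by (simp_all add: sin_squared_eq)
  have a: "cos A * (sin x * sin y) = cos z - cos x * cos y" using A assms(1,2) by simp
  have b: "cos B * (sin x * sin z) = cos y - cos x * cos z" using B assms(1,3) by simp
  have "(sin A * (sin x * sin y))\<^sup>2 = (1 - (cos A)\<^sup>2) * (sin x * sin y)\<^sup>2" by (simp add: sin_squared_eq power_mult_distrib)
  also have "\<dots> = (sin x)\<^sup>2 * (sin y)\<^sup>2 - (cos A * (sin x * sin y))\<^sup>2" by (simp add: algebra_simps power_mult_distrib)
  also have "\<dots> = ?G" unfolding a sx by (simp add: algebra_simps power2_eq_square)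
  finally have 1: "(sin A * (sin x * sin y))\<^sup>2 = ?G" .
  have "(sin B * (sin x * sin z))\<^sup>2 = (1 - (cos B)\<^sup>2) * (sin x * sin z)\<^sup>2" by (simp add: sin_squared_eq power_mult_distrib)
  also have "\<dots> = (sin x)\<^sup>2 * (sin z)\<^sup>2 - (cos B * (sin x * sin z))\<^sup>2" by (simp add: algebra_simps power_mult_distrib)
  also have "\<dots> = ?G" unfolding b sx by (simp add: algebra_simps power2_eq_square)
  finally have 2: "(sin B * (sin x * sin z))\<^sup>2 = ?G" .
  have "sin A * (sin x * sin y) = sin B * (sin x * sin z)"
  proof (rule power2_eq_imp_eq)
    show "(sin A * (sin x * sin y))\<^sup>2 = (sin B * (sin x * sin z))\<^sup>2" by (simp only: 1 2)
    show "0 \<le> sin A * (sin x * sin y)" "0 \<le> sin B * (sin x * sin z)"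
      using A(1,2) B(1,2) assms(1-3) by (simp_all add: sin_ge_zero)
  qed
  moreover have "sin A * sin B * (sin y * sin z * (sin x)\<^sup>2) = (sin A * (sin x * sin y)) * (sin B * (sin x * sin z))"
    by (simp add: power2_eq_square)
  ultimately have "sin A * sin B * (sin y * sin z * (sin x)\<^sup>2) = (sin A * (sin x * sin y))\<^sup>2"
    by (simp only: power2_eq_square)
  then show ?thesis using 1 by simp
qed

text \<open>The planar counterpart; here the right side is 16 times the squared area of the
  triangle.\<close>

lemma euclidean_sin_mult:
  fixes x y z :: real
  assumes "0 < x" "0 < y" "0 < z" and A: "0 \<le> A" "A \<le> pi" "cos A = (x\<^sup>2 + y\<^sup>2 - z\<^sup>2) / (2 * x * y)"
    and B: "0 \<le> B" "B \<le> pi" "cos B = (x\<^sup>2 + z\<^sup>2 - y\<^sup>2) / (2 * x * z)"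
  shows "sin A * sin B * (4 * y * z * x\<^sup>2) = 4 * x\<^sup>2 * y\<^sup>2 - (x\<^sup>2 + y\<^sup>2 - z\<^sup>2)\<^sup>2" (is "_ = ?G")
proof -
  have a: "cos A * (2 * x * y) = x\<^sup>2 + y\<^sup>2 - z\<^sup>2" using A assms(1,2) by simp
  have b: "cos B * (2 * x * z) = x\<^sup>2 + z\<^sup>2 - y\<^sup>2" using B assms(1,3) by simp
  have "(sin A * (2 * x * y))\<^sup>2 = (1 - (cos A)\<^sup>2) * (2 * x * y)\<^sup>2" by (simp add: sin_squared_eq power_mult_distrib)
  also have "\<dots> = (2 * x * y)\<^sup>2 - (cos A * (2 * x * y))\<^sup>2" by (simp add: algebra_simps power_mult_distrib)
  also have "\<dots> = ?G" unfolding a by (simp add: algebra_simps power2_eq_square)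
  finally have 1: "(sin A * (2 * x * y))\<^sup>2 = ?G" .
  have "(sin B * (2 * x * z))\<^sup>2 = (1 - (cos B)\<^sup>2) * (2 * x * z)\<^sup>2" by (simp add: sin_squared_eq power_mult_distrib)
  also have "\<dots> = (2 * x * z)\<^sup>2 - (cos B * (2 * x * z))\<^sup>2" by (simp add: algebra_simps power_mult_distrib)
  also have "\<dots> = ?G" unfolding b by (simp add: algebra_simps power2_eq_square)
  finally have 2: "(sin B * (2 * x * z))\<^sup>2 = ?G" .
  have "sin A * (2 * x * y) = sin B * (2 * x * z)"
  proof (rule power2_eq_imp_eq)
    show "(sin A * (2 * x * y))\<^sup>2 = (sin B * (2 * x * z))\<^sup>2" by (simp only: 1 2)
    show "0 \<le> sin A * (2 * x * y)" "0 \<le> sin B * (2 * x * z)"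
      using A(1,2) B(1,2) assms(1-3) by (simp_all add: sin_ge_zero)
  qed
  moreover have "sin A * sin B * (4 * y * z * x\<^sup>2) = (sin A * (2 * x * y)) * (sin B * (2 * x * z))"
    by (simp add: power2_eq_square)
  ultimately have "sin A * sin B * (4 * y * z * x\<^sup>2) = (sin A * (2 * x * y))\<^sup>2"
    by (simp only: power2_eq_square)
  then show ?thesis using 1 by simp
qed

text \<open>On the sphere this is the dual law of cosines.\<close>

lemma model_angle_sum:
  assumes K: "K \<ge> 0" and t: "triangle_sides K b c a" and a: "0 < a"
  shows "pi \<le> model_angle K b c a + model_angle K c a b + model_angle K a b c"
proof -
  define A B C where "A = model_angle K b c a" "B = model_angle K c a b" "C = model_angle K a b c"
  have t': "triangle_sides K c a b" "triangle_sides K a b c" using t a unfolding triangle_sides_def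
    by (auto simp: algebra_simps)
  have r: "0 \<le> A" "0 \<le> B" "0 \<le> C" "A \<le> pi" "B \<le> pi" "C \<le> pi" unfolding A_B_C_def by (simp_all add: model_angle_bounds)
  have cs: "cos A = cos_angle K b c a" "cos B = cos_angle K c a b" "cos C = cos_angle K a b c"
    unfolding A_B_C_def using cos_model_angle K t t' by auto
  have "cos C \<le> - cos (A + B)"
  proof (cases "K = 0")
    case True
    have p: "0 < a" "0 < b" "0 < c" using t a unfolding triangle_sides_def by auto
    have ss: "sin A * sin B * (4 * b * a * c\<^sup>2) = 4 * c\<^sup>2 * b\<^sup>2 - (c\<^sup>2 + b\<^sup>2 - a\<^sup>2)\<^sup>2"
      by (rule euclidean_sin_mult) (use cs True r p in \<open>auto simp: cos_angle_def field_simps\<close>)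
    have ca: "cos A * (2 * b * c) = b\<^sup>2 + c\<^sup>2 - a\<^sup>2" "cos B * (2 * c * a) = c\<^sup>2 + a\<^sup>2 - b\<^sup>2"
       "cos C * (2 * a * b) = a\<^sup>2 + b\<^sup>2 - c\<^sup>2" using cs True p unfolding cos_angle_def by auto
    have "(cos C + cos (A + B)) * (4 * a * b * c\<^sup>2) = 2 * c\<^sup>2 * (cos C * (2 * a * b)) + (cos A * (2 * b * c)) * (cos B * (2 * c * a)) - sin A * sin B * (4 * b * a * c\<^sup>2)"
      by (simp add: cos_add algebra_simps power2_eq_square)
    also have "\<dots> = 0" unfolding ca ss by (simp add: algebra_simps power2_eq_square)
    finally show ?thesis using p by simp
  next
    case False
    then have K0: "K > 0" using K by simp
    define x y z where "x = sqrt K * b" "y = sqrt K * c" "z = sqrt K * a"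
    note f = triangle_sides_scaled[OF K0 t, folded x_y_z_def]
    have z0: "0 < z" using a K0 unfolding x_y_z_def by simp
    have p: "0 < sin x" "0 < sin y" "0 < sin z" using f z0 by (auto intro!: sin_gt_zero)
    let ?G = "1 - (cos y)\<^sup>2 - (cos x)\<^sup>2 - (cos z)\<^sup>2 + 2 * cos y * cos x * cos z"
    have ss: "sin A * sin B * (sin x * sin z * (sin y)\<^sup>2) = ?G"
      by (rule spherical_sin_mult) (use cs False r p x_y_z_def in \<open>auto simp: cos_angle_def field_simps\<close>)
    have ca: "cos A * (sin x * sin y) = cos z - cos x * cos y" "cos B * (sin y * sin z) = cos x - cos y * cos z"
       "cos C * (sin z * sin x) = cos y - cos z * cos x"
      using cs False p unfolding cos_angle_def x_y_z_def by auto
    have "(cos C + cos (A + B)) * (sin x * sin z * (sin y)\<^sup>2) = (sin y)\<^sup>2 * (cos C * (sin z * sin x)) + (cos A * (sin x * sin y)) * (cos B * (sin y * sin z)) - sin A * sin B * (sin x * sin z * (sin y)\<^sup>2)"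
      by (simp add: cos_add algebra_simps power2_eq_square)
    \<comment> \<open>The factor \<open>cos y - 1\<close> separates the sphere from the plane, where
      the corresponding expression vanishes: it is the source of the spherical excess.\<close>
    also have "\<dots> = ?G * (cos y - 1)" unfolding ca ss unfolding sin_squared_eq by (simp add: algebra_simps power2_eq_square)
    also have "\<dots> \<le> 0"
    proof (rule mult_nonneg_nonpos)
      show "0 \<le> ?G" unfolding ss[symmetric] using r p by (simp add: sin_ge_zero)
    qed simp
    finally have "(cos C + cos (A + B)) * (sin x * sin z * (sin y)\<^sup>2) \<le> 0" .
    moreover have "0 < sin x * sin z * (sin y)\<^sup>2" using p by simp
    ultimately have "cos C + cos (A + B) \<le> 0" by (meson mult_pos_pos not_le)
    then show ?thesis by linarith
  qed
  then show ?thesis using angle_sum_ge_pi_aux r unfolding A_B_C_def by blast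
qed

lemma polar_norm: "r * cos w * (r * cos w) + r * sin w * (r * sin w) = r * (r::real)"
proof -
  have "(r * cos w)\<^sup>2 + (r * sin w)\<^sup>2 = r\<^sup>2"
    by (simp add: power_mult_distrib flip: distrib_left)
  then show ?thesis by (simp only: power2_eq_square)
qed

text \<open>The common vertex is the north pole, \<open>N\<close> is the other end of the shared
  side, and \<open>U\<close> and \<open>V\<close> lie at distances \<open>b\<close> and
  \<open>c\<close> from the pole on the two sides of it. Cauchy-Schwarz for the components of
  \<open>U\<close> and \<open>V\<close> orthogonal to \<open>N\<close> gives the spherical triangle
  inequality in terms of cosines.\<close>

lemma spherical_triangle_ineq:
  fixes b c h p q t u :: real
  assumes p: "cos p = cos b * cos h + sin b * sin h * cos t" "0 \<le> sin p"
    and q: "cos q = cos h * cos c + sin h * sin c * cos u" "0 \<le> sin q"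
  shows "cos (p + q) \<le> cos b * cos c + sin b * sin c * cos (t + u)"
proof -
  define U V N :: "real^3" where "U = vector [sin b * cos t, sin b * sin t, cos b]"
    "V = vector [sin c * cos u, - sin c * sin u, cos c]" "N = vector [sin h, 0, cos h]"
  have un: "U \<bullet> U = 1" "V \<bullet> V = 1" "N \<bullet> N = 1"
    unfolding U_V_N_def inner_vec_def sum_3 using polar_norm[of "sin b" t] polar_norm[of "sin c" u]
    by (simp_all add: algebra_simps flip: power2_eq_square)
  have dots: "U \<bullet> N = cos p" "V \<bullet> N = cos q" "U \<bullet> V = cos b * cos c + sin b * sin c * cos (t + u)"
    unfolding U_V_N_def inner_vec_def sum_3 p q by (simp_all add: algebra_simps cos_add)
  have "\<bar>(U - cos p *\<^sub>R N) \<bullet> (V - cos q *\<^sub>R N)\<bar> \<le> norm (U - cos p *\<^sub>R N) * norm (V - cos q *\<^sub>R N)"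
    by (rule Cauchy_Schwarz_ineq2)
  also have "norm (U - cos p *\<^sub>R N) = sin p"
  proof -
    have "(norm (U - cos p *\<^sub>R N))\<^sup>2 = (sin p)\<^sup>2"
      unfolding power2_norm_eq_inner using un dots
      by (simp add: inner_diff_left inner_diff_right inner_commute sin_squared_eq) (simp add: power2_eq_square)
    then show ?thesis by (rule power2_eq_imp_eq) (use p(2) in auto)
  qed
  also have "norm (V - cos q *\<^sub>R N) = sin q"
  proof -
    have "(norm (V - cos q *\<^sub>R N))\<^sup>2 = (sin q)\<^sup>2"
      unfolding power2_norm_eq_inner using un dots
      by (simp add: inner_diff_left inner_diff_right inner_commute sin_squared_eq) (simp add: power2_eq_square)
    then show ?thesis by (rule power2_eq_imp_eq) (use q(2) in auto)
  qed
  also have "(U - cos p *\<^sub>R N) \<bullet> (V - cos q *\<^sub>R N) = U \<bullet> V - cos p * cos q"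
    using un dots by (simp add: inner_diff_left inner_diff_right inner_commute)
  finally show ?thesis unfolding dots(3) cos_add by linarith
qed

text \<open>The same configuration in the complex plane, with the common vertex at 0 and the shared
  side ending at the real number \<open>h\<close>.\<close>

lemma euclidean_triangle_ineq:
  fixes b c h p q t u :: real
  assumes p: "p\<^sup>2 = b\<^sup>2 + h\<^sup>2 - 2 * b * h * cos t" "0 \<le> p"
    and q: "q\<^sup>2 = h\<^sup>2 + c\<^sup>2 - 2 * h * c * cos u" "0 \<le> q"
  shows "b\<^sup>2 + c\<^sup>2 - 2 * b * c * cos (t + u) \<le> (p + q)\<^sup>2"
proof -
  define x z where "x = of_real b * cis t" "z = of_real c * cis (- u)"
  have sq: "(norm (of_real b * cis t - of_real c * cis u))\<^sup>2 = b\<^sup>2 + c\<^sup>2 - 2 * b * c * cos (t - u)" for b c t u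
  proof -
    have "(norm (of_real b * cis t - of_real c * cis u))\<^sup>2 
        = b\<^sup>2 * ((cos t)\<^sup>2 + (sin t)\<^sup>2) + c\<^sup>2 * ((cos u)\<^sup>2 + (sin u)\<^sup>2) - 2 * b * c * cos (t - u)"
      unfolding cmod_power2 cos_diff by (simp add: power2_eq_square algebra_simps del: sin_cos_squared_add sin_cos_squared_add2 sin_cos_squared_add3)
    then show ?thesis by simp
  qed
  have "(norm (x - of_real h))\<^sup>2 = p\<^sup>2" using sq[of b t h 0] p by (simp add: x_z_def)
  then have 1: "norm (x - of_real h) = p" by (rule power2_eq_imp_eq) (use p(2) in auto)
  have "(norm (of_real h - z))\<^sup>2 = q\<^sup>2" using sq[of h 0 c "-u"] q by (simp add: x_z_def)
  then have 2: "norm (of_real h - z) = q" by (rule power2_eq_imp_eq) (use q(2) in auto)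
  have "norm (x - z) \<le> p + q" using norm_triangle_ineq[of "x - of_real h" "of_real h - z"] 1 2 by simp
  then have "(norm (x - z))\<^sup>2 \<le> (p + q)\<^sup>2" by (intro power_mono) auto
  then show ?thesis using sq[of b t c "-u"] by (simp add: x_z_def)
qed

lemma cos_angle_law:
  assumes "K \<ge> 0" "triangle_sides K b c a"
  defines "t \<equiv> model_angle K b c a"
  shows "K = 0 \<Longrightarrow> a\<^sup>2 = b\<^sup>2 + c\<^sup>2 - 2 * b * c * cos t"
    "K > 0 \<Longrightarrow> cos (sqrt K * a) = cos (sqrt K * b) * cos (sqrt K * c) + sin (sqrt K * b) * sin (sqrt K * c) * cos t"
proof -
  have c: "cos t = cos_angle K b c a" unfolding t_def using assms cos_model_angle by blast
  show "K = 0 \<Longrightarrow> a\<^sup>2 = b\<^sup>2 + c\<^sup>2 - 2 * b * c * cos t"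
    unfolding c cos_angle_def using assms(2) by (simp add: triangle_sides_def)
  assume K: "K > 0"
  have "sin (sqrt K * b) > 0" "sin (sqrt K * c) > 0" 
    using triangle_sides_scaled[OF K assms(2)] by (auto intro: sin_gt_zero)
  then show "cos (sqrt K * a) = cos (sqrt K * b) * cos (sqrt K * c) + sin (sqrt K * b) * sin (sqrt K * c) * cos t"
    unfolding c cos_angle_def using K by simp
qed

text \<open>Glue the two comparison triangles along their common side of length \<open>h\<close>: the triangle inequality
  in the model space bounds the total angle, unless it exceeds \<open>pi\<close>, when \<open>p + q > b + c\<close>.\<close>

lemma model_angle_gluing:
  assumes K: "K \<ge> 0" and s: "triangle_sides K b h p" "triangle_sides K h c q" 
    and pq: "p + q \<le> b + c" "small_perimeter K (b + c + (p + q))"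
  shows "model_angle K b h p + model_angle K h c q \<le> model_angle K b c (p + q)"
proof -
  define t u where "t = model_angle K b h p" "u = model_angle K h c q"
  have tu: "0 \<le> t" "t \<le> pi" "0 \<le> u" "u \<le> pi" unfolding t_u_def by (auto simp: model_angle_bounds)
  note l1 = cos_angle_law[OF K s(1), folded t_u_def] and l2 = cos_angle_law[OF K s(2), folded t_u_def]
  have pos: "0 < b" "0 < h" "0 < c" "0 \<le> p" "0 \<le> q" using s unfolding triangle_sides_def by auto
  have neg: "cos u < cos (pi - t)" if "t + u > pi"
    using that tu by (intro cos_monotone_0_pi) auto
  show ?thesis
  proof (cases "K = 0")
    case True
    have le: "t + u \<le> pi"
    proof (rule ccontr)
      assume "\<not> ?thesis"
      then have n: "cos t + cos u < 0" using neg by simp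
      \<comment> \<open>\<open>b - h * cos t\<close> is the projection of the side \<open>p\<close>
        to the line of \<open>b\<close>. Adding the bounds for both triangles gives
        \<open>p + q >= b + c - h * (cos t + cos u)\<close>, which exceeds \<open>b + c\<close> if
        the angles exceed \<open>pi\<close>.\<close>
      have "\<bar>b - h * cos t\<bar> \<le> p"
      proof (rule abs_le_square_iff[THEN iffD2, of _ p, simplified abs_of_nonneg[OF pos(4)]])
        have "p\<^sup>2 - (b - h * cos t)\<^sup>2 = h\<^sup>2 * (1 - (cos t)\<^sup>2)" using l1(1)[OF True] by (simp add: power2_eq_square algebra_simps)
        also have "\<dots> \<ge> 0" by (simp add: abs_square_le_1)
        finally show "(b - h * cos t)\<^sup>2 \<le> p\<^sup>2" by simp
      qed
      moreover have "\<bar>c - h * cos u\<bar> \<le> q"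
      proof (rule abs_le_square_iff[THEN iffD2, of _ q, simplified abs_of_nonneg[OF pos(5)]])
        have "q\<^sup>2 - (c - h * cos u)\<^sup>2 = h\<^sup>2 * (1 - (cos u)\<^sup>2)" using l2(1)[OF True] by (simp add: power2_eq_square algebra_simps)
        also have "\<dots> \<ge> 0" by (simp add: abs_square_le_1)
        finally show "(c - h * cos u)\<^sup>2 \<le> q\<^sup>2" by simp
      qed
      moreover have "h * (cos t + cos u) < 0" using n pos by (simp add: mult_pos_neg)
      ultimately show False using pq by (simp add: distrib_left)
    qed
    have "b\<^sup>2 + c\<^sup>2 - 2 * b * c * cos (t + u) \<le> (p + q)\<^sup>2"
      by (rule euclidean_triangle_ineq[OF l1(1)[OF True] pos(4) l2(1)[OF True] pos(5)])
    then have "cos_angle K b c (p + q) \<le> cos (t + u)" using True pos unfolding cos_angle_def by (simp add: field_simps)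
    then show ?thesis using le_clamped_arccos le tu unfolding t_u_def[symmetric] model_angle_def[of K b c] by simp
  next
    case False
    then have K0: "K > 0" using K by simp
    define B C H P Q where "B = sqrt K * b" "C = sqrt K * c" "H = sqrt K * h" "P = sqrt K * p" "Q = sqrt K * q"
    note s1 = triangle_sides_scaled[OF K0 s(1), folded B_C_H_P_Q_def]
    note s2 = triangle_sides_scaled[OF K0 s(2), folded B_C_H_P_Q_def]
    note l1 = l1(2)[OF K0, folded B_C_H_P_Q_def] and l2 = l2(2)[OF K0, folded B_C_H_P_Q_def]
    have pq': "P + Q \<le> B + C" "B + C + (P + Q) < 2 * pi"
      using pq small_perimeter_scaled[OF K0] K0 unfolding B_C_H_P_Q_def by (auto simp: distrib_left simp flip: distrib_left)
    have sp: "0 \<le> sin P" "0 \<le> sin Q" using s1 s2 by (auto intro!: sin_ge_zero)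
    have sn: "0 < sin B" "0 < sin C" "0 < sin H" using s1 s2 by (auto intro!: sin_gt_zero)
    have le: "t + u \<le> pi"
    proof (rule ccontr)
      assume "\<not> ?thesis"
      then have n: "cos u < cos (pi - t)" using neg by simp
      \<comment> \<open>Shrink the second angle from \<open>u\<close> to \<open>pi - t\<close>, so
        that \<open>b\<close> and \<open>c\<close> become collinear; \<open>W\<close> is the cosine
        of the shortened third side \<open>Q'\<close>. The triangle inequality then gives
        \<open>cos (P + Q') <= cos (B + C)\<close>, against \<open>P + Q' < P + Q <= B + C\<close>
        and the perimeter bound.\<close>
      define W where "W = cos H * cos C + sin H * sin C * cos (pi - t)"
      have "sin H * sin C * cos u < sin H * sin C * cos (pi - t)"
        using n sn by (intro mult_strict_left_mono) auto
      then have W1: "cos Q < W" using l2 unfolding W_def by simp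
      have "W \<le> cos (H - C)"
        using sn mult_left_mono[OF cos_le_one[of "pi - t"], of "sin H * sin C"] unfolding W_def cos_diff by simp
      then have W2: "W \<le> 1" using cos_le_one order_trans by blast
      have W3: "-1 \<le> W" using W1 cos_ge_minus_one[of Q] by linarith
      define Q' where "Q' = arccos W"
      have Q': "cos Q' = W" "0 \<le> Q'" "Q' \<le> pi" using W2 W3 unfolding Q'_def by (auto simp: arccos_lbound arccos_ubound)
      have QQ: "Q' < Q"
      proof (rule ccontr)
        assume "\<not> ?thesis"
        then have "cos Q' \<le> cos Q" using s2 Q' by (intro cos_monotone_0_pi_le) auto
        then show False using W1 Q' by simp
      qed
      have "cos (P + Q') \<le> cos B * cos C + sin B * sin C * cos (t + (pi - t))"
        by (rule spherical_triangle_ineq[where h = H]) (use l1 Q' W_def sp in \<open>auto intro: sin_ge_zero\<close>)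
      then have c: "cos (P + Q') \<le> cos (B + C)" by (simp add: cos_add)
      have PQ: "0 \<le> P + Q'" "P + Q' < P + Q" "P + Q \<le> pi" using s1 Q' QQ pq' by auto
      show False
      proof (cases "B + C \<le> pi")
        case True
        then have "cos (B + C) < cos (P + Q')" using PQ pq' by (intro cos_monotone_0_pi) auto
        then show ?thesis using c by linarith
      next
        case False
        then have "cos (2 * pi - (B + C)) < cos (P + Q')" using PQ pq' by (intro cos_monotone_0_pi) auto
        moreover have "cos (2 * pi - (B + C)) = cos (B + C)" by (simp only: cos_2pi_minus)
        ultimately show ?thesis using c by linarith
      qed
    qed
    have "cos (P + Q) \<le> cos B * cos C + sin B * sin C * cos (t + u)"
      by (rule spherical_triangle_ineq[OF l1 sp(1) l2 sp(2)])
    then have "cos_angle K b c (p + q) \<le> cos (t + u)" using False sn unfolding cos_angle_def B_C_H_P_Q_def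
      by (simp add: field_simps)
    then show ?thesis using le_clamped_arccos le tu unfolding t_u_def[symmetric] model_angle_def[of K b c] by simp
  qed
qed

section \<open>Angles between circles of constant curvature and their chords\<close>

lemma half_tan_ge:
  assumes "K \<ge> 0" "0 \<le> x" "K > 0 \<Longrightarrow> sqrt K * x < pi"
  shows "x / 2 \<le> half_tan K x"
proof (cases "K = 0")
  case False
  then have K: "K > 0" using assms by simp
  have "sqrt K * x / 2 \<le> tan (sqrt K * x / 2)"
  proof (cases "x = 0")
    case False
    then show ?thesis using assms K abs_tan_ge[of "sqrt K * x / 2"] tan_gt_zero[of "sqrt K * x / 2"] by force
  qed simp
  then show ?thesis unfolding half_tan_def using K by (simp add: field_simps)
qed (simp add: half_tan_def)

lemma half_tan_strict_mono:
  assumes "K \<ge> 0" "0 \<le> x" "x < y" "K > 0 \<Longrightarrow> sqrt K * y < pi"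
  shows "half_tan K x < half_tan K y"
proof (cases "K = 0")
  case False
  then have K: "K > 0" using assms by simp
  have "tan (sqrt K * x / 2) < tan (sqrt K * y / 2)"
    using assms K by (intro tan_monotone) (auto intro: less_le_trans[of "-pi" 0])
  then show ?thesis unfolding half_tan_def using K by (simp add: field_simps)
qed (use assms in \<open>simp add: half_tan_def\<close>)

lemma half_tan_pos:
  assumes "K \<ge> 0" "0 < x" "K > 0 \<Longrightarrow> sqrt K * x < pi"
  shows "0 < half_tan K x"
  using half_tan_strict_mono[of K 0 x] assms by (simp add: half_tan_def[of K 0] split: if_splits)

lemma arcsin_le_of_le_sin:
  fixes v w :: real
  assumes "0 \<le> v" "0 \<le> w" "v \<le> sin w"
  shows "v \<le> 1" "arcsin v \<le> w"
proof -
  show v: "v \<le> 1" using assms sin_le_one order_trans by blast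
  show "arcsin v \<le> w"
  proof (cases "w \<le> pi / 2")
    case True
    have "arcsin v \<le> arcsin (sin w)" using assms v by (intro arcsin_le_arcsin) auto
    then show ?thesis using True assms by (simp add: arcsin_sin)
  next
    case False
    then show ?thesis using arcsin_ubound[of v] v assms by simp
  qed
qed

text \<open>Halving a chord: \<open>x\<close> is the common length of the two half chords, \<open>D\<close> that of the whole one.\<close>

lemma chord_doubling:
  assumes K: "K \<ge> 0" and k: "0 < k" and s: "triangle_sides K x x D" and D: "0 < D"
    and kx: "k * half_tan K x \<le> 1"
    and apex: "model_angle K x x D \<le> pi - 2 * arcsin (k * half_tan K x)"
  shows "k * half_tan K D \<le> 1" "arcsin (k * half_tan K D) \<le> arcsin (k * half_tan K x) + model_angle K x D x"
proof -
  define f t where "f = arcsin (k * half_tan K x)" "t = model_angle K x D x"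
  have s': "triangle_sides K x D x" using s D unfolding triangle_sides_def by (auto simp: algebra_simps)
  have x0: "0 < x" "K > 0 \<Longrightarrow> sqrt K * x < pi" "K > 0 \<Longrightarrow> sqrt K * D < pi"
    using s triangle_sides_scaled[OF _ s] by (auto simp: triangle_sides_def)
  have hx: "0 < half_tan K x" "0 < half_tan K D" using half_tan_pos K x0 D by auto
  have sf: "sin f = k * half_tan K x" unfolding f_t_def using kx hx k by (simp add: order_trans[of "-1" 0])
  have f0: "0 \<le> f" "f \<le> pi / 2" unfolding f_t_def using kx hx k arcsin_ubound[of "k * half_tan K x"]
    by (auto intro!: arcsin_nonneg simp: order_trans[of "-1" 0])
  have t0: "0 \<le> t" "t \<le> pi" unfolding f_t_def by (auto simp: model_angle_bounds)
  have "k * half_tan K D \<le> sin (f + t)"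
  proof (cases "K = 0")
    case True
    have "pi \<le> model_angle K x x D + model_angle K x D x + model_angle K D x x"
      using model_angle_sum[OF K s D] .
    \<comment> \<open>Both base angles equal \<open>t\<close>, and the apex leaves them at least
      \<open>2 * f\<close> together.\<close>
    then have ft: "f \<le> t" using apex unfolding f_t_def by (simp add: model_angle_commute[of K D x])
    have "x\<^sup>2 = x\<^sup>2 + D\<^sup>2 - 2 * x * D * cos t" using cos_angle_law(1)[OF K s' True] unfolding f_t_def .
    then have Dx: "D = 2 * x * cos t" using D by (simp add: power2_eq_square)
    have "0 \<le> sin (t - f)" using ft t0 f0 by (intro sin_ge_zero) auto
    then have "2 * (sin f * cos t) \<le> sin (f + t)" by (simp add: sin_add sin_diff algebra_simps)
    moreover have "k * half_tan K D = 2 * (sin f * cos t)" unfolding sf using True Dx by (simp add: half_tan_def)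
    ultimately show ?thesis by simp
  next
    case False
    then have K0: "K > 0" using K by simp
    define X E k' where "X = sqrt K * x" "E = sqrt K * D / 2" "k' = k / sqrt K"
    have X: "0 < X" "X < pi" "0 < E" "E < pi / 2" using x0 K0 D unfolding X_E_k'_def by auto
    have E2: "sqrt K * D = 2 * E" unfolding X_E_k'_def by simp
    have k': "0 < k'" "k * half_tan K x = k' * tan (X / 2)" "k * half_tan K D = k' * tan E"
      unfolding X_E_k'_def half_tan_def using K0 k False by auto
    have sX: "0 < sin X" "0 < cos E" "0 < sin E" using X by (auto intro!: sin_gt_zero cos_gt_zero)
    have cE: "cos (2 * E) = 2 * (cos E)\<^sup>2 - 1" by (simp add: cos_double_cos)
    have "cos X = cos X * cos (2 * E) + sin X * sin (2 * E) * cos t"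
      using cos_angle_law(2)[OF K s' K0] unfolding f_t_def(2)[symmetric] X_E_k'_def(1)[symmetric] E2 by simp
    then have "cos X * (1 - cos (2 * E)) = sin X * (2 * sin E * cos E) * cos t"
      unfolding sin_double[symmetric] by (simp add: algebra_simps)
    moreover have "1 - cos (2 * E) = 2 * (sin E)\<^sup>2" by (simp add: cos_double_sin)
    \<comment> \<open>The altitude cuts the isosceles triangle into two right triangles with
      hypotenuse \<open>X\<close>, leg \<open>E\<close> and adjacent angle \<open>t\<close>; this is
      the relation \<open>cos t = tan E / tan X\<close>.\<close>
    ultimately have c1: "cos X * sin E = sin X * cos E * cos t" using sX by (simp add: power2_eq_square)
    have "cos (pi - 2 * f) \<le> cos (model_angle K x x D)"
      using apex f0 unfolding f_t_def(1)[symmetric] by (intro cos_monotone_0_pi_le) (auto simp: model_angle_bounds)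
    then have ap: "2 * (sin f)\<^sup>2 - 1 \<le> cos (model_angle K x x D)" by (simp add: cos_double_sin)
    have "cos (2 * E) = cos X * cos X + sin X * sin X * cos (model_angle K x x D)"
      using cos_angle_law(2)[OF K s K0] unfolding X_E_k'_def(1)[symmetric] E2 .
    also have "\<dots> \<ge> cos X * cos X + sin X * sin X * (2 * (sin f)\<^sup>2 - 1)" using ap by (intro add_left_mono mult_left_mono) auto
    finally have "(cos X)\<^sup>2 + (sin X)\<^sup>2 * (2 * (sin f)\<^sup>2 - 1) \<le> 2 * (cos E)\<^sup>2 - 1"
      unfolding cE by (simp only: power2_eq_square)
    \<comment> \<open>Half of the apex angle is at most \<open>pi / 2 - f\<close>. In the right
      triangle its sine is \<open>sin E / sin X\<close>, which yields \<open>A\<close> below, and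
      its cosine is \<open>cos E * sin t\<close>, which yields \<open>B\<close>.\<close>
    then have I: "(cos X)\<^sup>2 + (sin X)\<^sup>2 * (sin f)\<^sup>2 \<le> (cos E)\<^sup>2"
      using sin_cos_squared_add[of X] unfolding right_diff_distrib by linarith
    have sE: "(sin E)\<^sup>2 \<le> (sin X * cos f)\<^sup>2"
      using I unfolding power_mult_distrib cos_squared_eq by (simp add: algebra_simps)
    have cf: "0 \<le> cos f" using f0 by (intro cos_ge_zero) auto
    have A: "sin E \<le> sin X * cos f" by (rule power2_le_imp_le[OF sE]) (use cf sX in auto)
    have "(cos E * sin t * sin X)\<^sup>2 = (cos E)\<^sup>2 * (sin X)\<^sup>2 - (sin X * cos E * cos t)\<^sup>2"
      unfolding power_mult_distrib sin_squared_eq[of t] by (simp add: algebra_simps)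
    also have "\<dots> = (cos E)\<^sup>2 - (cos X)\<^sup>2" unfolding c1[symmetric] power_mult_distrib sin_squared_eq by (simp add: algebra_simps)
    also have "\<dots> \<ge> (sin X * sin f)\<^sup>2" using I by (simp add: power_mult_distrib)
    finally have "(sin X * sin f)\<^sup>2 \<le> (cos E * sin t * sin X)\<^sup>2" .
    then have "sin X * sin f \<le> cos E * sin t * sin X"
      by (rule power2_le_imp_le) (use sX t0 in \<open>auto simp: sin_ge_zero\<close>)
    then have B: "sin f \<le> cos E * sin t" using sX by (simp add: mult.commute)
    have sf0: "0 \<le> sin f" using f0 by (intro sin_ge_zero) auto
    have ks: "k' * sin X = sin f * (1 + cos X)"
    proof -
      have "cos (X / 2) \<noteq> 0" using cos_gt_zero[of "X/2"] X by simp
      moreover have "1 + cos X = 2 * (cos (X / 2))\<^sup>2" using cos_double_cos[of "X/2"] by simp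
      moreover have "sin X = 2 * sin (X / 2) * cos (X / 2)" using sin_double[of "X/2"] by simp
      ultimately show ?thesis unfolding sf k' tan_def by (simp add: power2_eq_square)
    qed
    have "k' * sin E * sin X = sin E * (k' * sin X)" by simp
    also have "\<dots> = sin f * sin E * cos X + sin f * sin E" unfolding ks by (simp add: algebra_simps)
    also have "\<dots> \<le> sin f * (cos X * sin E) + sin f * (sin X * cos f)"
      using mult_left_mono[OF A sf0] by simp
    also have "\<dots> \<le> sin f * (cos X * sin E) + cos E * sin t * (sin X * cos f)"
      using B sX cf by (intro add_left_mono mult_right_mono) auto
    also have "\<dots> = sin (f + t) * cos E * sin X" unfolding c1 sin_add by (simp add: algebra_simps)
    finally have "k' * sin E \<le> sin (f + t) * cos E" using sX by simp
    then show ?thesis unfolding k'(3) tan_def using sX by (simp add: field_simps)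
  qed
  moreover have "0 \<le> k * half_tan K D" "0 \<le> f + t" using k hx f0 t0 by auto
  ultimately show "k * half_tan K D \<le> 1" "arcsin (k * half_tan K D) \<le> arcsin (k * half_tan K x) + model_angle K x D x"
    using arcsin_le_of_le_sin[of "k * half_tan K D" "f + t"] unfolding f_t_def by auto
qed

text \<open>The derivative at 0 of the angle as a function of the chord is
  \<open>k / 2 < k1 / 2\<close>. The slack is essential: for \<open>k1 = k\<close> the inequality is
  reversed, because tangent and inverse sine lie above the identity.\<close>

lemma short_chord_angle:
  assumes K: "K \<ge> 0" and k: "0 < k" "k < k1"
  shows "\<exists>r>0. \<forall>x. 0 < x \<and> x < r \<longrightarrow> k * half_tan K x \<le> 1 \<and> arcsin (k * half_tan K x) \<le> k1 / 2 * x"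
proof -
  have d: "((\<lambda>x. k * half_tan K x) has_real_derivative k / 2) (at 0)"
  proof (cases "K = 0")
    case True
    then show ?thesis unfolding half_tan_def by (auto intro!: derivative_eq_intros)
  next
    case False
    then have "sqrt K > 0" using K by simp
    then show ?thesis unfolding half_tan_def using False
      by (auto intro!: derivative_eq_intros simp: field_simps)
  qed
  have h0: "half_tan K 0 = 0" by (simp add: half_tan_def)
  have "((\<lambda>x. arcsin (k * half_tan K x)) has_real_derivative inverse (sqrt (1 - 0\<^sup>2)) * (k / 2)) (at 0)"
    by (rule DERIV_chain'[OF d]) (use h0 DERIV_arcsin[of 0] in simp)
  then have "((\<lambda>x. (arcsin (k * half_tan K x) - arcsin (k * half_tan K 0)) / (x - 0)) \<longlongrightarrow> k / 2) (at 0)"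
    unfolding has_field_derivative_iff by simp
  then have "((\<lambda>x. arcsin (k * half_tan K x) / x) \<longlongrightarrow> k / 2) (at 0)" by (simp add: h0)
  then have "((\<lambda>x. arcsin (k * half_tan K x) / x) \<longlongrightarrow> k / 2) (at_right 0)"
    by (rule tendsto_mono[OF at_le, rotated]) auto
  then have 1: "\<forall>\<^sub>F x in at_right 0. arcsin (k * half_tan K x) / x < k1 / 2"
    by (rule order_tendstoD) (use k in simp)
  have "((\<lambda>x. k * half_tan K x) \<longlongrightarrow> k * half_tan K 0) (at_right 0)"
    using DERIV_isCont[OF d] unfolding isCont_def by (rule tendsto_mono[OF at_le, rotated]) auto
  then have 2: "\<forall>\<^sub>F x in at_right 0. k * half_tan K x < 1"
    by (rule order_tendstoD) (use h0 in simp)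
  have "\<forall>\<^sub>F x in at_right 0. arcsin (k * half_tan K x) / x < k1 / 2 \<and> k * half_tan K x < 1"
    using 1 2 by (rule eventually_conj)
  then obtain r where r: "r > 0" "\<And>x. 0 < x \<Longrightarrow> x < r \<Longrightarrow> arcsin (k * half_tan K x) / x < k1 / 2 \<and> k * half_tan K x < 1"
    unfolding eventually_at_right_field by auto
  show ?thesis
  proof (intro exI[of _ r] conjI allI impI)
    fix x assume x: "0 < x \<and> x < r"
    then show "k * half_tan K x \<le> 1" using r(2)[of x] by simp
    show "arcsin (k * half_tan K x) \<le> k1 / 2 * x" using r(2)[of x] x by (simp add: divide_less_eq)
  qed (rule r)
qed

text \<open>The assumption \<open>k * half_tan K x <= 1\<close> keeps every side at a distance from
  \<open>pi / sqrt K\<close>. If the perimeter is nearly maximal, no side can be short, so the angle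
  stays below \<open>pi\<close> by a fixed amount. This separates \<open>cos A\<close> from
  \<open>cos (B + C)\<close> by a constant \<open>h\<close>, and the Lipschitz bound for the cosine
  turns \<open>h\<close> into a gap in the perimeter. The first conjunct treats triangles with two
  equal vertices.\<close>

lemma perimeter_gap:
  assumes K: "K > 0" and k: "0 < k"
  shows "\<exists>e>0. (\<forall>b\<ge>0. sqrt K * b < pi \<longrightarrow> k * half_tan K b \<le> 1 \<longrightarrow> 2 * b \<le> 2 * pi / sqrt K - e) \<and>
    (\<forall>b c a. triangle_sides K b c a \<longrightarrow> k * half_tan K b \<le> 1 \<longrightarrow> k * half_tan K c \<le> 1 \<longrightarrow> k * half_tan K a \<le> 1 \<longrightarrow>
       model_angle K b c a \<le> pi - arcsin (k * half_tan K b) - arcsin (k * half_tan K c) \<longrightarrow>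
       a + b + c \<le> 2 * pi / sqrt K - e)"
proof -
  define s where "s = sqrt K"
  have s: "s > 0" using K unfolding s_def by simp
  \<comment> \<open>\<open>pi - d\<close> is the scaled diameter of a circle of curvature
    \<open>k\<close>, the longest chord with \<open>k * half_tan K b <= 1\<close>.\<close>
  define d where "d = pi - 2 * arctan (s / k)"
  have "arctan (s / k) < pi / 2" by (rule arctan_ubound)
  then have d: "d > 0" unfolding d_def by simp
  have side: "s * b \<le> pi - d" if "0 \<le> b" "s * b < pi" "k * half_tan K b \<le> 1" for b
  proof -
    have "tan (s * b / 2) \<le> s / k" using that(3) K k s unfolding half_tan_def s_def by (simp add: field_simps)
    then have "arctan (tan (s * b / 2)) \<le> arctan (s / k)" by (simp add: arctan_le_iff)
    moreover have "0 \<le> s * b" using that s by simp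
    then have "arctan (tan (s * b / 2)) = s * b / 2" using that by (intro arctan_tan) auto
    ultimately show ?thesis unfolding d_def by simp
  qed
  define h where "h = 2 * (k * half_tan K (d / s))\<^sup>2 * (sin d)\<^sup>2"
  have dpi: "d < pi"
  proof -
    have "0 < arctan (s / k)" using s k by simp
    then show ?thesis unfolding d_def by linarith
  qed
  then have sd: "0 < sin d" using d by (intro sin_gt_zero)
  have hd: "0 < half_tan K (d / s)" using half_tan_pos[of K "d / s"] K d s dpi unfolding s_def[symmetric] by simp
  have h: "h > 0" unfolding h_def using hd k sd by simp
  define e where "e = min d h / s"
  have e: "e > 0" unfolding e_def using d h s by simp
  have se: "s * e = min d h" unfolding e_def using s by simp
  have conv: "p \<le> 2 * pi / sqrt K - e" if "s * p \<le> 2 * pi - min d h" for p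
    using that s unfolding s_def[symmetric] e_def by (simp add: field_simps)
  show ?thesis
  proof (intro exI[of _ e] conjI e allI impI)
    fix b assume b: "0 \<le> b" "sqrt K * b < pi" "k * half_tan K b \<le> 1"
    have "s * b \<le> pi - d" using side b unfolding s_def by blast
    then show "2 * b \<le> 2 * pi / sqrt K - e" using d by (intro conv) auto
  next
    fix b c a assume t: "triangle_sides K b c a" and kt: "k * half_tan K b \<le> 1" "k * half_tan K c \<le> 1" "k * half_tan K a \<le> 1"
      and an: "model_angle K b c a \<le> pi - arcsin (k * half_tan K b) - arcsin (k * half_tan K c)"
    note sc = triangle_sides_scaled[OF K t, folded s_def]
    have t0: "0 < b" "0 < c" "0 \<le> a" using t unfolding triangle_sides_def by auto
    have sd3: "s * b \<le> pi - d" "s * c \<le> pi - d" "s * a \<le> pi - d" using side kt sc t0 by auto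
    show "a + b + c \<le> 2 * pi / sqrt K - e"
    proof (cases "s * (a + b + c) \<le> 2 * pi - d")
      case True
      then show ?thesis by (intro conv) auto
    next
      case False
      define B C A where "B = s * b" "C = s * c" "A = s * a"
      \<comment> \<open>Two sides of scaled length at most \<open>pi - d\<close> leave at least
        \<open>d\<close> for the third when the perimeter exceeds \<open>2 * pi - d\<close>.\<close>
      have big: "d \<le> B" "d \<le> C" "B \<le> pi - d" "C \<le> pi - d" "A \<le> pi - d" "0 \<le> A"
        using False sd3 sc unfolding B_C_A_def by (auto simp: distrib_left)
      have sB: "sin d \<le> sin B" if "d \<le> B" "B \<le> pi - d" for B
      proof (cases "B \<le> pi / 2")
        case True then show ?thesis using that d by (intro sin_monotone_2pi_le) auto
      next
        case False
        have "sin d \<le> sin (pi - B)" using that d False by (intro sin_monotone_2pi_le) auto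
        then show ?thesis by simp
      qed
      have mono: "k * half_tan K (d / s) \<le> k * half_tan K x" if "d \<le> s * x" "s * x < pi" for x
      proof (cases "d / s = x")
        case False
        then have "d / s < x" using that s by (simp add: field_simps) 
        then have "half_tan K (d / s) < half_tan K x"
          using that s K d unfolding s_def by (intro half_tan_strict_mono) auto
        then show ?thesis using k by simp
      qed simp
      define f where "f = arcsin (k * half_tan K (d / s))"
      have ge: "f \<le> arcsin (k * half_tan K x)" if "d \<le> s * x" "s * x < pi" "k * half_tan K x \<le> 1" for x
        unfolding f_def using mono[OF that(1,2)] that(3) hd k by (intro arcsin_le_arcsin) (auto simp: order_trans[of "-1" 0])
      have fle: "k * half_tan K (d / s) \<le> 1" using mono[of b] big sc kt unfolding B_C_A_def by force
      have f0: "0 \<le> f" "sin f = k * half_tan K (d / s)" unfolding f_def using fle hd k 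
        by (auto intro!: arcsin_nonneg simp: order_trans[of "-1" 0])
      have "model_angle K b c a \<le> pi - 2 * f" using an ge[of b] ge[of c] big sc kt unfolding B_C_A_def by auto
      then have "cos (pi - 2 * f) \<le> cos (model_angle K b c a)"
        using f0 by (intro cos_monotone_0_pi_le) (auto simp: model_angle_bounds)
      then have ct: "2 * (sin f)\<^sup>2 - 1 \<le> cos (model_angle K b c a)" by (simp add: cos_double_sin)
      have pp: "(sin d)\<^sup>2 \<le> sin B * sin C" unfolding power2_eq_square using sB[of B] sB[of C] big sd by (intro mult_mono) auto
      have "cos A = cos B * cos C + sin B * sin C * cos (model_angle K b c a)"
        using cos_angle_law(2)[OF _ t K] K unfolding s_def[symmetric] B_C_A_def by simp
      also have "\<dots> \<ge> cos B * cos C + sin B * sin C * (2 * (sin f)\<^sup>2 - 1)"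
        using ct order_trans[OF zero_le_power2 pp] by (intro add_left_mono mult_left_mono) auto
      finally have "cos (B + C) + sin B * sin C * (2 * (sin f)\<^sup>2) \<le> cos A" by (simp add: cos_add algebra_simps)
      moreover have "(sin d)\<^sup>2 * (2 * (sin f)\<^sup>2) \<le> sin B * sin C * (2 * (sin f)\<^sup>2)" using pp by (intro mult_right_mono) auto
      ultimately have "cos (B + C) + h \<le> cos A" unfolding h_def f0 by (simp add: algebra_simps)
      moreover have "cos A = cos (2 * pi - A)" by (simp add: cos_diff)
      moreover have "\<bar>cos (2 * pi - A) - cos (B + C)\<bar> \<le> \<bar>(2 * pi - A) - (B + C)\<bar>"
      proof -
        have "norm (cos (2 * pi - A) - cos (B + C)) \<le> 1 * norm ((2 * pi - A) - (B + C))"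
          by (rule field_differentiable_bound[where S = UNIV and f' = "\<lambda>x. - sin x"])
             (auto intro!: derivative_eq_intros)
        then show ?thesis by simp
      qed
      moreover have "A + B + C < 2 * pi" using sc(7) unfolding B_C_A_def .
      ultimately have "h \<le> 2 * pi - (A + B + C)" by linarith
      then show ?thesis by (intro conv) (auto simp: B_C_A_def distrib_left)
    qed
  qed
qed

section \<open>The circumscribed circle\<close>

definition gram3 :: "real \<Rightarrow> real \<Rightarrow> real \<Rightarrow> real" where
  "gram3 x y z = 1 - x\<^sup>2 - y\<^sup>2 - z\<^sup>2 + 2 * x * y * z"

text \<open>The square of twice the area of the triangle of unit vectors with inner products \<open>x, y, z\<close>.\<close>

definition chord_area :: "real \<Rightarrow> real \<Rightarrow> real \<Rightarrow> real" where
  "chord_area x y z = (2 - 2 * x) * (2 - 2 * y) - (1 - x - y + z)\<^sup>2"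

text \<open>A line meets the unit sphere in at most two points, so three different unit vectors are
  not collinear and Cauchy-Schwarz is strict for the two chords.\<close>

lemma chord_area_pos:
  fixes A B C :: "real^3"
  assumes n: "norm A = 1" "norm B = 1" "norm C = 1" and ne: "A \<noteq> B" "A \<noteq> C" "B \<noteq> C"
  shows "0 < chord_area (A \<bullet> B) (A \<bullet> C) (B \<bullet> C)"
proof -
  have aa: "A \<bullet> A = 1" "B \<bullet> B = 1" "C \<bullet> C = 1" using n by (simp_all add: dot_square_norm)
  define p q where "p = B - A" "q = C - A"
  have e: "chord_area (A \<bullet> B) (A \<bullet> C) (B \<bullet> C) = (norm p * norm q)\<^sup>2 - (p \<bullet> q)\<^sup>2"
    unfolding chord_area_def p_q_def power_mult_distrib power2_norm_eq_inner
    using aa by (simp add: inner_diff_left inner_diff_right inner_commute power2_eq_square algebra_simps)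
  have "\<bar>p \<bullet> q\<bar> \<noteq> norm p * norm q"
  proof
    assume "\<bar>p \<bullet> q\<bar> = norm p * norm q"
    then have "collinear {0, p, q}" by (simp add: norm_cauchy_schwarz_equal)
    then obtain t where t: "q = t *\<^sub>R p" using ne unfolding collinear_lemma p_q_def by auto
    then have C: "C = A + t *\<^sub>R (B - A)" unfolding p_q_def by (simp add: algebra_simps)
    have "1 = (A + t *\<^sub>R (B - A)) \<bullet> (A + t *\<^sub>R (B - A))" using aa C by simp
    also have "\<dots> = 1 + 2 * t * (A \<bullet> B - 1) + t\<^sup>2 * (2 - 2 * (A \<bullet> B))"
      using aa by (simp add: inner_diff_left inner_diff_right inner_add_left inner_add_right inner_commute power2_eq_square algebra_simps)
    finally have "(t\<^sup>2 - t) * (1 - A \<bullet> B) = 0" by (simp add: algebra_simps)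
    moreover have "t \<noteq> 0" "t \<noteq> 1" using C ne by auto
    then have "t\<^sup>2 - t \<noteq> 0" by (simp add: power2_eq_square)
    ultimately have "A \<bullet> B = 1" by simp
    then have "(norm (A - B))\<^sup>2 = 0" unfolding power2_norm_eq_inner using aa
      by (simp add: inner_diff_left inner_diff_right inner_commute)
    then show False using ne by simp
  qed
  then have "\<bar>p \<bullet> q\<bar> < norm p * norm q" using Cauchy_Schwarz_ineq2[of p q] by simp
  then have "\<bar>p \<bullet> q\<bar>\<^sup>2 < (norm p * norm q)\<^sup>2" by (intro power_strict_mono) auto
  then show ?thesis unfolding e by simp
qed

text \<open>The normal \<open>N\<close> of the plane through the three points is a multiple of
  \<open>n\<close>. Its squared length is \<open>chord_area\<close>, and
  \<open>A \<bullet> N\<close> is the determinant of the three vectors, whose square is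
  \<open>gram3\<close>; comparing both gives \<open>h\<close>.\<close>

lemma plane_distance_unit_vectors:
  fixes A B C n :: "real^3"
  assumes un: "norm n = 1" "norm A = 1" "norm B = 1" "norm C = 1"
    and h: "n \<bullet> A = h" "n \<bullet> B = h" "n \<bullet> C = h"
  shows "h\<^sup>2 * chord_area (A \<bullet> B) (A \<bullet> C) (B \<bullet> C) = gram3 (A \<bullet> B) (A \<bullet> C) (B \<bullet> C)"
proof -
  have aa: "A \<bullet> A = 1" "B \<bullet> B = 1" "C \<bullet> C = 1" "n \<bullet> n = 1" using un by (simp_all add: dot_square_norm)
  define p q where "p = B - A" "q = C - A"
  define N where "N = cross3 p q"
  have "n \<bullet> p = 0" "n \<bullet> q = 0" unfolding p_q_def using h by (simp_all add: inner_diff_right)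
  then have "cross3 n N = 0" unfolding N_def Lagrange by (simp add: inner_commute)
  moreover have "cross3 n (cross3 n N) = (n \<bullet> N) *\<^sub>R n - (n \<bullet> n) *\<^sub>R N" by (rule Lagrange)
  ultimately have N: "N = (n \<bullet> N) *\<^sub>R n" using aa by simp
  have "(A \<bullet> N)\<^sup>2 = (n \<bullet> N)\<^sup>2 * h\<^sup>2"
    by (subst N) (simp add: h inner_commute[of A n] power_mult_distrib)
  moreover have "(norm N)\<^sup>2 = (n \<bullet> N)\<^sup>2" by (subst N) (simp add: un power_mult_distrib)
  moreover have "(norm N)\<^sup>2 = (norm p * norm q)\<^sup>2 - (p \<bullet> q)\<^sup>2" unfolding N_def using norm_cross_dot[of p q] by simp
  moreover have "\<dots> = chord_area (A \<bullet> B) (A \<bullet> C) (B \<bullet> C)"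
    unfolding chord_area_def p_q_def power_mult_distrib power2_norm_eq_inner
    using aa by (simp add: inner_diff_left inner_diff_right inner_commute power2_eq_square algebra_simps)
  moreover have "(A \<bullet> N)\<^sup>2 = gram3 (A \<bullet> B) (A \<bullet> C) (B \<bullet> C)"
  proof -
    have "A \<bullet> N = A \<bullet> cross3 B C"
      unfolding N_def p_q_def cross3_def inner_vec_def sum_3 by (simp add: algebra_simps)
    moreover have "(A \<bullet> cross3 B C)\<^sup>2 = (A \<bullet> A) * (B \<bullet> B) * (C \<bullet> C) - (A \<bullet> A) * (B \<bullet> C)\<^sup>2 - (B \<bullet> B) * (A \<bullet> C)\<^sup>2
       - (C \<bullet> C) * (A \<bullet> B)\<^sup>2 + 2 * (A \<bullet> B) * (A \<bullet> C) * (B \<bullet> C)"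
      unfolding cross3_def inner_vec_def sum_3 by (simp add: algebra_simps power2_eq_square)
    ultimately show ?thesis unfolding gram3_def aa by simp
  qed
  ultimately show ?thesis by simp
qed

text \<open>The classical formula for the circumradius, product of the sides over four times the
  area, squared and cleared of its denominator.\<close>

lemma planar_circumcircle:
  fixes A B C o' :: "real^3"
  assumes pl: "A $ 3 = 0" "B $ 3 = 0" "C $ 3 = 0" "o' $ 3 = 0" and R: "dist o' A = R" "dist o' B = R" "dist o' C = R"
  shows "R\<^sup>2 * (4 * (dist A B)\<^sup>2 * (dist A C)\<^sup>2 - ((dist A B)\<^sup>2 + (dist A C)\<^sup>2 - (dist B C)\<^sup>2)\<^sup>2)
     = (dist A B * dist A C * dist B C)\<^sup>2"
proof -
  define u p q where "u = o' - A" "p = B - A" "q = C - A"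
  have d: "(dist A B)\<^sup>2 = p \<bullet> p" "(dist A C)\<^sup>2 = q \<bullet> q" "(dist B C)\<^sup>2 = p \<bullet> p + q \<bullet> q - 2 * (p \<bullet> q)" "R\<^sup>2 = u \<bullet> u"
    unfolding u_p_q_def R(1)[symmetric] dist_norm power2_norm_eq_inner
    by (simp_all add: inner_diff_left inner_diff_right inner_commute)
  have e1: "2 * (u \<bullet> p) = p \<bullet> p"
  proof -
    have "(dist o' B)\<^sup>2 = (dist o' A)\<^sup>2" using R by simp
    then show ?thesis unfolding u_p_q_def dist_norm power2_norm_eq_inner
      by (simp add: inner_diff_left inner_diff_right inner_commute)
  qed
  have e2: "2 * (u \<bullet> q) = q \<bullet> q"
  proof -
    have "(dist o' C)\<^sup>2 = (dist o' A)\<^sup>2" using R by simp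
    then show ?thesis unfolding u_p_q_def dist_norm power2_norm_eq_inner
      by (simp add: inner_diff_left inner_diff_right inner_commute)
  qed
  have z: "u $ 3 = 0" "p $ 3 = 0" "q $ 3 = 0" unfolding u_p_q_def using pl by auto
  \<comment> \<open>This is the vanishing of the Gram determinant of three vectors of a
    plane.\<close>
  have "(u \<bullet> u) * ((p \<bullet> p) * (q \<bullet> q) - (p \<bullet> q)\<^sup>2) = (u \<bullet> p)\<^sup>2 * (q \<bullet> q) - 2 * (u \<bullet> p) * (u \<bullet> q) * (p \<bullet> q) + (u \<bullet> q)\<^sup>2 * (p \<bullet> p)"
    unfolding inner_vec_def sum_3 using z by (simp add: algebra_simps power2_eq_square)
  then have id: "4 * ((u \<bullet> u) * ((p \<bullet> p) * (q \<bullet> q) - (p \<bullet> q)\<^sup>2)) =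
      (2 * (u \<bullet> p))\<^sup>2 * (q \<bullet> q) - 2 * (2 * (u \<bullet> p)) * (2 * (u \<bullet> q)) * (p \<bullet> q) + (2 * (u \<bullet> q))\<^sup>2 * (p \<bullet> p)"
    by (simp add: power2_eq_square)
  show ?thesis unfolding d power_mult_distrib using id[unfolded e1 e2] by (simp add: algebra_simps power2_eq_square)
qed

text \<open>In the plane this is 16 times the squared area over the squared product of the sides. On
  the sphere the plane of the circle has scaled distance \<open>h\<close> from the centre, with
  \<open>h\<^sup>2 = gram3 / chord_area\<close>, and the squared curvature
  \<open>K * cot\<^sup>2\<close> becomes \<open>K * h\<^sup>2 / (1 - h\<^sup>2)\<close>.\<close>

definition circumcurvature_sq :: "real \<Rightarrow> real \<Rightarrow> real \<Rightarrow> real \<Rightarrow> real" where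
  "circumcurvature_sq K x y z =
    (if K = 0 then (4 * x\<^sup>2 * y\<^sup>2 - (x\<^sup>2 + y\<^sup>2 - z\<^sup>2)\<^sup>2) / (x * y * z)\<^sup>2
     else let c = cos (sqrt K * x); d = cos (sqrt K * y); e = cos (sqrt K * z)
       in K * gram3 c d e / (chord_area c d e - gram3 c d e))"

lemma cos_arccos_inner:
  fixes x y :: "real^3"
  assumes "K > 0" "norm x = 1 / sqrt K" "norm y = 1 / sqrt K"
  shows "norm (sqrt K *\<^sub>R x) = 1" "norm (sqrt K *\<^sub>R y) = 1" "(sqrt K *\<^sub>R x) \<bullet> (sqrt K *\<^sub>R y) = K * (x \<bullet> y)" "\<bar>K * (x \<bullet> y)\<bar> \<le> 1"
proof -
  show 1: "norm (sqrt K *\<^sub>R x) = 1" "norm (sqrt K *\<^sub>R y) = 1" using assms by simp_all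
  show 2: "(sqrt K *\<^sub>R x) \<bullet> (sqrt K *\<^sub>R y) = K * (x \<bullet> y)" using assms by simp
  show "\<bar>K * (x \<bullet> y)\<bar> \<le> 1" using Cauchy_Schwarz_ineq2[of "sqrt K *\<^sub>R x" "sqrt K *\<^sub>R y"] unfolding 1 2 by simp
qed

lemma model_dist_cos:
  assumes "K > 0" "x \<in> model_space K" "y \<in> model_space K"
  shows "cos (sqrt K * model_dist K x y) = (sqrt K *\<^sub>R x) \<bullet> (sqrt K *\<^sub>R y)"
  using cos_arccos_inner[of K x y] assms unfolding model_dist_def model_space_def by (simp add: cos_arccos_abs)

lemma circumcurvature_unique:
  assumes K: "K \<ge> 0" and ne: "a \<noteq> b" "b \<noteq> c" "a \<noteq> c"
    and tr: "comparison_triangle K a b c a' b' c'" and C: "model_circle K C k" "a' \<in> C" "b' \<in> C" "c' \<in> C" and k: "0 \<le> k"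
  shows "k = sqrt (circumcurvature_sq K (dist a b) (dist b c) (dist c a))"
proof -
  note tr = tr[unfolded comparison_triangle_def]
  have d0: "dist a b > 0" "dist b c > 0" "dist c a > 0" using ne by auto
  have "k\<^sup>2 = circumcurvature_sq K (dist a b) (dist b c) (dist c a)"
  proof (cases "K = 0")
    case True
    have d: "dist b' a' = dist a b" "dist b' c' = dist b c" "dist a' c' = dist c a"
      using tr True unfolding model_dist_def by (auto simp: dist_commute)
    have pl: "a' $ 3 = 0" "b' $ 3 = 0" "c' $ 3 = 0" using tr True unfolding model_space_def by auto
    let ?S = "4 * (dist a b)\<^sup>2 * (dist b c)\<^sup>2 - ((dist a b)\<^sup>2 + (dist b c)\<^sup>2 - (dist c a)\<^sup>2)\<^sup>2"
    have "k\<^sup>2 * (dist a b * dist b c * dist c a)\<^sup>2 = ?S"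
      using C(1) unfolding model_circle_def
    proof (elim disjE exE conjE)
      fix m r assume m: "m \<in> model_space K" "0 < r" "C = {x \<in> model_space K. model_dist K m x = r}"
        "if K = 0 then k = 1 / r else r \<le> pi / (2 * sqrt K) \<and> k = sqrt K * cot (sqrt K * r)"
      have "r\<^sup>2 * ?S = (dist a b * dist b c * dist c a)\<^sup>2"
        using planar_circumcircle[of b' a' c' m r] pl m C True d unfolding model_space_def model_dist_def by auto
      then have "k\<^sup>2 * (dist a b * dist b c * dist c a)\<^sup>2 = (k * r)\<^sup>2 * ?S" by (simp add: power_mult_distrib)
      moreover have "k * r = 1" using m True by simp
      ultimately show ?thesis by simp
    next
      fix u v assume uv: "k = 0" "C = {u + t *\<^sub>R v |t. True}"
      then obtain t1 t2 t3 where t: "a' = u + t1 *\<^sub>R v" "b' = u + t2 *\<^sub>R v" "c' = u + t3 *\<^sub>R v" using C by auto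
      have "(dist a b)\<^sup>2 = (t1 - t2)\<^sup>2 * (v \<bullet> v)" "(dist b c)\<^sup>2 = (t2 - t3)\<^sup>2 * (v \<bullet> v)" "(dist c a)\<^sup>2 = (t3 - t1)\<^sup>2 * (v \<bullet> v)"
        unfolding d[symmetric] t dist_norm power2_norm_eq_inner 
        by (simp_all add: power2_eq_square inner_diff_left inner_diff_right algebra_simps)
      then have "?S = 0" by (simp only:) (simp add: power2_eq_square algebra_simps)
      then show ?thesis using uv by simp
    qed
    then show ?thesis unfolding circumcurvature_sq_def using True d0 by (simp add: field_simps)
  next
    case False
    then have K0: "K > 0" using K by simp
    obtain m r where m: "m \<in> model_space K" "0 < r" "C = {x \<in> model_space K. model_dist K m x = r}"
        "r \<le> pi / (2 * sqrt K)" "k = sqrt K * cot (sqrt K * r)"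
      using C(1) False unfolding model_circle_def by auto
    define A B D n h where "A = sqrt K *\<^sub>R a'" "B = sqrt K *\<^sub>R b'" "D = sqrt K *\<^sub>R c'" "n = sqrt K *\<^sub>R m" "h = cos (sqrt K * r)"
    have sp: "a' \<in> model_space K" "b' \<in> model_space K" "c' \<in> model_space K" using tr by auto
    have un: "norm A = 1" "norm B = 1" "norm D = 1" "norm n = 1"
      unfolding A_B_D_n_h_def using sp m(1) K0 False unfolding model_space_def by auto
    have nh: "n \<bullet> A = h" "n \<bullet> B = h" "n \<bullet> D = h"
    proof -
      have "n \<bullet> (sqrt K *\<^sub>R x) = h" if "x \<in> C" for x
        using that model_dist_cos[OF K0 m(1), of x] unfolding m(3) A_B_D_n_h_def by auto
      then show "n \<bullet> A = h" "n \<bullet> B = h" "n \<bullet> D = h" unfolding A_B_D_n_h_def(1-3) using C by blast+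
    qed
    have dd: "B \<bullet> A = cos (sqrt K * dist a b)" "B \<bullet> D = cos (sqrt K * dist b c)" "A \<bullet> D = cos (sqrt K * dist c a)"
      using model_dist_cos[OF K0 sp(1) sp(2)] model_dist_cos[OF K0 sp(2) sp(3)] model_dist_cos[OF K0 sp(3) sp(1)] tr
      unfolding A_B_D_n_h_def by (simp_all add: inner_commute)
    have sr: "0 < sqrt K * r" "sqrt K * r \<le> pi / 2" using m K0 by (auto simp: field_simps)
    have s: "0 < sin (sqrt K * r)" using sr by (intro sin_gt_zero) auto
    have ne': "B \<noteq> A" "B \<noteq> D" "A \<noteq> D"
    proof -
      have "model_dist K x x = 0" if "x \<in> model_space K" for x
        using that K0 False unfolding model_dist_def model_space_def
        by (auto simp: dot_square_norm power_divide)
      then have "b' \<noteq> a'" "b' \<noteq> c'" "a' \<noteq> c'" using tr d0 by (metis less_irrefl)+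
      then show "B \<noteq> A" "B \<noteq> D" "A \<noteq> D" using K0 unfolding A_B_D_n_h_def by auto
    qed
    define G W where "G = gram3 (B \<bullet> A) (B \<bullet> D) (A \<bullet> D)" "W = chord_area (B \<bullet> A) (B \<bullet> D) (A \<bullet> D)"
    have hG: "h\<^sup>2 * W = G" unfolding G_W_def using plane_distance_unit_vectors un nh by blast
    have W: "W > 0" unfolding G_W_def using chord_area_pos un ne' by blast
    have WG: "W - G = (sin (sqrt K * r))\<^sup>2 * W" using hG A_B_D_n_h_def(5) by (simp add: sin_squared_eq algebra_simps)
    have "k\<^sup>2 = K * (h\<^sup>2 / (sin (sqrt K * r))\<^sup>2)" unfolding m(5) A_B_D_n_h_def(5) cot_def using K0
      by (simp add: power_mult_distrib power_divide)
    also have "\<dots> = K * G / (W - G)" unfolding WG using W s by (simp flip: hG)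
    finally show ?thesis unfolding circumcurvature_sq_def G_W_def dd using False by (simp add: Let_def)
  qed
  then show ?thesis using k by (metis real_sqrt_unique)
qed

text \<open>The global curvature bound also concerns triangles of perimeter exactly
  \<open>2 * pi / sqrt K\<close>, which \<open>triangle_sides\<close> excludes; they lie on a great
  circle, and the angle \<open>pi\<close> serves.\<close>

lemma spherical_third_side:
  assumes "0 < x" "0 < y" "0 \<le> z" "z \<le> x + y" "x \<le> z + y" "y \<le> z + x" "x + y + z \<le> 2 * pi"
  shows "\<exists>t. cos z = cos x * cos y + sin x * sin y * cos t"
proof (cases "x + y + z = 2 * pi")
  case True
  then have "z = 2 * pi - (x + y)" by simp
  then have "cos z = cos (x + y)" by (simp only: cos_2pi_minus)
  then show ?thesis by (intro exI[of _ pi]) (simp add: cos_add)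
next
  case False
  then have "triangle_sides 1 x y z" unfolding triangle_sides_def small_perimeter_def using assms by auto
  from cos_angle_law(2)[OF _ this] show ?thesis by auto
qed

lemma inner_vector_3: "(vector [a, b, c] :: real^3) \<bullet> vector [d, e, f] = a * d + b * e + c * f"
  by (simp add: inner_vec_def sum_3)

lemma circumcircle_exists_sphere:
  fixes a b c :: "'a::metric_space"
  assumes K: "K > 0" and ne: "a \<noteq> b" "b \<noteq> c" "a \<noteq> c"
    and per: "dist a b + dist b c + dist c a \<le> 2 * pi / sqrt K"
  shows "\<exists>k\<ge>0. \<exists>a' b' c' C. comparison_triangle K a b c a' b' c' \<and> model_circle K C k \<and> a' \<in> C \<and> b' \<in> C \<and> c' \<in> C"
proof -
  define s where "s = sqrt K"
  have s: "s > 0" "s * s = K" unfolding s_def using K by auto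
  define x y z where "x = s * dist a b" "y = s * dist b c" "z = s * dist c a"
  have p: "x + y + z \<le> 2 * pi" using per s unfolding x_y_z_def s_def[symmetric] by (simp add: field_simps)
  have pos: "0 < x" "0 < y" "0 < z" using ne s unfolding x_y_z_def by auto
  have ti: "z \<le> x + y" "x \<le> z + y" "y \<le> z + x"
    unfolding x_y_z_def using s dist_triangle[of c a b] dist_triangle[of a b c] dist_triangle[of b c a]
    by (simp_all add: dist_commute flip: distrib_left)
  obtain t where t: "cos z = cos x * cos y + sin x * sin y * cos t"
    using spherical_third_side[of x y z] pos ti p by auto
  define B A D :: "real^3" where "B = vector [0, 0, 1]" "A = vector [sin x, 0, cos x]" "D = vector [sin y * cos t, sin y * sin t, cos y]"
  have aa: "A \<bullet> A = 1" "B \<bullet> B = 1" "D \<bullet> D = 1"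
    unfolding B_A_D_def inner_vector_3 polar_norm by (simp_all flip: power2_eq_square)
  then have un: "norm A = 1" "norm B = 1" "norm D = 1" by (simp_all add: norm_eq_1)
  have dots: "A \<bullet> B = cos x" "B \<bullet> D = cos y" "D \<bullet> A = cos z"
    unfolding B_A_D_def inner_vector_3 t by (simp_all add: algebra_simps)
  have cx: "cos x \<noteq> 1" "cos y \<noteq> 1" "cos z \<noteq> 1"
    using pos p ti cos_monotone_0_pi[of 0 x] cos_monotone_0_pi[of 0 y] cos_monotone_0_pi[of 0 z] by auto
  have ne': "A \<noteq> B" "B \<noteq> D" "D \<noteq> A" using cx dots un by (auto simp: dot_square_norm)
  define N where "N = cross3 (A - B) (D - B)"
  have "(norm N)\<^sup>2 = chord_area (B \<bullet> A) (B \<bullet> D) (A \<bullet> D)"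
  proof -
    have "(norm N)\<^sup>2 = (norm (A - B) * norm (D - B))\<^sup>2 - ((A - B) \<bullet> (D - B))\<^sup>2"
      unfolding N_def using norm_cross_dot[of "A - B" "D - B"] by simp
    also have "\<dots> = chord_area (B \<bullet> A) (B \<bullet> D) (A \<bullet> D)"
      unfolding chord_area_def power_mult_distrib power2_norm_eq_inner using aa
      by (simp add: inner_diff_left inner_diff_right inner_commute power2_eq_square algebra_simps)
    finally show ?thesis .
  qed
  then have N0: "N \<noteq> 0" using chord_area_pos[of B A D] un ne' by auto
  \<comment> \<open>The sign puts the centre on the side from which the radius is at most a quarter
    of a great circle, as \<open>model_circle\<close> demands; this makes the curvature
    nonnegative.\<close>
  define n where "n = (if 0 \<le> N \<bullet> B then inverse (norm N) *\<^sub>R N else - (inverse (norm N) *\<^sub>R N))"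
  have nn: "norm n = 1" unfolding n_def using N0 by simp
  have "N \<bullet> (A - B) = 0" "N \<bullet> (D - B) = 0" unfolding N_def by (simp_all add: dot_cross_self inner_commute)
  then have nh: "n \<bullet> A = n \<bullet> B" "n \<bullet> D = n \<bullet> B" unfolding n_def by (auto simp: inner_diff_right)
  define h where "h = n \<bullet> B"
  have h0: "0 \<le> h" unfolding h_def n_def by (auto simp: mult_nonneg_nonpos)
  have h1: "h < 1"
  proof (rule ccontr)
    assume "\<not> h < 1"
    moreover have "h \<le> 1" unfolding h_def using norm_cauchy_schwarz[of n B] nn un by simp
    ultimately have "n \<bullet> B = norm n * norm B" "n \<bullet> A = norm n * norm A" using nh nn un unfolding h_def by auto
    then have "n = B" "n = A" unfolding norm_cauchy_schwarz_eq using nn un by auto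
    then show False using ne' by simp
  qed
  define r where "r = arccos h / s"
  have ah: "0 < arccos h" "arccos h \<le> pi / 2" using h0 h1 arccos_lt_bounded[of h] arccos_le_pi2[of h] by auto
  let ?C = "{u \<in> model_space K. model_dist K ((1/s) *\<^sub>R n) u = r}"
  have ms: "(1/s) *\<^sub>R u \<in> model_space K" if "norm u = 1" for u using that K s unfolding model_space_def s_def by simp
  have md: "model_dist K ((1/s) *\<^sub>R u) ((1/s) *\<^sub>R v) = arccos (u \<bullet> v) / s" for u v
    using K s unfolding model_dist_def by (simp flip: s_def)
  have "comparison_triangle K a b c ((1/s) *\<^sub>R A) ((1/s) *\<^sub>R B) ((1/s) *\<^sub>R D)"
    unfolding comparison_triangle_def md dots using ms un pos p ti s by (simp add: arccos_cos) (simp add: x_y_z_def)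
  moreover have "model_circle K ?C (s * cot (s * r))"
    unfolding model_circle_def
    by (rule disjI1, rule exI[of _ "(1/s) *\<^sub>R n"], rule exI[of _ r])
       (use K ms nn ah s in \<open>auto simp: r_def field_simps simp flip: s_def\<close>)
  moreover have "(1/s) *\<^sub>R A \<in> ?C" "(1/s) *\<^sub>R B \<in> ?C" "(1/s) *\<^sub>R D \<in> ?C"
    using ms un nh md unfolding r_def h_def by auto
  moreover have "0 \<le> s * cot (s * r)"
  proof -
    have "s * r = arccos h" unfolding r_def using s by simp
    moreover have "0 \<le> cos (arccos h)" "0 \<le> sin (arccos h)" using h0 h1 ah by (auto intro: sin_ge_zero)
    ultimately show ?thesis unfolding cot_def using s by simp
  qed
  ultimately show ?thesis by blast
qed

lemma circumcircle_exists_plane: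
  fixes a b c :: "'a::metric_space"
  assumes ne: "a \<noteq> b" "b \<noteq> c" "a \<noteq> c"
  shows "\<exists>k\<ge>0. \<exists>a' b' c' C. comparison_triangle 0 a b c a' b' c' \<and> model_circle 0 C k \<and> a' \<in> C \<and> b' \<in> C \<and> c' \<in> C"
proof -
  define x y z where "x = dist a b" "y = dist b c" "z = dist c a"
  have pos: "0 < x" "0 < y" "0 < z" using ne unfolding x_y_z_def by auto
  have "triangle_sides 0 x y z" unfolding triangle_sides_def small_perimeter_def x_y_z_def
    using ne dist_triangle[of c a b] dist_triangle[of a b c] dist_triangle[of b c a] by (simp add: dist_commute)
  from cos_angle_law(1)[OF _ this] obtain t where t: "z\<^sup>2 = x\<^sup>2 + y\<^sup>2 - 2 * x * y * cos t" by auto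
  define B A D :: "real^3" where "B = vector [0, 0, 0]" "A = vector [x, 0, 0]" "D = vector [y * cos t, y * sin t, 0]"
  have dist_sq: "(dist (vector [p, q, 0]) (vector [u, v, 0] :: real^3))\<^sup>2 = (p - u)\<^sup>2 + (q - v)\<^sup>2" for p q u v :: real
    unfolding dist_norm power2_norm_eq_inner inner_vec_def sum_3 by (simp add: power2_eq_square)
  have e: "dist P Q = r" if "(dist P Q)\<^sup>2 = r\<^sup>2" "0 < r" for P Q :: "real^3" and r
    using that(1) by (rule power2_eq_imp_eq) (use that(2) in auto)
  have sc: "y * y * (cos t * cos t) + y * y * (sin t * sin t) = y * y" 
    using polar_norm[of y t] by (simp add: algebra_simps)
  have tr: "comparison_triangle 0 a b c A B D"
  proof -
    have "dist A B = x" "dist B D = y" "dist D A = z"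
      unfolding B_A_D_def by (rule e, unfold dist_sq t, use pos sc in \<open>auto simp: power2_eq_square algebra_simps\<close>)+
    then show ?thesis unfolding comparison_triangle_def model_space_def model_dist_def using x_y_z_def
      by (simp add: B_A_D_def)
  qed
  show ?thesis
  proof (cases "sin t = 0")
    case True
    let ?C = "{(vector [0,0,0]::real^3) + r *\<^sub>R vector [1,0,0] | r. True}"
    have v: "vector [p, 0, 0] \<in> ?C" for p :: real
      by (intro CollectI exI[of _ p]) (simp add: vec_eq_iff forall_3)
    have "model_circle 0 ?C 0" unfolding model_circle_def
      by (intro disjI2 conjI refl exI[of _ "vector [0,0,0]"] exI[of _ "vector [1,0,0]"])
         (auto simp: vec_eq_iff forall_3)
    moreover have "A \<in> ?C" "B \<in> ?C" "D \<in> ?C" unfolding B_A_D_def using v True by auto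
    ultimately show ?thesis using tr by blast
  next
    case False
    \<comment> \<open>The circumcentre lies on the perpendicular bisector of \<open>A\<close> and
      \<open>B\<close>, at first coordinate \<open>x / 2\<close>; equal distance from
      \<open>D\<close> determines its height \<open>w\<close>.\<close>
    define w where "w = (y - x * cos t) / (2 * sin t)"
    define O' :: "real^3" where "O' = vector [x / 2, w, 0]"
    define R where "R = sqrt ((x / 2)\<^sup>2 + w\<^sup>2)"
    have "0 < (x / 2)\<^sup>2 + w\<^sup>2" using pos by (intro add_pos_nonneg) auto
    then have R: "0 < R" "R\<^sup>2 = (x / 2)\<^sup>2 + w\<^sup>2" unfolding R_def by auto
    have w: "2 * (w * sin t) = y - x * cos t" unfolding w_def using False by simp
    have "(x / 2 - y * cos t)\<^sup>2 + (w - y * sin t)\<^sup>2 = (x / 2)\<^sup>2 + w\<^sup>2 - x * y * cos t - y * (2 * (w * sin t)) + (y * y * (cos t * cos t) + y * y * (sin t * sin t))"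
      by (simp add: power2_eq_square algebra_simps)
    also have "\<dots> = (x / 2)\<^sup>2 + w\<^sup>2" unfolding w sc by (simp add: algebra_simps)
    finally have D: "(x / 2 - y * cos t)\<^sup>2 + (w - y * sin t)\<^sup>2 = (x / 2)\<^sup>2 + w\<^sup>2" .
    have "dist O' A = R" "dist O' B = R" "dist O' D = R"
      unfolding B_A_D_def O'_def by (rule e, unfold dist_sq R D, use R in \<open>auto simp: power2_eq_square algebra_simps\<close>)+
    then have "A \<in> {u \<in> model_space 0. model_dist 0 O' u = R}" "B \<in> {u \<in> model_space 0. model_dist 0 O' u = R}"
        "D \<in> {u \<in> model_space 0. model_dist 0 O' u = R}"
      unfolding model_space_def model_dist_def B_A_D_def by auto
    moreover have "model_circle 0 {u \<in> model_space 0. model_dist 0 O' u = R} (1 / R)"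
      unfolding model_circle_def by (rule disjI1, rule exI[of _ O'], rule exI[of _ R]) (use R in \<open>auto simp: model_space_def O'_def\<close>)
    moreover have "0 \<le> 1 / R" using R by simp
    ultimately show ?thesis using tr by blast
  qed
qed

text \<open>Since \<open>chi\<close> is a definite description, nothing is known about it before
  existence and uniqueness are settled. The explicit circles give existence, and uniqueness holds
  because every admissible curvature equals the same function of the side lengths.\<close>

lemma chi_eq:
  assumes K: "K \<ge> 0" and ne: "a \<noteq> b" "b \<noteq> c" "a \<noteq> c"
    and per: "K > 0 \<Longrightarrow> dist a b + dist b c + dist c a \<le> 2 * pi / sqrt K"
  shows "0 \<le> chi K a b c" "chi K a b c = sqrt (circumcurvature_sq K (dist a b) (dist b c) (dist c a))"
proof -
  let ?P = "\<lambda>k. 0 \<le> k \<and> (\<exists>a' b' c' C. comparison_triangle K a b c a' b' c' \<and> model_circle K C k \<and> a' \<in> C \<and> b' \<in> C \<and> c' \<in> C)"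
  have "\<exists>k. ?P k"
    using circumcircle_exists_sphere[of K a b c] circumcircle_exists_plane[OF ne] K ne per by (cases "K = 0") auto
  then obtain k0 where k0: "?P k0" by blast
  have u: "k = sqrt (circumcurvature_sq K (dist a b) (dist b c) (dist c a))" if "?P k" for k
    using that circumcurvature_unique[OF K ne] by blast
  have "\<exists>!k. ?P k"
  proof (rule ex1I[of _ k0])
    fix k assume "?P k"
    then show "k = k0" using u[of k] u[OF k0] by simp
  qed (rule k0)
  then have "?P (chi K a b c)" unfolding chi_def by (rule theI')
  then show "0 \<le> chi K a b c" "chi K a b c = sqrt (circumcurvature_sq K (dist a b) (dist b c) (dist c a))"
    using u[of "chi K a b c"] by blast+
qed

lemma chi_rotate: "chi K a b c = chi K b c a"
  unfolding chi_def
proof (rule arg_cong[where f = The], rule ext)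
  fix k
  have "comparison_triangle K a b c a' b' c' \<longleftrightarrow> comparison_triangle K b c a b' c' a'" for a' b' c'
    unfolding comparison_triangle_def by blast
  then show "(0 \<le> k \<and> (\<exists>a' b' c' C. comparison_triangle K a b c a' b' c' \<and> model_circle K C k \<and> a' \<in> C \<and> b' \<in> C \<and> c' \<in> C)) =
     (0 \<le> k \<and> (\<exists>a' b' c' C. comparison_triangle K b c a a' b' c' \<and> model_circle K C k \<and> a' \<in> C \<and> b' \<in> C \<and> c' \<in> C))"
    by blast
qed

lemma chi_swap: "chi K a b c = chi K c b a"
  unfolding chi_def
proof (rule arg_cong[where f = The], rule ext)
  fix k
  have "model_dist K x y = model_dist K y x" for x y
    unfolding model_dist_def by (simp add: dist_commute inner_commute)
  then have "comparison_triangle K a b c a' b' c' \<longleftrightarrow> comparison_triangle K c b a c' b' a'" for a' b' c'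
    unfolding comparison_triangle_def by (metis dist_commute)
  then show "(0 \<le> k \<and> (\<exists>a' b' c' C. comparison_triangle K a b c a' b' c' \<and> model_circle K C k \<and> a' \<in> C \<and> b' \<in> C \<and> c' \<in> C)) =
     (0 \<le> k \<and> (\<exists>a' b' c' C. comparison_triangle K c b a a' b' c' \<and> model_circle K C k \<and> a' \<in> C \<and> b' \<in> C \<and> c' \<in> C))"
    by blast
qed

section \<open>Circumscribed circles and the angle at a vertex\<close>

lemma gram3_factor: "gram3 x y z = (1 - x\<^sup>2) * (1 - y\<^sup>2) - (z - x * y)\<^sup>2"
  unfolding gram3_def by (simp add: power2_eq_square algebra_simps)

lemma chord_area_minus_gram3:
  "chord_area x y z - gram3 x y z = (1 - x)\<^sup>2 * (1 - y\<^sup>2) + (1 - y)\<^sup>2 * (1 - x\<^sup>2) - 2 * (1 - x) * (1 - y) * (z - x * y)"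
  unfolding gram3_def chord_area_def by (simp add: power2_eq_square algebra_simps)

lemma tan_half_mult_sin: "sin x \<noteq> 0 \<Longrightarrow> tan (x / 2) * sin x = 1 - cos (x::real)"
proof -
  assume s: "sin x \<noteq> 0"
  have 1: "sin x = 2 * sin (x/2) * cos (x/2)" "cos x = 1 - 2 * (sin (x/2))\<^sup>2"
    using sin_double[of "x/2"] cos_double_sin[of "x/2"] by auto
  then have "cos (x/2) \<noteq> 0" using s by auto
  then show ?thesis unfolding 1 tan_def by (simp add: power2_eq_square)
qed

text \<open>Stereographic projection from the vertex turns circles through it into lines, and \<open>half_tan\<close> into
  the reciprocal distance from the origin: this is the distance of such a line from the origin.\<close>

lemma chi_angle_relation:
  assumes K: "K \<ge> 0" and ne: "a \<noteq> b" "b \<noteq> c" "a \<noteq> c"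
    and per: "small_perimeter K (dist a b + dist b c + dist c a)"
  defines "t \<equiv> model_angle K (dist a b) (dist b c) (dist c a)" and "X \<equiv> half_tan K (dist a b)" and "Y \<equiv> half_tan K (dist b c)"
  shows "(sin t)\<^sup>2 = (chi K a b c)\<^sup>2 * (X\<^sup>2 + Y\<^sup>2 - 2 * X * Y * cos t)" "\<not> (X = Y \<and> cos t = 1)" "0 < X" "0 < Y"
    "triangle_sides K (dist a b) (dist b c) (dist c a)"
proof -
  define x y z where "x = dist a b" "y = dist b c" "z = dist c a"
  have pos: "0 < x" "0 < y" "0 < z" using ne unfolding x_y_z_def by auto
  show ts: "triangle_sides K (dist a b) (dist b c) (dist c a)" unfolding triangle_sides_def
    using ne dist_triangle[of c a b] dist_triangle[of a b c] dist_triangle[of b c a] per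
    by (simp add: dist_commute algebra_simps)
  note sc = triangle_sides_scaled[OF _ ts, folded x_y_z_def]
  note law = cos_angle_law[OF K ts, folded t_def x_y_z_def]
  show "0 < X" "0 < Y" using half_tan_pos K pos sc unfolding X_def Y_def x_y_z_def[symmetric] by auto
  have per': "dist a b + dist b c + dist c a \<le> 2 * pi / sqrt K" if "K > 0" using per that unfolding small_perimeter_def by simp
  note ch = chi_eq(1,2)[OF K ne per']
  show "\<not> (X = Y \<and> cos t = 1)"
  proof
    assume e: "X = Y \<and> cos t = 1"
    have xy: "x = y"
    proof (rule ccontr)
      assume "x \<noteq> y"
      then have "half_tan K x < half_tan K y \<or> half_tan K y < half_tan K x"
        using half_tan_strict_mono[OF K, of x y] half_tan_strict_mono[OF K, of y x] pos sc by (cases "x < y") auto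
      then show False using e unfolding X_def Y_def x_y_z_def by simp
    qed
    show False
    proof (cases "K = 0")
      case True
      have "z\<^sup>2 = 0" using law(1)[OF True] e xy by (simp add: power2_eq_square)
      then show False using pos by simp
    next
      case False
      then have K0: "K > 0" using K by simp
      have "cos (sqrt K * z) = 1" using law(2)[OF K0] e xy sin_cos_squared_add2[of "sqrt K * x"] by (simp add: power2_eq_square)
      moreover have "cos (sqrt K * z) < cos 0" using sc(8)[OF K0] pos K0 by (intro cos_monotone_0_pi) auto
      ultimately show False by simp
    qed
  qed
  have ge0: "0 \<le> circumcurvature_sq K x y z" using ch unfolding x_y_z_def[symmetric] by simp
  then have k2: "(chi K a b c)\<^sup>2 = circumcurvature_sq K x y z" using ch unfolding x_y_z_def[symmetric] by simp
  have st: "(sin t)\<^sup>2 = 1 - (cos t)\<^sup>2" by (rule sin_squared_eq)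
  show "(sin t)\<^sup>2 = (chi K a b c)\<^sup>2 * (X\<^sup>2 + Y\<^sup>2 - 2 * X * Y * cos t)"
  proof (cases "K = 0")
    case True
    have XY: "X = x / 2" "Y = y / 2" unfolding X_def Y_def half_tan_def x_y_z_def using True by auto
    have l: "z\<^sup>2 = x\<^sup>2 + y\<^sup>2 - 2 * x * y * cos t" using law(1)[OF True] .
    have e1: "X\<^sup>2 + Y\<^sup>2 - 2 * X * Y * cos t = z\<^sup>2 / 4" unfolding XY l by (simp add: field_simps power2_eq_square)
    have "4 * x\<^sup>2 * y\<^sup>2 - (x\<^sup>2 + y\<^sup>2 - z\<^sup>2)\<^sup>2 = 4 * x\<^sup>2 * y\<^sup>2 * (sin t)\<^sup>2"
      unfolding l st by (simp add: power2_eq_square algebra_simps)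
    then have "circumcurvature_sq K x y z = 4 * (sin t)\<^sup>2 / z\<^sup>2"
      unfolding circumcurvature_sq_def using True pos by (simp add: power_mult_distrib)
    then show ?thesis unfolding k2 e1 using pos by simp
  next
    case False
    then have K0: "K > 0" using K by simp
    define u v w where "u = sqrt K * x" "v = sqrt K * y" "w = sqrt K * z"
    have s: "0 < sin u" "0 < sin v" using sc[OF K0] unfolding u_v_w_def by (auto intro!: sin_gt_zero)
    have XY: "sqrt K * X * sin u = 1 - cos u" "sqrt K * Y * sin v = 1 - cos v"
      unfolding X_def Y_def half_tan_def x_y_z_def[symmetric]
      using False K0 s tan_half_mult_sin[of u] tan_half_mult_sin[of v] unfolding u_v_w_def by auto
    have l: "cos w - cos u * cos v = sin u * sin v * cos t" using law(2)[OF K0] unfolding u_v_w_def by simp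
    have G: "gram3 (cos u) (cos v) (cos w) = (sin u * sin v)\<^sup>2 * (sin t)\<^sup>2"
    proof -
      have "gram3 (cos u) (cos v) (cos w) = (sin u)\<^sup>2 * (sin v)\<^sup>2 - (sin u * sin v * cos t)\<^sup>2"
        unfolding gram3_factor l by (simp add: sin_squared_eq)
      then show ?thesis unfolding st by (simp add: power_mult_distrib algebra_simps)
    qed
    have W: "chord_area (cos u) (cos v) (cos w) - gram3 (cos u) (cos v) (cos w)
       = K * (X\<^sup>2 + Y\<^sup>2 - 2 * X * Y * cos t) * (sin u * sin v)\<^sup>2"
    proof -
      have id: "(r * X * sin u)\<^sup>2 * (sin v)\<^sup>2 + (r * Y * sin v)\<^sup>2 * (sin u)\<^sup>2 - 2 * (r * X * sin u) * (r * Y * sin v) * (sin u * sin v * cos t)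
          = (r * r) * (X\<^sup>2 + Y\<^sup>2 - 2 * X * Y * cos t) * (sin u * sin v)\<^sup>2" for r
        by (simp add: power2_eq_square algebra_simps)
      have "chord_area (cos u) (cos v) (cos w) - gram3 (cos u) (cos v) (cos w)
        = (sqrt K * X * sin u)\<^sup>2 * (sin v)\<^sup>2 + (sqrt K * Y * sin v)\<^sup>2 * (sin u)\<^sup>2 - 2 * (sqrt K * X * sin u) * (sqrt K * Y * sin v) * (sin u * sin v * cos t)"
        unfolding chord_area_minus_gram3 l XY sin_squared_eq by simp
      also have "\<dots> = (sqrt K * sqrt K) * (X\<^sup>2 + Y\<^sup>2 - 2 * X * Y * cos t) * (sin u * sin v)\<^sup>2"
        using id[of "sqrt K"] .
      finally show ?thesis using K by simp
    qed
    have P: "0 < X\<^sup>2 + Y\<^sup>2 - 2 * X * Y * cos t"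
    proof -
      have "X\<^sup>2 + Y\<^sup>2 - 2 * X * Y * cos t = (X - Y)\<^sup>2 + 2 * (X * Y) * (1 - cos t)" by (simp add: power2_eq_square algebra_simps)
      moreover have "0 < (X - Y)\<^sup>2 + 2 * (X * Y) * (1 - cos t)"
      proof (cases "X = Y")
        case True
        then have "cos t < 1" using \<open>\<not> (X = Y \<and> cos t = 1)\<close> cos_le_one[of t] by linarith
        then show ?thesis using \<open>0 < X\<close> \<open>0 < Y\<close> by (intro add_nonneg_pos) auto
      next
        case False
        then show ?thesis using \<open>0 < X\<close> \<open>0 < Y\<close> by (intro add_pos_nonneg) auto
      qed
      ultimately show ?thesis by simp
    qed
    have "(chi K a b c)\<^sup>2 = K * ((sin u * sin v)\<^sup>2 * (sin t)\<^sup>2) / (K * (X\<^sup>2 + Y\<^sup>2 - 2 * X * Y * cos t) * (sin u * sin v)\<^sup>2)"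
      unfolding k2 circumcurvature_sq_def Let_def u_v_w_def[symmetric] W[symmetric] G[symmetric] using False by simp
    also have "\<dots> = (sin t)\<^sup>2 / (X\<^sup>2 + Y\<^sup>2 - 2 * X * Y * cos t)" using K0 s by simp
    finally show ?thesis using P by simp
  qed
qed

text \<open>The assumption says \<open>gram3 X Y (cos t) = 0\<close>: three unit vectors with these
  inner products are coplanar. Hence \<open>cos t\<close> is the cosine of the sum or of the
  difference of \<open>arccos X\<close> and \<open>arccos Y\<close>, once these are defined.\<close>

lemma coplanar_cosines:
  fixes t X Y :: real
  assumes "(sin t)\<^sup>2 = X\<^sup>2 + Y\<^sup>2 - 2 * X * Y * cos t"
  shows "(cos t - X * Y)\<^sup>2 = (1 - X\<^sup>2) * (1 - Y\<^sup>2)"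
  using assms unfolding sin_squared_eq by (simp add: power2_eq_square algebra_simps)

text \<open>Whichever sign occurs, \<open>t\<close> is at most \<open>arccos X + arccos Y\<close>.
  That the inverse cosines are defined follows from the sign of
  \<open>(1 - X\<^sup>2) * (1 - Y\<^sup>2)\<close>: if one of \<open>X\<close> and \<open>Y\<close>
  exceeded 1, both would be at least 1, and then \<open>X = Y\<close> and \<open>cos t = 1\<close>,
  the excluded case.\<close>

lemma angle_le_of_coplanar:
  fixes t X Y :: real
  assumes t: "0 \<le> t" "t \<le> pi" and e: "(sin t)\<^sup>2 = X\<^sup>2 + Y\<^sup>2 - 2 * X * Y * cos t"
    and XY: "0 < X" "0 < Y" "\<not> (X = Y \<and> cos t = 1)"
  shows "X \<le> 1" "Y \<le> 1" "t \<le> pi - arcsin X - arcsin Y"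
proof -
  note c = coplanar_cosines[OF e]
  have ge: "0 \<le> (1 - X\<^sup>2) * (1 - Y\<^sup>2)" unfolding c[symmetric] by simp
  have both: "X \<le> 1 \<and> Y \<le> 1"
  proof (rule ccontr)
    assume "\<not> ?thesis"
    then have "1 \<le> X\<^sup>2" "1 \<le> Y\<^sup>2"
      using ge XY power_strict_mono[of X 1 2] power_strict_mono[of Y 1 2] one_less_power[of X 2] one_less_power[of Y 2]
      by (smt (verit) mult_le_0_iff mult_nonneg_nonneg mult_pos_neg mult_neg_pos not_less one_power2 zero_less_numeral zero_le_mult_iff)+
    then have ge1: "1 \<le> X" "1 \<le> Y" using XY by (metis abs_of_pos one_le_power abs_square_le_1 linorder_linear abs_le_square_iff abs_one one_power2)+
    have "1 \<le> X * Y" using ge1 mult_mono[of 1 X 1 Y] by simp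
    then have "(X * Y - 1)\<^sup>2 \<le> (X * Y - cos t)\<^sup>2" using cos_le_one[of t] by (intro power_mono) auto
    then have "(X * Y - 1)\<^sup>2 \<le> (1 - X\<^sup>2) * (1 - Y\<^sup>2)" using c by (simp add: power2_commute)
    then have "(X - Y)\<^sup>2 \<le> 0" by (simp add: power2_eq_square algebra_simps)
    then have xy: "X = Y" by simp
    have "(cos t - X * X)\<^sup>2 = (1 - X\<^sup>2)\<^sup>2" using c xy by (simp add: power2_eq_square)
    then have "cos t - X * X = 1 - X\<^sup>2 \<or> cos t - X * X = - (1 - X\<^sup>2)" by (simp only: power2_eq_iff)
    then have "cos t = 1 \<or> cos t = 2 * X\<^sup>2 - 1" by (auto simp: power2_eq_square)
    moreover have "X\<^sup>2 = 1" if "cos t = 2 * X\<^sup>2 - 1" using that cos_le_one[of t] \<open>1 \<le> X\<^sup>2\<close> by linarith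
    ultimately have "cos t = 1" by auto
    then show False using XY xy by simp
  qed
  then show 1: "X \<le> 1" "Y \<le> 1" by auto
  have "cos (arccos X + arccos Y) = X * Y - sqrt (1 - X\<^sup>2) * sqrt (1 - Y\<^sup>2)"
    using 1 XY by (simp add: cos_add sin_arccos)
  also have "\<dots> = X * Y - \<bar>cos t - X * Y\<bar>" by (simp flip: real_sqrt_mult c)
  also have "\<dots> \<le> cos t" by linarith
  finally have le: "cos (arccos X + arccos Y) \<le> cos t" .
  have ac: "arccos X = pi / 2 - arcsin X" "arccos Y = pi / 2 - arcsin Y"
    using 1 XY by (auto simp: arccos_arcsin_eq)
  have a0: "0 \<le> arcsin X" "0 \<le> arcsin Y" "arcsin X \<le> pi / 2" "arcsin Y \<le> pi / 2"
    using 1 XY arcsin_ubound[of X] arcsin_ubound[of Y] by (auto intro!: arcsin_nonneg)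
  show "t \<le> pi - arcsin X - arcsin Y"
  proof (rule ccontr)
    assume "\<not> ?thesis"
    then have "arccos X + arccos Y < t" unfolding ac by simp
    then have "cos t < cos (arccos X + arccos Y)" using t a0 unfolding ac by (intro cos_monotone_0_pi) auto
    then show False using le by simp
  qed
qed

text \<open>In the projected picture, for positive \<open>X\<close> and \<open>Y\<close>, a line at
  distance 1 from the origin carries two points at distances \<open>1 / X\<close> and
  \<open>1 / Y\<close>. The last two assumptions say that the triangle with the origin has no obtuse
  angle at these points. So the foot of the perpendicular lies between them, and the angles
  \<open>arccos X\<close> and \<open>arccos Y\<close> add up.\<close>

lemma angle_eq_of_coplanar:
  fixes t X Y :: real
  assumes t: "0 \<le> t" "t \<le> pi" and e: "(sin t)\<^sup>2 = X\<^sup>2 + Y\<^sup>2 - 2 * X * Y * cos t"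
    and XY: "0 \<le> X" "X < 1" "0 \<le> Y" "Y < 1" "\<not> (X = Y \<and> cos t = 1)" "Y * cos t \<le> X" "X * cos t \<le> Y"
  shows "t = pi - arcsin X - arcsin Y"
proof -
  note c = coplanar_cosines[OF e]
  define p q where "p = sqrt (1 - X\<^sup>2)" "q = sqrt (1 - Y\<^sup>2)"
  have sq: "X\<^sup>2 < 1" "Y\<^sup>2 < 1" using XY power_strict_mono[of X 1 2] power_strict_mono[of Y 1 2] by auto
  then have pq: "0 < p" "0 < q" "p\<^sup>2 = 1 - X\<^sup>2" "q\<^sup>2 = 1 - Y\<^sup>2" unfolding p_q_def by auto
  have "(cos t - X * Y)\<^sup>2 = (p * q)\<^sup>2" using c pq by (simp add: power_mult_distrib)
  then have "cos t - X * Y = p * q \<or> cos t - X * Y = - (p * q)" by (simp only: power2_eq_iff)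
  moreover have False if plus: "cos t - X * Y = p * q"
  proof -
    have ct: "cos t = X * Y + p * q" using plus by simp
    have "X * cos t = X\<^sup>2 * Y + X * p * q" unfolding ct by (simp add: power2_eq_square algebra_simps)
    then have "X * p * q \<le> p\<^sup>2 * Y" using XY(7) unfolding pq by (simp add: algebra_simps)
    then have 1: "X * q \<le> p * Y" using pq by (simp add: power2_eq_square mult.assoc mult.left_commute)
    have "Y * cos t = Y\<^sup>2 * X + Y * p * q" unfolding ct by (simp add: power2_eq_square algebra_simps)
    then have "Y * p * q \<le> q\<^sup>2 * X" using XY(6) unfolding pq by (simp add: algebra_simps)
    then have 2: "Y * p \<le> q * X" using pq by (simp add: power2_eq_square mult.assoc mult.left_commute)
    have "X * q = Y * p" using 1 2 by (simp add: mult.commute)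
    then have "X\<^sup>2 * q\<^sup>2 = Y\<^sup>2 * p\<^sup>2" by (simp flip: power_mult_distrib)
    then have "X\<^sup>2 = Y\<^sup>2" unfolding pq by (simp add: algebra_simps)
    then have xy: "X = Y" using XY by (simp add: power2_eq_iff_nonneg)
    then have "cos t = X\<^sup>2 + p\<^sup>2" using ct by (simp add: p_q_def power2_eq_square)
    then show False using pq XY xy by simp
  qed
  ultimately have "cos t = X * Y - p * q" by auto
  also have "\<dots> = cos (arccos X + arccos Y)" using XY by (simp add: cos_add sin_arccos p_q_def)
  finally have ct: "cos t = cos (arccos X + arccos Y)" .
  have ac: "arccos X = pi / 2 - arcsin X" "arccos Y = pi / 2 - arcsin Y"
    using XY by (auto simp: arccos_arcsin_eq)
  have a0: "0 \<le> arcsin X" "0 \<le> arcsin Y" "arcsin X \<le> pi / 2" "arcsin Y \<le> pi / 2"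
    using XY arcsin_ubound[of X] arcsin_ubound[of Y] by (auto intro!: arcsin_nonneg)
  have "t = arccos X + arccos Y"
    using arccos_cos[OF t] arccos_cos[of "arccos X + arccos Y"] a0 ct unfolding ac by auto
  then show ?thesis unfolding ac by simp
qed

text \<open>Needed at the vertices of inscribed polygons, where only a bound linear in the chords
  can be summed. The exact bound has \<open>arcsin (q * half_tan K x)\<close> in place of
  \<open>k / 2 * x\<close>, and inverse sine and \<open>half_tan\<close> are bounded below by their
  linear parts.\<close>

lemma model_angle_le_of_chi_ge:
  assumes K: "K \<ge> 0" and ne: "a \<noteq> b" "b \<noteq> c" "a \<noteq> c" and k: "0 < k" "k \<le> chi K a b c"
    and per: "small_perimeter K (dist a b + dist b c + dist c a)"
  shows "model_angle K (dist a b) (dist b c) (dist c a) \<le> pi - k / 2 * (dist a b + dist b c)"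
proof -
  define t X Y where "t = model_angle K (dist a b) (dist b c) (dist c a)" "X = half_tan K (dist a b)" "Y = half_tan K (dist b c)"
  note rel = chi_angle_relation[OF K ne per, folded t_X_Y_def]
  define q where "q = chi K a b c"
  have q: "0 < q" "k \<le> q" using k unfolding q_def by auto
  have "(sin t)\<^sup>2 = (q * X)\<^sup>2 + (q * Y)\<^sup>2 - 2 * (q * X) * (q * Y) * cos t"
    using rel(1) unfolding q_def by (simp add: power2_eq_square algebra_simps)
  from angle_le_of_coplanar[OF _ _ this] have b: "q * X \<le> 1" "q * Y \<le> 1" "t \<le> pi - arcsin (q * X) - arcsin (q * Y)"
    using rel q unfolding t_X_Y_def(1) by (auto simp: model_angle_bounds)
  have as: "k / 2 * x \<le> arcsin (q * half_tan K x)" if "0 < x" "K > 0 \<Longrightarrow> sqrt K * x < pi" "q * half_tan K x \<le> 1" for x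
  proof -
    have "k / 2 * x \<le> q * (x / 2)" using q that by simp
    also have "\<dots> \<le> q * half_tan K x" using half_tan_ge[OF K, of x] that q by simp
    also have "\<dots> \<le> arcsin (q * half_tan K x)"
    proof -
      have "0 \<le> q * half_tan K x" using q half_tan_pos[OF K that(1,2)] by simp
      then show ?thesis using sin_x_le_x[of "arcsin (q * half_tan K x)"] that(3)
        by (simp add: arcsin_nonneg order_trans[of "-1" 0])
    qed
    finally show ?thesis .
  qed
  have "k / 2 * dist a b \<le> arcsin (q * X)" "k / 2 * dist b c \<le> arcsin (q * Y)"
    using as b ne triangle_sides_scaled[OF _ rel(5)] unfolding t_X_Y_def by auto
  then show ?thesis using b(3) unfolding t_X_Y_def by (simp add: distrib_left)
qed

text \<open>For the angle opposite to the largest side this supplies the inequalities that select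
  the sign in \<open>angle_eq_of_coplanar\<close>.\<close>

lemma half_tan_cos_le:
  assumes K: "K \<ge> 0" and ts: "triangle_sides K x y z" and l: "x \<le> z"
  shows "half_tan K x * cos (model_angle K x y z) \<le> half_tan K y"
proof (cases "K = 0")
  case True
  have p: "0 < x" "0 < y" using ts unfolding triangle_sides_def by auto
  have c: "cos (model_angle K x y z) = (x\<^sup>2 + y\<^sup>2 - z\<^sup>2) / (2 * x * y)"
    unfolding cos_model_angle[OF K ts] cos_angle_def using True by simp
  have "x\<^sup>2 \<le> z\<^sup>2" using l p by (intro power_mono) auto
  then have "x\<^sup>2 + y\<^sup>2 - z\<^sup>2 \<le> 2 * y * y" using zero_le_power2[of y] unfolding power2_eq_square by linarith
  then have "(x\<^sup>2 + y\<^sup>2 - z\<^sup>2) / (4 * y) \<le> y / 2" using p by (simp add: field_simps)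
  moreover have "x / 2 * ((x\<^sup>2 + y\<^sup>2 - z\<^sup>2) / (2 * x * y)) = (x\<^sup>2 + y\<^sup>2 - z\<^sup>2) / (4 * y)" using p by simp
  ultimately show ?thesis unfolding c half_tan_def using True by simp
next
  case False
  then have K0: "K > 0" using K by simp
  define u v w where "u = sqrt K * x" "v = sqrt K * y" "w = sqrt K * z"
  note sc = triangle_sides_scaled[OF K0 ts, folded u_v_w_def]
  have s: "0 < sin u" "0 < sin v" using sc by (auto intro!: sin_gt_zero)
  have law: "cos w = cos u * cos v + sin u * sin v * cos (model_angle K x y z)"
    using cos_angle_law(2)[OF K ts K0] unfolding u_v_w_def .
  have "u \<le> w" using l K0 unfolding u_v_w_def by simp
  then have cw: "cos w \<le> cos u" using sc by (intro cos_monotone_0_pi_le) auto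
  have uv: "tan (u / 2) * sin u = 1 - cos u" "tan (v / 2) * sin v = 1 - cos v" using tan_half_mult_sin s by auto
  have v2: "1 - (cos v)\<^sup>2 = (sin v)\<^sup>2" "(sin u)\<^sup>2 = (1 - cos u) * (1 + cos u)" 
    by (simp_all add: sin_squared_eq power2_eq_square algebra_simps)
  have "(tan (u / 2) * cos (model_angle K x y z)) * ((sin u)\<^sup>2 * sin v) = (tan (u/2) * sin u) * (sin u * sin v * cos (model_angle K x y z))"
    by (simp add: power2_eq_square)
  also have "\<dots> = (1 - cos u) * (cos w - cos u * cos v)" unfolding uv using law by simp
  also have "\<dots> \<le> (1 - cos u) * ((1 + cos u) * (1 - cos v))"
  proof (rule mult_left_mono)
    have "cos w - cos u * cos v \<le> 1 + cos u - cos v - cos u * cos v" using cw cos_le_one[of v] by linarith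
    then show "cos w - cos u * cos v \<le> (1 + cos u) * (1 - cos v)" by (simp add: algebra_simps)
  qed simp
  also have "\<dots> = tan (v / 2) * ((sin u)\<^sup>2 * sin v)" unfolding v2 uv(2)[symmetric] by simp
  finally have "tan (u / 2) * cos (model_angle K x y z) \<le> tan (v / 2)" using s by simp
  then show ?thesis unfolding half_tan_def u_v_w_def using False K0 by (simp add: divide_right_mono)
qed

text \<open>Opposite to the largest side the curvature determines the angle: for curvature
  \<open>q < k\<close> it would be \<open>pi - arcsin (q * X) - arcsin (q * Y)\<close>, more than
  the assumed bound. At another vertex the two inverse cosines may be subtracted instead of added,
  hence the condition on the sides.\<close>

lemma chi_ge_of_model_angle_le:
  assumes K: "K \<ge> 0" and ne: "a \<noteq> b" "b \<noteq> c" "a \<noteq> c" and k: "0 < k"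
    and per: "small_perimeter K (dist a b + dist b c + dist c a)"
    and lar: "dist a b \<le> dist c a" "dist b c \<le> dist c a"
    and kT: "k * half_tan K (dist a b) \<le> 1" "k * half_tan K (dist b c) \<le> 1"
    and an: "model_angle K (dist a b) (dist b c) (dist c a) \<le> pi - arcsin (k * half_tan K (dist a b)) - arcsin (k * half_tan K (dist b c))"
  shows "k \<le> chi K a b c"
proof (rule ccontr)
  assume lt: "\<not> ?thesis"
  define t X Y where "t = model_angle K (dist a b) (dist b c) (dist c a)" "X = half_tan K (dist a b)" "Y = half_tan K (dist b c)"
  note rel = chi_angle_relation[OF K ne per, folded t_X_Y_def]
  define q where "q = chi K a b c"
  have q: "0 \<le> q" "q < k" using lt chi_eq(1)[OF K ne] per unfolding q_def small_perimeter_def by auto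
  have l1: "X * cos t \<le> Y" using half_tan_cos_le[OF K rel(5) lar(1)] unfolding t_X_Y_def .
  have ts': "triangle_sides K (dist b c) (dist a b) (dist c a)" using rel(5) unfolding triangle_sides_def by (auto simp: algebra_simps)
  have l2: "Y * cos t \<le> X" using half_tan_cos_le[OF K ts' lar(2)] unfolding t_X_Y_def by (simp add: model_angle_commute)
  have n1: "\<not> (q * X = q * Y \<and> cos t = 1)"
    using rel(2) l1 l2 by auto
  have lt: "q * X < k * X" "q * Y < k * Y" using q rel by auto
  have "(sin t)\<^sup>2 = (q * X)\<^sup>2 + (q * Y)\<^sup>2 - 2 * (q * X) * (q * Y) * cos t"
    using rel(1) unfolding q_def by (simp add: power2_eq_square algebra_simps)
  then have "t = pi - arcsin (q * X) - arcsin (q * Y)"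
  proof (rule angle_eq_of_coplanar[rotated 2])
    show "0 \<le> t" "t \<le> pi" unfolding t_X_Y_def by (auto simp: model_angle_bounds)
    show "q * Y * cos t \<le> q * X" "q * X * cos t \<le> q * Y" using l1 l2 q by (auto simp: mult.assoc intro: mult_left_mono)
    show "q * X < 1" "q * Y < 1" using lt kT unfolding t_X_Y_def by auto
  qed (use q rel n1 in auto)
  moreover have "arcsin (q * X) < arcsin (k * X)" "arcsin (q * Y) < arcsin (k * Y)"
    using lt kT q rel unfolding t_X_Y_def(2,3)[symmetric] 
    by (auto intro!: arcsin_less_arcsin intro: order_trans[of "-1" 0])
  ultimately show False using an unfolding t_X_Y_def by simp
qed

section \<open>Shortest paths in compact length spaces\<close>

lemma curve_length_ge_partition:
  assumes "p 0 = s" "p n = t" "\<And>i. i < n \<Longrightarrow> p i \<le> p (Suc i)"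
  shows "ereal (\<Sum>i<n. dist (g (p i)) (g (p (Suc i)))) \<le> curve_length g s t"
  unfolding curve_length_def using assms by (intro SUP_upper2[of "(n, p)"]) auto

lemma curve_length_ge_dist:
  assumes "s \<le> t" shows "ereal (dist (g s) (g t)) \<le> curve_length g s t"
  using curve_length_ge_partition[of "\<lambda>i. if i = 0 then s else t" s 1 t g] assms by simp

lemma curve_length_ge_dist2:
  assumes "s \<le> r" "r \<le> t" shows "ereal (dist (g s) (g r) + dist (g r) (g t)) \<le> curve_length g s t"
  using curve_length_ge_partition[of "\<lambda>i. if i = 0 then s else if i = 1 then r else t" s 2 t g] assms
  by (simp add: numeral_2_eq_2)

text \<open>Almost shortest curves contain points equidistant from their ends, by the intermediate
  value theorem. These are approximate midpoints, and by compactness they accumulate at a true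
  one.\<close>

lemma midpoint_exists:
  fixes X :: "'a::metric_space set"
  assumes X: "compact X" "length_space X" and xy: "x \<in> X" "y \<in> X"
  shows "\<exists>m\<in>X. dist x m = dist x y / 2 \<and> dist m y = dist x y / 2"
proof -
  have "\<exists>m\<in>X. dist x m = dist m y \<and> 2 * dist x m \<le> dist x y + 1 / Suc n" for n
  proof -
    have "(0::real) < 1 / Suc n" by simp
    then obtain s where s: "continuous_on {0..1} s" "s ` {0..1} \<subseteq> X" "s 0 = x" "s 1 = y"
        "curve_length s 0 1 < ereal (dist x y + 1 / Suc n)"
      using X(2) xy unfolding length_space_def by blast
    have "\<exists>r\<ge>0. r \<le> 1 \<and> dist x (s r) - dist (s r) y = 0"
      by (rule IVT') (use s in \<open>auto intro!: continuous_intros\<close>)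
    then obtain r where r: "0 \<le> r" "r \<le> 1" "dist x (s r) = dist (s r) y" by auto
    have "ereal (dist (s 0) (s r) + dist (s r) (s 1)) < ereal (dist x y + 1 / Suc n)"
      using curve_length_ge_dist2[OF r(1,2), of s] s(5) by (rule le_less_trans)
    then have "2 * dist x (s r) \<le> dist x y + 1 / Suc n" using r(3) s(3,4) by simp
    moreover have "s r \<in> X" using s(2) r by auto
    ultimately show ?thesis using r(3) by blast
  qed
  then obtain m where m: "\<And>n. m n \<in> X" "\<And>n. dist x (m n) = dist (m n) y" "\<And>n. 2 * dist x (m n) \<le> dist x y + 1 / Suc n"
    by metis
  obtain l f where l: "l \<in> X" "strict_mono f" "(m \<circ> f) \<longlonglongrightarrow> l"
    using X(1) m(1) unfolding compact_def by blast
  have 1: "(\<lambda>n. dist x ((m \<circ> f) n)) \<longlonglongrightarrow> dist x l" "(\<lambda>n. dist ((m \<circ> f) n) y) \<longlonglongrightarrow> dist l y"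
    using l(3) by (intro tendsto_intros; assumption)+
  have eq: "dist x l = dist l y" using LIMSEQ_unique[OF 1(1)] 1(2) m(2) by simp
  have "(\<lambda>n. 1 / real (Suc n)) \<longlonglongrightarrow> 0" using LIMSEQ_inverse_real_of_nat by (simp add: inverse_eq_divide)
  from LIMSEQ_subseq_LIMSEQ[OF this l(2)]
  have "(\<lambda>n. dist x y + 1 / real (Suc (f n))) \<longlonglongrightarrow> dist x y + 0"
    by (intro tendsto_intros) (simp add: o_def)
  moreover have "(\<lambda>n. 2 * dist x ((m \<circ> f) n)) \<longlonglongrightarrow> 2 * dist x l" using 1(1) by (rule tendsto_mult_left)
  ultimately have "2 * dist x l \<le> dist x y + 0"
    by (intro LIMSEQ_le[of "\<lambda>n. 2 * dist x ((m \<circ> f) n)"]) (use m(3) in auto)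
  then have "dist x l = dist x y / 2" using eq dist_triangle[of x y l] by simp
  then show ?thesis using eq l(1) by (intro bexI[of _ l]) auto
qed

text \<open>A maximal subset of \<open>X\<close> on which the distance from \<open>x\<close> is an isometry into \<open>[0, dist x y]\<close> has no gaps.\<close>

lemma shortest_path_exists:
  fixes X :: "'a::metric_space set"
  assumes X: "compact X" "length_space X" and xy: "x \<in> X" "y \<in> X"
  shows "\<exists>s. shortest_path X s x y \<and> (\<forall>a\<in>{0..1}. \<forall>b\<in>{0..1}. dist (s a) (s b) = \<bar>a - b\<bar> * dist x y)"
proof -
  define d where "d = dist x y"
  define P where "P S \<longleftrightarrow> S \<subseteq> X \<and> x \<in> S \<and> y \<in> S \<and> (\<forall>u\<in>S. dist x u \<le> d) \<and>
      (\<forall>u\<in>S. \<forall>v\<in>S. dist u v = \<bar>dist x u - dist x v\<bar>)" for S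
  have "P {x, y}" unfolding P_def d_def using xy by (auto simp: dist_commute)
  then have "Collect P \<noteq> {}" by auto
  moreover have "\<Union>\<C> \<in> Collect P" if C: "\<C> \<noteq> {}" "subset.chain (Collect P) \<C>" for \<C>
  proof -
    have CP: "P S" if "S \<in> \<C>" for S using C(2) that unfolding subset.chain_def by auto
    have "dist u v = \<bar>dist x u - dist x v\<bar>" if "u \<in> S" "S \<in> \<C>" "v \<in> T" "T \<in> \<C>" for u v S T
    proof -
      have "S \<subseteq> T \<or> T \<subseteq> S" using C(2) that unfolding subset.chain_def by blast
      then show ?thesis using CP[OF that(2)] CP[OF that(4)] that unfolding P_def by blast
    qed
    then have "\<forall>u\<in>\<Union>\<C>. \<forall>v\<in>\<Union>\<C>. dist u v = \<bar>dist x u - dist x v\<bar>" by blast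
    moreover have "\<Union>\<C> \<subseteq> X" "\<forall>u\<in>\<Union>\<C>. dist x u \<le> d" using CP unfolding P_def by blast+
    moreover obtain S where "S \<in> \<C>" using C(1) by blast
    then have "x \<in> \<Union>\<C>" "y \<in> \<Union>\<C>" using CP unfolding P_def by blast+
    ultimately show ?thesis unfolding P_def by blast
  qed
  ultimately have "\<exists>M\<in>Collect P. \<forall>S\<in>Collect P. M \<subseteq> S \<longrightarrow> S = M"
    by (rule subset_Zorn_nonempty)
  then obtain S where S: "P S" "\<And>T. P T \<Longrightarrow> S \<subseteq> T \<Longrightarrow> T = S" by auto
  have SX: "S \<subseteq> X" "x \<in> S" "y \<in> S" "\<And>u. u \<in> S \<Longrightarrow> dist x u \<le> d" 
    "\<And>u v. u \<in> S \<Longrightarrow> v \<in> S \<Longrightarrow> dist u v = \<bar>dist x u - dist x v\<bar>" using S(1) unfolding P_def by blast+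
  have "P (closure S)"
  proof -
    have "closure S \<subseteq> X" using SX(1) compact_imp_closed[OF X(1)] by (rule closure_minimal)
    moreover have "closure S \<subseteq> {u. dist x u \<le> d}"
      by (rule closure_minimal) (use SX(4) in \<open>auto intro!: closed_Collect_le continuous_intros\<close>)
    moreover have 1: "closure S \<subseteq> {u. dist u v = \<bar>dist x u - dist x v\<bar>}" if "v \<in> S" for v
    proof (rule closure_minimal)
      show "S \<subseteq> {u. dist u v = \<bar>dist x u - dist x v\<bar>}" using SX(5) that by blast
    qed (intro closed_Collect_eq continuous_intros)
    moreover have "closure S \<subseteq> {v. dist u v = \<bar>dist x u - dist x v\<bar>}" if "u \<in> closure S" for u
    proof (rule closure_minimal)
      show "S \<subseteq> {v. dist u v = \<bar>dist x u - dist x v\<bar>}" using 1 that by blast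
    qed (intro closed_Collect_eq continuous_intros)
    ultimately show ?thesis unfolding P_def using SX(2,3) closure_subset[of S] by blast
  qed
  then have "closure S = S" using S(2) closure_subset by blast
  then have "closed S" using closure_eq by blast
  then have cS: "compact S" using compact_Int_closed[OF X(1)] SX(1) by (metis inf.absorb_iff2)
  have ex: "\<exists>u\<in>S. dist x u = r" if r: "0 \<le> r" "r \<le> d" for r
  proof (rule ccontr)
    assume no: "\<not> ?thesis"
    \<comment> \<open>A missing value \<open>r\<close> splits \<open>S\<close> into two compact
      parts. A midpoint \<open>m\<close> of the points \<open>u\<close> and \<open>v\<close>
      bordering the gap can be added to \<open>S\<close>, contrary to maximality.\<close>
    define A B where "A = S \<inter> {u. dist x u \<le> r}" "B = S \<inter> {u. r \<le> dist x u}"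
    have cAB: "compact A" "compact B" unfolding A_B_def
      by (auto intro!: compact_Int_closed[OF cS] closed_Collect_le continuous_intros)
    have ne: "x \<in> A" "y \<in> B" using SX(2,3) r unfolding A_B_def d_def by auto
    obtain u where u: "u \<in> A" "\<And>w. w \<in> A \<Longrightarrow> dist x w \<le> dist x u"
      using continuous_attains_sup[OF cAB(1), of "dist x"] ne(1) continuous_on_dist[OF continuous_on_const continuous_on_id] by blast
    obtain v where v: "v \<in> B" "\<And>w. w \<in> B \<Longrightarrow> dist x v \<le> dist x w"
      using continuous_attains_inf[OF cAB(2), of "dist x"] ne(2) continuous_on_dist[OF continuous_on_const continuous_on_id] by blast
    have uS: "u \<in> S" "v \<in> S" using u v unfolding A_B_def by auto
    have lt: "dist x u < r" "r < dist x v" using u(1) v(1) no unfolding A_B_def by force+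
    obtain m where m: "m \<in> X" "dist u m = dist u v / 2" "dist m v = dist u v / 2"
      using midpoint_exists[OF X, of u v] uS SX(1) by blast
    have duv: "dist u v = dist x v - dist x u" using SX(5)[OF uS] lt by simp
    have fm: "dist x m = (dist x u + dist x v) / 2"
      using dist_triangle[of x m u] dist_triangle[of x v m] m duv by (simp add: field_simps)
    have sm: "dist w m = \<bar>dist x w - dist x m\<bar>" if w: "w \<in> S" for w
    proof (cases "dist x w \<le> r")
      case True
      then have "dist x w \<le> dist x u" using u(2) w unfolding A_B_def by simp
      then have "dist w m \<le> dist x m - dist x w"
        using dist_triangle[of w m u] SX(5)[OF w uS(1)] m duv fm by (simp add: field_simps)
      then show ?thesis using dist_triangle[of x m w] zero_le_dist[of w m] by linarith
    next
      case False
      then have "dist x v \<le> dist x w" using v(2) w unfolding A_B_def by simp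
      then have "dist w m \<le> dist x w - dist x m"
        using dist_triangle[of w m v] SX(5)[OF w uS(2)] m duv fm by (simp add: field_simps dist_commute)
      then show ?thesis using dist_triangle[of x w m] zero_le_dist[of w m] dist_commute[of m w] by linarith
    qed
    have "dist x m \<le> d" using fm SX(4)[OF uS(1)] SX(4)[OF uS(2)] by simp
    moreover have "dist u v = \<bar>dist x u - dist x v\<bar>" if "u \<in> insert m S" "v \<in> insert m S" for u v
    proof (cases "u = m"; cases "v = m")
      assume "u = m" "v \<noteq> m"
      then show ?thesis using sm[of v] that by (simp add: dist_commute abs_minus_commute)
    qed (use sm SX(5) that in auto)
    ultimately have "P (insert m S)" unfolding P_def using SX(1-4) m(1) by blast
    then have "m \<in> S" using S(2) by blast
    show False
    proof (cases "dist x m \<le> r")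
      case True
      then show False using u(2)[of m] \<open>m \<in> S\<close> fm lt unfolding A_B_def by simp
    next
      case False
      then show False using v(2)[of m] \<open>m \<in> S\<close> fm lt unfolding A_B_def by simp
    qed
  qed
  define s where "s r = (SOME u. u \<in> S \<and> dist x u = r * d)" for r
  have d0: "0 \<le> d" unfolding d_def by simp
  have s: "s r \<in> S" "dist x (s r) = r * d" if "r \<in> {0..1}" for r
  proof -
    have "\<exists>u. u \<in> S \<and> dist x u = r * d" using ex[of "r * d"] that d0 by (auto simp: mult_left_le_one_le)
    then have "s r \<in> S \<and> dist x (s r) = r * d" unfolding s_def by (rule someI_ex)
    then show "s r \<in> S" "dist x (s r) = r * d" by auto
  qed
  have iso: "dist (s a) (s b) = \<bar>a - b\<bar> * d" if "a \<in> {0..1}" "b \<in> {0..1}" for a b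
    using SX(5)[OF s(1)[OF that(1)] s(1)[OF that(2)]] s(2) that d0
    by (simp add: abs_mult flip: left_diff_distrib)
  have "s 0 = x" using s(2)[of 0] by simp
  moreover have "s 1 = y"
    using SX(5)[OF s(1)[of 1] SX(3)] s(2)[of 1] unfolding d_def by simp
  moreover have "s ` {0..1} \<subseteq> X" using s(1) SX(1) by blast
  moreover have "continuous_on {0..1} s"
  proof (rule continuous_onI)
    fix a e :: real assume a: "a \<in> {0..1}" "0 < e"
    show "\<exists>da>0. \<forall>b\<in>{0..1}. dist b a < da \<longrightarrow> dist (s b) (s a) \<le> e"
    proof (intro exI[of _ "e / (d + 1)"] conjI ballI impI)
      fix b assume b: "b \<in> {0..1}" "dist b a < e / (d + 1)"
      have "dist (s b) (s a) = \<bar>b - a\<bar> * d" using iso a b by simp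
      also have "\<dots> \<le> e / (d + 1) * (d + 1)" using b d0 by (intro mult_mono) (auto simp: dist_real_def)
      finally show "dist (s b) (s a) \<le> e" using d0 by simp
    qed (use a d0 in simp)
  qed
  moreover have "curve_length s 0 1 = ereal d"
  proof (rule antisym)
    show "ereal d \<le> curve_length s 0 1" using curve_length_ge_dist[of 0 1 s] iso[of 0 1] by simp
    show "curve_length s 0 1 \<le> ereal d" unfolding curve_length_def
    proof (rule SUP_least, clarsimp)
      fix n and p :: "nat \<Rightarrow> real" assume p: "p 0 = 0" "p n = 1" "\<forall>i<n. p i \<le> p (Suc i)"
      have ge: "0 \<le> p i" if "i \<le> n" for i using that by (induction i) (use p in \<open>auto intro: order_trans\<close>)
      have le: "p (n - i) \<le> 1" if "i \<le> n" for i using that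
      proof (induction i)
        case (Suc i)
        then have "p (n - Suc i) \<le> p (Suc (n - Suc i))" using p by simp
        also have "Suc (n - Suc i) = n - i" using Suc by simp
        finally show ?case using Suc by simp
      qed (use p in simp)
      have in01: "p i \<in> {0..1}" if "i \<le> n" for i using ge[OF that] le[of "n - i"] that by simp
      have "(\<Sum>i<n. dist (s (p i)) (s (p (Suc i)))) = (\<Sum>i<n. p (Suc i) * d - p i * d)"
        using iso in01 p(3) by (intro sum.cong) (auto simp: left_diff_distrib)
      also have "\<dots> = p n * d - p 0 * d" by (rule sum_lessThan_telescope)
      finally show "(\<Sum>i<n. dist (s (p i)) (s (p (Suc i)))) \<le> d" using p by simp
    qed
  qed
  ultimately have "shortest_path X s x y" unfolding shortest_path_def d_def by auto
  then show ?thesis using iso unfolding d_def by blast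
qed

section \<open>Crossing paths in the disk\<close>

text \<open>Both paths fit into a box with bottom edge on the real axis, and their ends alternate on
  this edge. This is the situation of the Fashoda theorem \<open>fashoda_interlace\<close>,
  transported to \<open>real^2\<close>.\<close>

lemma alternating_paths_meet_half_plane:
  fixes f g :: "real \<Rightarrow> complex"
  assumes "path f" "path g" and im: "\<And>z. z \<in> path_image f \<union> path_image g \<Longrightarrow> 0 \<le> Im z"
    and "Im (pathstart f) = 0" "Im (pathfinish f) = 0" "Im (pathstart g) = 0" "Im (pathfinish g) = 0"
    and "Re (pathstart f) < Re (pathstart g)" "Re (pathstart g) < Re (pathfinish f)" "Re (pathfinish f) < Re (pathfinish g)"
  shows "path_image f \<inter> path_image g \<noteq> {}"
proof -
  define E :: "complex \<Rightarrow> real^2" where "E z = Re z *\<^sub>R axis 1 1 + Im z *\<^sub>R axis 2 1" for z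
  have E: "E z $ 1 = Re z" "E z $ 2 = Im z" for z unfolding E_def by (auto simp: axis_def)
  have cE: "continuous_on A E" for A unfolding E_def by (intro continuous_intros)
  have "bounded (path_image f \<union> path_image g)"
    using assms by (simp add: bounded_path_image)
  then obtain B where B: "\<And>z. z \<in> path_image f \<union> path_image g \<Longrightarrow> norm z \<le> B" unfolding bounded_iff by blast
  define a b :: "real^2" where "a = - B *\<^sub>R axis 1 1" "b = B *\<^sub>R axis 1 1 + B *\<^sub>R axis 2 1"
  have ab: "a $ 1 = -B" "a $ 2 = 0" "b $ 1 = B" "b $ 2 = B" unfolding a_b_def by (auto simp: axis_def)
  have box: "E z \<in> cbox a b" if "z \<in> path_image f \<union> path_image g" for z
    using B[OF that] im[OF that] abs_Re_le_cmod[of z] abs_Im_le_cmod[of z]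
    unfolding mem_box_cart forall_2 E ab by auto
  have "path (E \<circ> f)" "path (E \<circ> g)" using assms cE by (auto intro!: path_continuous_image)
  then obtain w where w: "w \<in> path_image (E \<circ> f)" "w \<in> path_image (E \<circ> g)"
    by (rule fashoda_interlace[of "E \<circ> f" "E \<circ> g" a b])
      (use box assms in \<open>auto simp: path_image_compose pathstart_compose pathfinish_compose E ab\<close>)
  then obtain u v where uv: "u \<in> path_image f" "v \<in> path_image g" "E u = E v" by (auto simp: path_image_compose)
  have "u = v" using arg_cong[OF uv(3), of "\<lambda>x. x $ 1"] arg_cong[OF uv(3), of "\<lambda>x. x $ 2"] E
    by (auto simp: complex_eq_iff)
  then show ?thesis using uv by auto
qed

text \<open>The Moebius map sending the omitted boundary point to infinity takes the disk to a half-plane.\<close>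

lemma alternating_paths_meet_disk_aux:
  fixes c :: "real \<Rightarrow> complex" and p q :: "real \<Rightarrow> complex"
  assumes c: "continuous_on UNIV c" "\<And>t. norm (c t) = 1" "\<And>s t. s < t \<Longrightarrow> t < s + L \<Longrightarrow> c s \<noteq> c t"
    and r: "tz < ra" "ra < rb" "rb < rc" "rc < rd" "rd < tz + L"
    and p: "path p" "path_image p \<subseteq> cball 0 1 - {c tz}" "pathstart p = c ra" "pathfinish p = c rc"
    and q: "path q" "path_image q \<subseteq> cball 0 1 - {c tz}" "pathstart q = c rb" "pathfinish q = c rd"
  shows "path_image p \<inter> path_image q \<noteq> {}"
proof -
  define w where "w = c tz"
  define M where "M z = \<i> * (w + z) / (w - z)" for z
  have nw: "norm w = 1" unfolding w_def using c by simp
  have w0: "w \<noteq> 0" using nw by auto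
  \<comment> \<open>By this formula the disk goes to the closed upper half-plane and the circle to
    the real line.\<close>
  have im: "Im (M z) = (1 - (norm z)\<^sup>2) / (norm (w - z))\<^sup>2" for z
  proof -
    have "M z = \<i> * ((w + z) * cnj (w - z)) / of_real ((norm (w - z))\<^sup>2)"
      unfolding M_def complex_norm_square
      by (cases "w = z") (simp_all del: complex_cnj_diff)
    then have "Im (M z) = Re ((w + z) * cnj (w - z)) / (norm (w - z))\<^sup>2" by (simp add: Im_divide_of_real)
    moreover have "Re ((w + z) * cnj (w - z)) = (norm w)\<^sup>2 - (norm z)\<^sup>2"
      unfolding cmod_power2 by (simp add: power2_eq_square algebra_simps)
    ultimately show ?thesis using nw by simp
  qed
  have inj: "x = y" if "M x = M y" "x \<noteq> w" "y \<noteq> w" for x y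
  proof -
    have "(w + x) * (w - y) = (w + y) * (w - x)" using that unfolding M_def by (simp add: field_simps)
    then have "2 * w * (x - y) = 0" by (simp add: algebra_simps)
    then show ?thesis using w0 by simp
  qed
  have cM: "continuous_on (A - {w}) M" for A unfolding M_def by (intro continuous_intros) auto
  have cw: "c t \<noteq> w" if "tz < t" "t < tz + L" for t using c(3)[of tz t] that unfolding w_def by auto
  define f where "f t = Re (M (c t))" for t
  have Mc: "M (c t) = of_real (f t)" for t unfolding f_def using im[of "c t"] c(2) by (simp add: complex_eq_iff)
  have fc: "continuous_on {ra..rd} f"
  proof -
    have "continuous_on {ra..rd} (M \<circ> c)"
      by (rule continuous_on_compose[OF continuous_on_subset[OF c(1)]], simp)
         (rule continuous_on_subset[OF cM[of UNIV]], use cw r in force)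
    then show ?thesis unfolding f_def o_def by (intro continuous_intros)
  qed
  have fi: "inj_on f {ra..rd}"
  proof (rule inj_onI)
    fix x y assume xy: "x \<in> {ra..rd}" "y \<in> {ra..rd}" "f x = f y"
    then have "c x = c y" using inj[of "c x" "c y"] Mc cw r by auto
    then show "x = y" using c(3)[of x y] c(3)[of y x] xy r by (cases x y rule: linorder_cases) auto
  qed
  \<comment> \<open>A continuous injection of an interval is monotone, increasing or decreasing with
    the orientation of \<open>c\<close>. Both alternatives compare \<open>f rb\<close> with
    \<open>f rc\<close>, so \<open>m1\<close> and \<open>m2\<close> agree on the direction.\<close>
  have m1: "(f ra < f rb \<and> f rb < f rc) \<or> (f rc < f rb \<and> f rb < f ra)"
    by (rule continuous_inj_imp_mono) (use r in \<open>auto intro: continuous_on_subset[OF fc] inj_on_subset[OF fi]\<close>)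
  have m2: "(f rb < f rc \<and> f rc < f rd) \<or> (f rd < f rc \<and> f rc < f rb)"
    by (rule continuous_inj_imp_mono) (use r in \<open>auto intro: continuous_on_subset[OF fc] inj_on_subset[OF fi]\<close>)
  have pM: "path (M \<circ> p)" "path (M \<circ> q)"
    by (rule path_continuous_image[OF p(1) continuous_on_subset[OF cM p(2)[folded w_def]]],
        rule path_continuous_image[OF q(1) continuous_on_subset[OF cM q(2)[folded w_def]]])
  have ge: "0 \<le> Im z" if z: "z \<in> path_image (M \<circ> p) \<union> path_image (M \<circ> q)" for z
  proof -
    obtain u where u: "z = M u" "u \<in> path_image p \<union> path_image q" using z by (auto simp: path_image_compose)
    then have "norm u \<le> 1" using p(2) q(2) by auto
    then have "(norm u)\<^sup>2 \<le> 1" by (simp add: power_le_one)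
    then show ?thesis unfolding u(1) im by simp
  qed
  have "path_image (M \<circ> p) \<inter> path_image (M \<circ> q) \<noteq> {}"
  proof (cases "f ra < f rb")
    case True
    then show ?thesis using m1 m2 ge pM p q
      by (intro alternating_paths_meet_half_plane) (auto simp: pathstart_compose pathfinish_compose Mc)
  next
    case False
    \<comment> \<open>In the decreasing case the ends interlace from left to right once both paths
      are reversed and exchange their roles.\<close>
    have "path_image (reversepath (M \<circ> q)) \<inter> path_image (reversepath (M \<circ> p)) \<noteq> {}"
      using False m1 m2 ge pM p q
      by (intro alternating_paths_meet_half_plane) (auto simp: pathstart_compose pathfinish_compose Mc)
    then show ?thesis by auto
  qed
  then obtain u v where uv: "u \<in> path_image p" "v \<in> path_image q" "M u = M v" by (auto simp: path_image_compose)
  have "u = v" using inj[OF uv(3)] uv p(2) q(2) unfolding w_def by auto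
  then show ?thesis using uv by auto
qed

text \<open>Two disjoint closed paths both meeting the circle cannot cover it, since it is
  connected. So some boundary point is omitted and can be sent to infinity; its position among the
  four ends decides how they are relabelled cyclically.\<close>

lemma alternating_paths_meet_disk:
  fixes c :: "real \<Rightarrow> complex" and p q :: "real \<Rightarrow> complex"
  assumes c: "continuous_on UNIV c" "\<And>s t. s < t \<Longrightarrow> t < s + L \<Longrightarrow> c s \<noteq> c t"
    and per: "\<And>t. c (t + L) = c t" and surj: "\<And>a. c ` {a..<a + L} = sphere 0 1"
    and r: "r1 < r2" "r2 < r3" "r3 < r4" "r4 < r1 + L"
    and p: "path p" "path_image p \<subseteq> cball 0 1" "pathstart p = c r1" "pathfinish p = c r3"
    and q: "path q" "path_image q \<subseteq> cball 0 1" "pathstart q = c r2" "pathfinish q = c r4"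
  shows "path_image p \<inter> path_image q \<noteq> {}"
proof
  assume dis: "path_image p \<inter> path_image q = {}"
  have nc: "norm (c t) = 1" for t
  proof -
    have "c t \<in> c ` {t..<t + L}" using r by auto
    then show ?thesis unfolding surj by simp
  qed
  have ends: "c r1 \<in> path_image p" "c r3 \<in> path_image p" "c r2 \<in> path_image q" "c r4 \<in> path_image q"
    using p q by (metis pathstart_in_path_image pathfinish_in_path_image)+
  have "\<not> sphere 0 1 \<subseteq> path_image p \<union> path_image q"
  proof
    assume cov: "sphere 0 1 \<subseteq> path_image p \<union> path_image q"
    have "connected (sphere (0::complex) 1)" by (rule connected_sphere) simp
    moreover have "closed (path_image p)" "closed (path_image q)" using p q by (auto simp: closed_path_image)
    moreover have "path_image p \<inter> sphere 0 1 \<noteq> {}" "path_image q \<inter> sphere 0 1 \<noteq> {}" using ends nc by force+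
    ultimately show False using cov dis unfolding connected_closed by blast
  qed
  then obtain w where w: "w \<in> sphere 0 1" "w \<notin> path_image p" "w \<notin> path_image q" by blast
  then obtain t0 where t0: "r4 - L \<le> t0" "t0 < r4" "w = c t0" using surj[of "r4 - L"] by fastforce
  have ne: "t0 \<noteq> r1" "t0 \<noteq> r2" "t0 \<noteq> r3" "t0 \<noteq> r4 - L" using t0 w ends per[of "r4 - L"] by auto
  have av: "path_image p \<subseteq> cball 0 1 - {c t0}" "path_image q \<subseteq> cball 0 1 - {c t0}" using p q w t0 by auto
  note aux = alternating_paths_meet_disk_aux[where c = c and L = L, OF c(1) nc c(2)]
  consider "t0 < r1" | "r1 < t0" "t0 < r2" | "r2 < t0" "t0 < r3" | "r3 < t0" using ne by linarith
  then show False
  proof cases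
    case 1
    then show ?thesis using aux[where tz = t0 and ra = r1 and rb = r2 and rc = r3 and rd = r4 and p = p and q = q] r p q av t0 ne dis by auto
  next
    case 2
    then show ?thesis using aux[where tz = t0 and ra = r2 and rb = r3 and rc = r4 and rd = "r1 + L" and p = q and q = "reversepath p"] r p q av t0 ne dis per by auto
  next
    case 3
    then show ?thesis using aux[where tz = t0 and ra = r3 and rb = r4 and rc = "r1 + L" and rd = "r2 + L" and p = "reversepath p" and q = "reversepath q"] r p q av t0 ne dis per by auto
  next
    case 4
    then show ?thesis using aux[where tz = t0 and ra = r4 and rb = "r1 + L" and rc = "r2 + L" and rd = "r3 + L" and p = "reversepath q" and q = p] r p q av t0 ne dis per by auto
  qed
qed

section \<open>Superadditivity of comparison angles\<close>

text \<open>Toponogov comparison bounds \<open>dist a (f r)\<close> from below, and the law of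
  cosines turns this into a bound on the angle at \<open>b\<close>. The comparison triangle is given
  in coordinates, with \<open>b'\<close> at the origin or the north pole and \<open>c'\<close>,
  \<open>d'\<close> in the same direction from it, so that \<open>a'\<close> is seen under the angle
  \<open>t\<close> from both.\<close>

lemma hinge_monotone:
  fixes X :: "'a::metric_space set"
  assumes K: "K \<ge> 0" and X: "alexandrov_curv_ge K X" and abc: "a \<in> X" "b \<in> X" "c \<in> X"
    and sp: "shortest_path X f b c" "r \<in> {0..1}" and d: "dist b (f r) + dist (f r) c = dist b c"
    and ne: "a \<noteq> b" "b \<noteq> f r" and per: "small_perimeter K (dist a b + dist b c + dist c a)"
  shows "model_angle K (dist b a) (dist b c) (dist a c) \<le> model_angle K (dist b a) (dist b (f r)) (dist a (f r))"
proof -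
  define w where "w = f r"
  have bc: "b \<noteq> c" using d ne by (metis add_nonneg_eq_0_iff dist_eq_0_iff dist_self zero_le_dist)
  have ts: "triangle_sides K (dist b a) (dist b c) (dist a c)" unfolding triangle_sides_def
    using ne bc per dist_triangle[of a c b] dist_triangle[of b a c] dist_triangle[of b c a]
    by (auto simp: dist_commute algebra_simps)
  define t where "t = model_angle K (dist b a) (dist b c) (dist a c)"
  have t0: "0 \<le> t" "t \<le> pi" unfolding t_def by (auto simp: model_angle_bounds)
  note law = cos_angle_law[OF K ts, folded t_def]
  have top: "model_dist K a' d' \<le> dist a w"
    if "comparison_triangle K a b c a' b' c'" "d' \<in> model_space K" "model_dist K b' d' = dist b w" "model_dist K d' c' = dist w c"
    for a' b' c' d'
  proof -
    have "K > 0 \<longrightarrow> dist a b + dist b c + dist c a < 2 * pi / sqrt K" using per unfolding small_perimeter_def .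
    then show ?thesis using X abc sp that unfolding alexandrov_curv_ge_def w_def by blast
  qed
  have pos: "0 < dist b a" "0 < dist b w" "0 < dist b c" using ne bc unfolding w_def by auto
  have "cos_angle K (dist b a) (dist b w) (dist a w) \<le> cos t"
  proof (cases "K = 0")
    case True
    define x y z where "x = dist b a" "y = dist b c" "z = dist b w"
    have "dist w c = y - z" using d unfolding x_y_z_def w_def by simp
    moreover from this have "0 \<le> y - z" using zero_le_dist[of w c] by simp
    ultimately have p: "0 < x" "0 < y" "0 < z" "dist w c = y - z" "0 \<le> y - z" using pos unfolding x_y_z_def by auto
    let ?a = "vector [x * cos t, x * sin t, 0] :: real^3" and ?b = "vector [0, 0, 0] :: real^3" and
      ?c = "vector [y, 0, 0] :: real^3" and ?d = "vector [z, 0, 0] :: real^3"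
    have dist_sq: "(dist (vector [p, q, 0]) (vector [u, v, 0] :: real^3))\<^sup>2 = (p - u)\<^sup>2 + (q - v)\<^sup>2" for p q u v :: real
      unfolding dist_norm power2_norm_eq_inner inner_vec_def sum_3 by (simp add: power2_eq_square)
    have e: "dist P Q = q" if "(dist P Q)\<^sup>2 = q\<^sup>2" "0 \<le> q" for P Q :: "real^3" and q
      using that(1) by (rule power2_eq_imp_eq) (use that(2) in auto)
    have xt: "(x * cos t - q)\<^sup>2 + (x * sin t)\<^sup>2 = x\<^sup>2 + q\<^sup>2 - 2 * x * q * cos t" for q
      using polar_norm[of x t] by (simp add: power2_eq_square algebra_simps)
    have "dist ?a ?b = x" by (rule e, unfold dist_sq) (use xt[of 0] p in auto)
    moreover have "dist ?b ?c = y" "dist ?b ?d = z" "dist ?d ?c = y - z"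
      by (rule e, unfold dist_sq, use p in \<open>auto simp: power2_commute\<close>)+
    moreover have "dist ?c ?a = dist c a"
    proof (rule e)
      have "(dist ?a ?c)\<^sup>2 = (dist a c)\<^sup>2" unfolding dist_sq law(1)[OF True] using xt[of y] by (simp add: x_y_z_def)
      then show "(dist ?c ?a)\<^sup>2 = (dist c a)\<^sup>2" by (simp add: dist_commute)
    qed simp
    ultimately have "model_dist K ?a ?d \<le> dist a w"
      using p(4) True by (intro top[of ?a ?b ?c ?d]) (auto simp: comparison_triangle_def model_space_def model_dist_def x_y_z_def dist_commute)
    then have "dist ?a ?d \<le> dist a w" unfolding model_dist_def using True by simp
    then have "(dist ?a ?d)\<^sup>2 \<le> (dist a w)\<^sup>2" by (intro power_mono) auto
    then have "x\<^sup>2 + z\<^sup>2 - 2 * x * z * cos t \<le> (dist a w)\<^sup>2" unfolding dist_sq using xt[of z] by simp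
    then show ?thesis unfolding cos_angle_def x_y_z_def[symmetric] using True p by (simp add: field_simps)
  next
    case False
    then have K0: "K > 0" using K by simp
    define s where "s = sqrt K"
    have s: "s > 0" "s * s = K" unfolding s_def using K0 by auto
    define x y z where "x = s * dist b a" "y = s * dist b c" "z = s * dist b w"
    note sc = triangle_sides_scaled[OF K0 ts, folded s_def, folded x_y_z_def]
    have dw: "s * dist w c = y - z" using d unfolding x_y_z_def w_def by (simp flip: right_diff_distrib)
    moreover have "0 \<le> s * dist w c" using s by simp
    ultimately have z: "0 < z" "z \<le> y" using pos s unfolding x_y_z_def by auto
    let ?a = "vector [sin x * cos t, sin x * sin t, cos x] :: real^3" and ?b = "vector [0, 0, 1] :: real^3" and
      ?c = "vector [sin y, 0, cos y] :: real^3" and ?d = "vector [sin z, 0, cos z] :: real^3"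
    have "?a \<bullet> ?a = 1" "?b \<bullet> ?b = 1" "?c \<bullet> ?c = 1" "?d \<bullet> ?d = 1"
      unfolding inner_vector_3 polar_norm by (simp_all flip: power2_eq_square)
    then have un: "norm ?a = 1" "norm ?b = 1" "norm ?c = 1" "norm ?d = 1" by (simp_all add: norm_eq_1)
    have ms: "(1/s) *\<^sub>R u \<in> model_space K" if "norm u = 1" for u using that K0 s unfolding model_space_def s_def by simp
    have md: "model_dist K ((1/s) *\<^sub>R u) ((1/s) *\<^sub>R v) = arccos (u \<bullet> v) / s" for u v
      using K0 s unfolding model_dist_def by (simp flip: s_def)
    have dots: "?a \<bullet> ?b = cos x" "?b \<bullet> ?c = cos y" "?c \<bullet> ?a = cos (s * dist a c)" "?b \<bullet> ?d = cos z" "?d \<bullet> ?c = cos (y - z)"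
       "?a \<bullet> ?d = cos x * cos z + sin x * sin z * cos t"
      unfolding inner_vector_3 law(2)[OF K0, folded s_def, folded x_y_z_def] cos_diff by (simp_all add: algebra_simps)
    have ar: "arccos (cos (s * q)) / s = q" if "0 \<le> s * q" "s * q \<le> pi" for q
      using arccos_cos[OF that] s by simp
    have arcs: "arccos (cos x) / s = dist a b" "arccos (cos y) / s = dist b c" "arccos (cos (s * dist a c)) / s = dist c a"
        "arccos (cos z) / s = dist b w" "arccos (cos (y - z)) / s = dist w c"
      using ar[of "dist b a"] ar[of "dist b c"] ar[of "dist a c"] ar[of "dist b w"] ar[of "dist w c"] sc z
      unfolding x_y_z_def[symmetric] dw by (auto simp: dist_commute)
    have "model_dist K ((1/s) *\<^sub>R ?a) ((1/s) *\<^sub>R ?d) \<le> dist a w"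
    proof (rule top)
      show "comparison_triangle K a b c ((1/s) *\<^sub>R ?a) ((1/s) *\<^sub>R ?b) ((1/s) *\<^sub>R ?c)"
        unfolding comparison_triangle_def md dots arcs using ms un by blast
      show "(1/s) *\<^sub>R ?d \<in> model_space K" using ms un by blast
      show "model_dist K ((1/s) *\<^sub>R ?b) ((1/s) *\<^sub>R ?d) = dist b w"
        unfolding md dots arcs ..
      show "model_dist K ((1/s) *\<^sub>R ?d) ((1/s) *\<^sub>R ?c) = dist w c"
        unfolding md dots arcs ..
    qed
    then have le: "arccos (?a \<bullet> ?d) \<le> s * dist a w" unfolding md using s by (simp add: field_simps)
    have aw: "s * dist a w \<le> pi"
    proof -
      have "2 * dist a w \<le> dist a b + dist b c + dist c a"
        using dist_triangle[of a w b] dist_triangle[of a w c] d unfolding w_def by (simp add: dist_commute)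
      moreover have "s * (dist a b + dist b c + dist c a) < 2 * pi" using per small_perimeter_scaled[OF K0] unfolding s_def by simp
      moreover have "s * (2 * dist a w) \<le> s * (dist a b + dist b c + dist c a)"
        using s by (intro mult_left_mono) (use calculation in auto)
      ultimately show ?thesis by linarith
    qed
    have "\<bar>?a \<bullet> ?d\<bar> \<le> 1" using Cauchy_Schwarz_ineq2[of ?a ?d] un by simp
    then have ac: "0 \<le> arccos (?a \<bullet> ?d)" "cos (arccos (?a \<bullet> ?d)) = ?a \<bullet> ?d" by (auto simp: cos_arccos_abs arccos_lbound)
    have "cos (s * dist a w) \<le> cos (arccos (?a \<bullet> ?d))" using le aw ac(1) by (intro cos_monotone_0_pi_le) auto
    then have "cos (s * dist a w) \<le> ?a \<bullet> ?d" unfolding ac(2) .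
    then have "cos (s * dist a w) \<le> cos x * cos z + sin x * sin z * cos t" unfolding dots .
    moreover have "0 < sin x" "0 < sin z" using sc z by (auto intro!: sin_gt_zero)
    ultimately show ?thesis unfolding cos_angle_def using False by (simp add: field_simps flip: s_def x_y_z_def)
  qed
  from le_clamped_arccos[OF t0 this] show ?thesis unfolding t_def model_angle_def w_def .
qed

lemma model_angle_straight:
  assumes K: "K \<ge> 0" and bc: "0 < b" "0 < c" "K > 0 \<Longrightarrow> sqrt K * b < pi" "K > 0 \<Longrightarrow> sqrt K * c < pi"
  shows "model_angle K b c (b + c) = pi"
proof -
  have "cos_angle K b c (b + c) = -1"
  proof (cases "K = 0")
    case True
    then show ?thesis using bc unfolding cos_angle_def by (simp add: field_simps power2_eq_square)
  next
    case False
    then have K0: "K > 0" using K by simp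
    have "0 < sin (sqrt K * b)" "0 < sin (sqrt K * c)" using K0 bc by (auto intro!: sin_gt_zero)
    then show ?thesis using False unfolding cos_angle_def by (simp add: distrib_left cos_add)
  qed
  then show ?thesis unfolding model_angle_def clamped_arccos_def by simp
qed

text \<open>Monotonicity is applied at the end \<open>x\<close> of the path, not at
  \<open>p\<close>. Cleared of denominators, the inequality between the two cosines at
  \<open>x\<close> becomes, as in Stewart's theorem, the statement that the two cosines at
  \<open>p\<close> have a nonnegative sum.\<close>

lemma adjacent_angles_le_pi:
  fixes X :: "'a::metric_space set"
  assumes K: "K \<ge> 0" and X: "alexandrov_curv_ge K X" and xyz: "x \<in> X" "y \<in> X" "z \<in> X"
    and sp: "shortest_path X f x z" "r \<in> {0..1}" and p: "p = f r" "dist x p + dist p z = dist x z"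
    and ne: "p \<noteq> x" "p \<noteq> y" "p \<noteq> z" "x \<noteq> y" and per: "small_perimeter K (dist y x + dist x z + dist z y)" 
    "small_perimeter K (dist p x + dist x y + dist y p)" "small_perimeter K (dist p y + dist y z + dist z p)"
  shows "model_angle K (dist p x) (dist p y) (dist x y) + model_angle K (dist p y) (dist p z) (dist y z) \<le> pi"
proof -
  define h k m B C where "h = dist p y" "k = dist x y" "m = dist y z" "B = dist p x" "C = dist p z"
  have xz: "dist x z = B + C" using p(2) unfolding h_k_m_B_C_def by (simp add: dist_commute)
  have pos: "0 < h" "0 < k" "0 < B" "0 < C" using ne unfolding h_k_m_B_C_def by auto
  have tri: "m \<le> h + C" "h \<le> m + C" "C \<le> m + h" "k \<le> B + h" "B \<le> k + h" "h \<le> k + B" "m \<le> k + (B + C)" "k \<le> m + (B + C)" "B + C \<le> m + k" "0 \<le> m"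
    unfolding xz[symmetric] unfolding h_k_m_B_C_def
    using dist_triangle[of y z p] dist_triangle[of p y z] dist_triangle[of p z y] dist_triangle[of x y p] dist_triangle[of p x y] dist_triangle[of p y x]
     dist_triangle[of y z x] dist_triangle[of x y z] dist_triangle[of x z y] by (auto simp: dist_commute)
  have t1: "triangle_sides K B h k" "triangle_sides K h C m" "triangle_sides K k (B + C) m" "triangle_sides K k B h"
  proof -
    have "small_perimeter K (k + B + h)" "small_perimeter K (m + h + C)" "small_perimeter K (m + k + (B + C))"
      using per unfolding xz unfolding h_k_m_B_C_def by (simp_all add: dist_commute algebra_simps)
    then show "triangle_sides K B h k" "triangle_sides K h C m" "triangle_sides K k (B + C) m" "triangle_sides K k B h"
      using tri pos unfolding triangle_sides_def by (auto simp: algebra_simps)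
  qed
  have "model_angle K (dist x y) (dist x z) (dist y z) \<le> model_angle K (dist x y) (dist x (f r)) (dist y (f r))"
    by (rule hinge_monotone[OF K X xyz(2,1,3) sp]) (use p ne per in auto)
  then have "model_angle K k (B + C) m \<le> model_angle K k B h"
    using xz p(1) unfolding h_k_m_B_C_def by (simp add: dist_commute)
  then have "cos (model_angle K k B h) \<le> cos (model_angle K k (B + C) m)"
    by (intro cos_monotone_0_pi_le) (auto simp: model_angle_bounds)
  then have c: "cos_angle K k B h \<le> cos_angle K k (B + C) m" using cos_model_angle K t1 by simp
  have "0 \<le> cos_angle K B h k + cos_angle K h C m"
  proof (cases "K = 0")
    case True
    have "(k\<^sup>2 + B\<^sup>2 - h\<^sup>2) / (2 * k * B) \<le> (k\<^sup>2 + (B + C)\<^sup>2 - m\<^sup>2) / (2 * k * (B + C))"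
      using c True unfolding cos_angle_def by simp
    then have "(k\<^sup>2 + B\<^sup>2 - h\<^sup>2) * (B + C) \<le> (k\<^sup>2 + (B + C)\<^sup>2 - m\<^sup>2) * B"
      using pos by (simp add: divide_simps mult_ac) (simp add: algebra_simps)
    then have "0 \<le> C * (B\<^sup>2 + h\<^sup>2 - k\<^sup>2) + B * (h\<^sup>2 + C\<^sup>2 - m\<^sup>2)" by (simp add: power2_eq_square algebra_simps)
    then have "0 \<le> (C * (B\<^sup>2 + h\<^sup>2 - k\<^sup>2) + B * (h\<^sup>2 + C\<^sup>2 - m\<^sup>2)) / (2 * B * h * C)" using pos by simp
    also have "\<dots> = cos_angle K B h k + cos_angle K h C m" using True pos unfolding cos_angle_def by (simp add: field_simps)
    finally show ?thesis .
  next
    case False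
    then have K0: "K > 0" using K by simp
    define h' k' m' B' C' where "h' = sqrt K * h" "k' = sqrt K * k" "m' = sqrt K * m" "B' = sqrt K * B" "C' = sqrt K * C"
    note defs = h'_k'_m'_B'_C'_def
    have BC: "sqrt K * (B + C) = B' + C'" unfolding defs by (simp add: distrib_left)
    note s1 = triangle_sides_scaled[OF K0 t1(1), folded defs] and s2 = triangle_sides_scaled[OF K0 t1(2), folded defs]
      and s3 = triangle_sides_scaled[OF K0 t1(3), folded defs, unfolded BC]
    have sn: "0 < sin h'" "0 < sin k'" "0 < sin B'" "0 < sin C'" "0 < sin (B' + C')"
      using sin_gt_zero[OF s1(2,10)] sin_gt_zero[OF s3(1,9)] sin_gt_zero[OF s1(1,9)] sin_gt_zero[OF s2(2,10)] sin_gt_zero[OF s3(2,10)]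
      by auto
    have "(cos h' - cos k' * cos B') / (sin k' * sin B') \<le> (cos m' - cos k' * cos (B' + C')) / (sin k' * sin (B' + C'))"
      using c False unfolding cos_angle_def BC defs[symmetric] by simp
    then have "(cos h' - cos k' * cos B') * sin (B' + C') \<le> (cos m' - cos k' * cos (B' + C')) * sin B'"
      using sn by (simp add: divide_simps mult_ac)
    moreover have "sin (B' + C') * cos B' - cos (B' + C') * sin B' = sin C'" using sin_diff[of "B' + C'" B'] by simp
    then have "cos k' * (sin (B' + C') * cos B' - cos (B' + C') * sin B') = cos k' * sin C'" by simp
    ultimately have "0 \<le> cos m' * sin B' - cos h' * sin (B' + C') + cos k' * sin C'" by (simp add: algebra_simps)
    then have "0 \<le> sin C' * (cos k' - cos B' * cos h') + sin B' * (cos m' - cos h' * cos C')"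
      unfolding sin_add by (simp add: algebra_simps)
    then have "0 \<le> (sin C' * (cos k' - cos B' * cos h') + sin B' * (cos m' - cos h' * cos C')) / (sin B' * sin h' * sin C')"
      using sn by simp
    also have "\<dots> = cos_angle K B h k + cos_angle K h C m" unfolding cos_angle_def defs[symmetric] using False sn 
      by (simp add: add_divide_distrib)
    finally show ?thesis .
  qed
  then have "cos (pi - model_angle K h C m) \<le> cos (model_angle K B h k)" using cos_model_angle K t1 by simp
  then have "model_angle K B h k \<le> pi - model_angle K h C m"
    by (subst (asm) cos_mono_le_eq) (auto simp: model_angle_bounds)
  then show ?thesis unfolding h_k_m_B_C_def by simp
qed

text \<open>Let \<open>v\<close> be the crossing point. Replacing \<open>y\<close> by
  \<open>v\<close> on the path from \<open>p\<close> enlarges both angles at \<open>p\<close>, and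
  since \<open>v\<close> lies on the path from \<open>x\<close> to \<open>z\<close>, the two smaller
  triangles glue to one with opposite side \<open>dist x z\<close>. If \<open>v = p\<close>, the
  total angle is straight and \<open>adjacent_angles_le_pi\<close> applies.\<close>

lemma angles_superadditive:
  fixes X :: "'a::metric_space set"
  assumes K: "K \<ge> 0" and X: "alexandrov_curv_ge K X" and pts: "p \<in> X" "x \<in> X" "y \<in> X" "z \<in> X"
    and f: "shortest_path X f p y" "r \<in> {0..1}" "dist p (f r) + dist (f r) y = dist p y"
    and e: "shortest_path X e x z" "q \<in> {0..1}" "dist x (e q) + dist (e q) z = dist x z"
    and w: "f r = e q" and ne: "p \<noteq> x" "p \<noteq> y" "p \<noteq> z" "x \<noteq> y"
    and per: "small_perimeter K (dist p x + dist x y + dist y p)" "small_perimeter K (dist p y + dist y z + dist z p)"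
      "small_perimeter K (dist p x + dist x z + dist z p)" "small_perimeter K (dist x y + dist y z + dist z x)"
  shows "model_angle K (dist p x) (dist p y) (dist x y) + model_angle K (dist p y) (dist p z) (dist y z)
     \<le> model_angle K (dist p x) (dist p z) (dist x z)"
proof (cases "p = f r")
  case True
  have pz: "dist x p + dist p z = dist x z" using e(3) w True by simp
  have sm: "sqrt K * dist p x < pi" "sqrt K * dist p z < pi" if K0: "K > 0"
  proof -
    have "2 * dist p x \<le> dist p x + dist x z + dist z p" "2 * dist p z \<le> dist p x + dist x z + dist z p"
      using pz zero_le_dist[of p x] zero_le_dist[of p z] dist_commute[of x p] dist_commute[of z p] by linarith+
    then have "sqrt K * (2 * dist p x) \<le> sqrt K * (dist p x + dist x z + dist z p)"
      "sqrt K * (2 * dist p z) \<le> sqrt K * (dist p x + dist x z + dist z p)" using K0 by (auto intro!: mult_left_mono)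
    then show "sqrt K * dist p x < pi" "sqrt K * dist p z < pi" using per(3) small_perimeter_scaled[OF K0] by auto
  qed
  have "model_angle K (dist p x) (dist p z) (dist x z) = pi"
    using model_angle_straight[OF K, of "dist p x" "dist p z"] ne sm pz by (simp add: dist_commute)
  moreover have "model_angle K (dist p x) (dist p y) (dist x y) + model_angle K (dist p y) (dist p z) (dist y z) \<le> pi"
    by (rule adjacent_angles_le_pi[OF K X pts(2,3,4) e(1,2)]) (use True w pz ne per in \<open>auto simp: dist_commute algebra_simps\<close>)
  ultimately show ?thesis by simp
next
  case False
  define v where "v = f r"
  have pv: "p \<noteq> v" using False unfolding v_def .
  have fv: "dist p v + dist v y = dist p y" "dist x v + dist v z = dist x z" using f e w unfolding v_def by auto
  have "model_angle K (dist p x) (dist p y) (dist x y) \<le> model_angle K (dist p x) (dist p v) (dist x v)"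
    unfolding v_def by (rule hinge_monotone[OF K X pts(2,1,3) f(1,2)]) (use f ne False per in \<open>auto simp: dist_commute algebra_simps\<close>)
  moreover have "model_angle K (dist p z) (dist p y) (dist z y) \<le> model_angle K (dist p z) (dist p v) (dist z v)"
    unfolding v_def by (rule hinge_monotone[OF K X pts(4,1,3) f(1,2)]) (use f ne False per in \<open>auto simp: dist_commute algebra_simps\<close>)
  moreover have "model_angle K (dist p x) (dist p v) (dist x v) + model_angle K (dist p v) (dist p z) (dist v z)
     \<le> model_angle K (dist p x) (dist p z) (dist x v + dist v z)"
  proof (rule model_angle_gluing[OF K])
    have mono: "small_perimeter K b" if "small_perimeter K a" "b \<le> a" for a b using that unfolding small_perimeter_def by auto
    have "dist x v + dist p x + dist p v \<le> dist p x + dist x y + dist y p"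
      using dist_triangle[of x v y] fv by (simp add: dist_commute)
    then have "small_perimeter K (dist x v + dist p x + dist p v)" using mono per(1) by blast
    then show "triangle_sides K (dist p x) (dist p v) (dist x v)" unfolding triangle_sides_def
      using ne pv dist_triangle[of x v p] dist_triangle[of p x v] dist_triangle[of p v x] by (auto simp: dist_commute)
    have "dist v z + dist p v + dist p z \<le> dist p y + dist y z + dist z p"
      using dist_triangle[of v z y] fv by (simp add: dist_commute)
    then have "small_perimeter K (dist v z + dist p v + dist p z)" using mono per(2) by blast
    then show "triangle_sides K (dist p v) (dist p z) (dist v z)" unfolding triangle_sides_def
      using ne pv dist_triangle[of v z p] dist_triangle[of p z v] dist_triangle[of p v z] by (auto simp: dist_commute)
    show "dist x v + dist v z \<le> dist p x + dist p z" using fv dist_triangle[of x z p] by (simp add: dist_commute)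
    show "small_perimeter K (dist p x + dist p z + (dist x v + dist v z))" using per(3) fv by (simp add: dist_commute algebra_simps)
  qed
  ultimately show ?thesis using fv
    by (simp add: model_angle_commute[of K "dist p z"] dist_commute[of z])
qed

section \<open>Turning of boundary arcs\<close>

text \<open>An averaging argument: integrated over the offset, the number of hits is the measure of
  \<open>B\<close> inside the \<open>n\<close> cells, so the offset with the fewest hits satisfies
  the bound.\<close>

lemma lattice_hits:
  fixes B :: "real set"
  assumes B: "B \<in> sets borel" and fin: "emeasure lborel B < \<infinity>" and eta: "0 < \<eta>"
  shows "\<exists>r\<in>{0<..<\<eta>}. \<eta> * card {i. i < n \<and> s + r + real i * \<eta> \<in> B} \<le> measure lborel B"
proof -
  define N where "N r = card {i. i < n \<and> s + r + real i * \<eta> \<in> B}" for r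
  have "\<exists>r. r \<in> {0<..<\<eta>}" using eta by (intro exI[of _ "\<eta>/2"]) auto
  then obtain r where r: "r \<in> {0<..<\<eta>}" "\<And>q. q \<in> {0<..<\<eta>} \<Longrightarrow> N r \<le> N q"
    using ex_has_least_nat[of "\<lambda>r. r \<in> {0<..<\<eta>}" _ N] by blast
  define I where "I i = {s + real i * \<eta> <..< s + real (Suc i) * \<eta>}" for i
  have dj: "disjoint_family_on (\<lambda>i. B \<inter> I i) {..<n}"
  proof -
    have "I i \<inter> I j = {}" if "i < j" for i j
    proof -
      have "real (Suc i) * \<eta> \<le> real j * \<eta>" using that eta by (intro mult_right_mono) auto
      then show ?thesis unfolding I_def by auto
    qed
    then have "I i \<inter> I j = {}" if "i \<noteq> j" for i j using that by (metis Int_commute linorder_neqE_nat)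
    then show ?thesis unfolding disjoint_family_on_def by blast
  qed
  have m: "(\<lambda>x. indicator (B \<inter> I i) x :: ennreal) \<in> borel_measurable borel" for i using B unfolding I_def by measurable
  have "ennreal (real (N r) * \<eta>) = of_nat (N r) * emeasure lborel {0<..<\<eta>}"
    using eta by (simp add: ennreal_mult ennreal_of_nat_eq_real_of_nat)
  also have "\<dots> = (\<integral>\<^sup>+q. of_nat (N r) * indicator {0<..<\<eta>} q \<partial>lborel)" by (simp add: nn_integral_cmult)
  also have "\<dots> \<le> (\<integral>\<^sup>+q. (\<Sum>i<n. indicator (B \<inter> I i) (s + real i * \<eta> + 1 * q)) \<partial>lborel)"
  proof (rule nn_integral_mono)
    fix q :: real
    show "of_nat (N r) * indicator {0<..<\<eta>} q \<le> (\<Sum>i<n. indicator (B \<inter> I i) (s + real i * \<eta> + 1 * q) :: ennreal)"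
    proof (cases "q \<in> {0<..<\<eta>}")
      case True
      have "(\<Sum>i<n. indicator (B \<inter> I i) (s + real i * \<eta> + 1 * q) :: ennreal) = (\<Sum>i<n. if s + q + real i * \<eta> \<in> B then 1 else 0)"
        using True by (intro sum.cong) (auto simp: I_def indicator_def algebra_simps)
      also have "\<dots> = of_nat (card ({..<n} \<inter> {i. s + q + real i * \<eta> \<in> B}))" by (simp add: sum.If_cases)
      also have "{..<n} \<inter> {i. s + q + real i * \<eta> \<in> B} = {i. i < n \<and> s + q + real i * \<eta> \<in> B}" by auto
      finally show ?thesis using r(2)[OF True] True unfolding N_def by (simp add: of_nat_mono)
    qed simp
  qed
  also have "\<dots> = (\<Sum>i<n. \<integral>\<^sup>+q. indicator (B \<inter> I i) (s + real i * \<eta> + 1 * q) \<partial>lborel)"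
    by (intro nn_integral_sum measurable_compose[OF _ m]) simp
  also have "\<dots> = (\<Sum>i<n. emeasure lborel (B \<inter> I i))"
  proof (rule sum.cong[OF refl])
    fix i
    have "emeasure lborel (B \<inter> I i) = (\<integral>\<^sup>+x. indicator (B \<inter> I i) x \<partial>lborel)"
      using B unfolding I_def by (subst nn_integral_indicator) auto
    also have "\<dots> = \<bar>1::real\<bar> * (\<integral>\<^sup>+q. indicator (B \<inter> I i) (s + real i * \<eta> + 1 * q) \<partial>lborel)"
      by (rule nn_integral_real_affine[OF m]) simp
    finally show "(\<integral>\<^sup>+q. indicator (B \<inter> I i) (s + real i * \<eta> + 1 * q) \<partial>lborel) = emeasure lborel (B \<inter> I i)" by simp
  qed
  also have "\<dots> = emeasure lborel (\<Union>i<n. B \<inter> I i)"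
    using B dj unfolding I_def by (intro sum_emeasure) auto
  also have "\<dots> \<le> emeasure lborel B" using B by (intro emeasure_mono) auto
  also have "\<dots> = ennreal (measure lborel B)" using fin by (simp add: emeasure_eq_ennreal_measure top.not_eq_extremum)
  finally have "real (N r) * \<eta> \<le> measure lborel B" using eta by (subst (asm) ennreal_le_iff) auto
  then show ?thesis using r(1) unfolding N_def by (intro bexI[of _ r]) (auto simp: mult.commute)
qed

text \<open>The crossing argument is condensed into \<open>superadditive\<close>: the estimates of
  turning see the boundary only through this inequality and a periodic, injective 1-Lipschitz
  parameter.\<close>

locale convex_curve =
  fixes K L :: real and g :: "real \<Rightarrow> 'a::metric_space"
  assumes K_nonneg: "0 \<le> K" and L_pos: "0 < L"
    and dist_le: "dist (g s) (g t) \<le> \<bar>s - t\<bar>"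
    and periodic: "g (t + L) = g t"
    and injective: "s < t \<Longrightarrow> t < s + L \<Longrightarrow> g s \<noteq> g t"
    and superadditive: "\<lbrakk>p < x; x < y; y < z; z < p + L;
        small_perimeter K (dist (g p) (g x) + dist (g x) (g y) + dist (g y) (g p));
        small_perimeter K (dist (g p) (g y) + dist (g y) (g z) + dist (g z) (g p));
        small_perimeter K (dist (g p) (g x) + dist (g x) (g z) + dist (g z) (g p));
        small_perimeter K (dist (g x) (g y) + dist (g y) (g z) + dist (g z) (g x))\<rbrakk> \<Longrightarrow>
      model_angle K (dist (g p) (g x)) (dist (g p) (g y)) (dist (g x) (g y))
      + model_angle K (dist (g p) (g y)) (dist (g p) (g z)) (dist (g y) (g z))
      \<le> model_angle K (dist (g p) (g x)) (dist (g p) (g z)) (dist (g x) (g z))"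
begin

definition D :: "real \<Rightarrow> real \<Rightarrow> real" where "D s t = dist (g s) (g t)"

definition A :: "real \<Rightarrow> real \<Rightarrow> real \<Rightarrow> real" where "A p x y = model_angle K (D p x) (D p y) (D x y)"

definition perim :: "real \<Rightarrow> real \<Rightarrow> real \<Rightarrow> real" where "perim a b c = D a b + D b c + D c a"

text \<open>The arcs inside which all comparison angles are meaningful. Repeated points are
  included, so for \<open>K > 0\<close> every chord is shorter than
  \<open>pi / sqrt K\<close>.\<close>

definition short_arc :: "real \<Rightarrow> real \<Rightarrow> bool" where
  "short_arc s u \<longleftrightarrow> u < s + L \<and> (\<forall>a b c. s \<le> a \<longrightarrow> a \<le> b \<longrightarrow> b \<le> c \<longrightarrow> c \<le> u \<longrightarrow> small_perimeter K (perim a b c))"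

text \<open>\<open>end_angle s u\<close> and \<open>start_angle s u\<close> are the angles between the arc and its chord; the comparison angles
  increase as the third point approaches the vertex, so the suprema are limits.\<close>

definition start_angle :: "real \<Rightarrow> real \<Rightarrow> real" where "start_angle s u = (SUP n\<in>{s<..<u}. A s n u)"

definition end_angle :: "real \<Rightarrow> real \<Rightarrow> real" where "end_angle s u = (SUP n\<in>{s<..<u}. A u n s)"

lemma D_commute: "D s t = D t s" unfolding D_def by (rule dist_commute)
lemma D_nonneg: "0 \<le> D s t" unfolding D_def by simp
lemma D_same [simp]: "D s s = 0" unfolding D_def by simp
lemma D_triangle: "D a c \<le> D a b + D b c" unfolding D_def by (rule dist_triangle)
lemma D_le: "D s t \<le> \<bar>s - t\<bar>" unfolding D_def by (rule dist_le)
lemma D_pos: "s < t \<Longrightarrow> t < s + L \<Longrightarrow> 0 < D s t" unfolding D_def using injective by simp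
lemma D_periodic [simp]: "D (s + L) t = D s t" "D s (t + L) = D s t" unfolding D_def by (simp_all add: periodic)
lemma A_periodic [simp]: "A (p + L) x y = A p x y" "A p (x + L) y = A p x y" "A p x (y + L) = A p x y" unfolding A_def by simp_all
lemma A_bounds: "0 \<le> A p x y" "A p x y \<le> pi" unfolding A_def by (simp_all add: model_angle_bounds)
lemma A_commute: "A p x y = A p y x" unfolding A_def using model_angle_commute by (simp add: D_commute)
lemma perim_rotate: "perim a b c = perim b c a" unfolding perim_def by simp

lemma continuous_on_g: "continuous_on S g"
  by (rule continuous_onI) (metis dist_le dist_real_def le_less_trans less_imp_le)

lemma continuous_on_D [continuous_intros]:
  "continuous_on S f \<Longrightarrow> continuous_on S h \<Longrightarrow> continuous_on S (\<lambda>x. D (f x) (h x))"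
  unfolding D_def
  by (intro continuous_on_dist continuous_on_compose2[OF continuous_on_g[of UNIV]]) auto

lemma short_arc_sub: "short_arc s u \<Longrightarrow> s \<le> a \<Longrightarrow> b \<le> u \<Longrightarrow> short_arc a b"
  unfolding short_arc_def by auto

lemma superadditive_A:
  assumes "p < x" "x < y" "y < z" "z < p + L" "small_perimeter K (perim p x y)" "small_perimeter K (perim p y z)" "small_perimeter K (perim p x z)" "small_perimeter K (perim x y z)"
  shows "A p x y + A p y z \<le> A p x z"
  using superadditive[of p x y z] assms unfolding A_def D_def perim_def by simp

text \<open>One instance of superadditivity for each of the four points as vertex; where the cyclic
  order passes the end of the arc, parameters are shifted by \<open>L\<close>.\<close>

lemma superadditive_arc:
  assumes "short_arc a d" "a < b" "b < c" "c < d"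
  shows "A a b c + A a c d \<le> A a b d" "A b c d + A b d a \<le> A b c a" "A c d a + A c a b \<le> A c d b" "A d a b + A d b c \<le> A d a c"
proof -
  have s: "small_perimeter K (perim a b c)" "small_perimeter K (perim a b d)" "small_perimeter K (perim a c d)" "small_perimeter K (perim b c d)" "d < a + L"
    using assms unfolding short_arc_def by auto
  have p: "perim (x + L) y z = perim x y z" "perim y (x + L) z = perim y x z" "perim y z (x + L) = perim y z x" for x y z
    unfolding perim_def by simp_all
  show "A a b c + A a c d \<le> A a b d" using superadditive_A[of a b c d] assms s by simp
  show "A b c d + A b d a \<le> A b c a"
    using superadditive_A[of b c d "a + L"] assms s by (simp add: p perim_rotate[of b d a] perim_rotate[of d a b] perim_rotate[of b c a] perim_rotate[of c a b] perim_rotate[of c d a] perim_rotate[of d a c])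
  show "A c d a + A c a b \<le> A c d b"
    using superadditive_A[of c d "a + L" "b + L"] assms s by (simp add: p perim_rotate[of c d a] perim_rotate[of d a c] perim_rotate[of c a b] perim_rotate[of c d b] perim_rotate[of d b c] perim_rotate[of d a b])
  show "A d a b + A d b c \<le> A d a c"
    using superadditive_A[of d "a + L" "b + L" "c + L"] assms s by (simp add: p perim_rotate[of d a b] perim_rotate[of d b c] perim_rotate[of d a c])
qed

lemma triangle_sides_arc:
  assumes "short_arc s u" "s < t" "t < u"
  shows "triangle_sides K (D s t) (D s u) (D t u)" "triangle_sides K (D t s) (D t u) (D s u)" "triangle_sides K (D u s) (D u t) (D s t)"
proof -
  have "small_perimeter K (perim s t u)" "u < s + L" using assms unfolding short_arc_def by auto
  moreover have "0 < D s t" "0 < D t u" "0 < D s u" using assms \<open>u < s + L\<close> by (auto intro!: D_pos)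
  ultimately show "triangle_sides K (D s t) (D s u) (D t u)" "triangle_sides K (D t s) (D t u) (D s u)" "triangle_sides K (D u s) (D u t) (D s t)"
    using D_triangle[of s t u] D_triangle[of t u s] D_triangle[of s u t] unfolding triangle_sides_def perim_def
    by (auto simp: D_commute algebra_simps)
qed

lemma angle_sum_arc:
  assumes "short_arc s u" "s < t" "t < u"
  shows "pi \<le> A s t u + A t s u + A u s t"
proof -
  have "0 < D t u" using assms by (auto intro!: D_pos simp: short_arc_def)
  then have "pi \<le> model_angle K (D s t) (D s u) (D t u) + model_angle K (D s u) (D t u) (D s t) + model_angle K (D t u) (D s t) (D s u)"
    using model_angle_sum[OF K_nonneg triangle_sides_arc(1)[OF assms]] by simp
  then show ?thesis unfolding A_def
    by (simp add: D_commute[of t s] D_commute[of u s] D_commute[of u t] model_angle_commute[of K "D t u" "D s t"])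
qed

lemma A_le_start_angle: "s < n \<Longrightarrow> n < u \<Longrightarrow> A s n u \<le> start_angle s u"
  unfolding start_angle_def by (rule cSUP_upper) (auto intro!: bdd_aboveI[of _ pi] simp: A_bounds)

lemma A_le_end_angle: "s < n \<Longrightarrow> n < u \<Longrightarrow> A u n s \<le> end_angle s u"
  unfolding end_angle_def by (rule cSUP_upper) (auto intro!: bdd_aboveI[of _ pi] simp: A_bounds)

lemma start_angle_le: "s < u \<Longrightarrow> (\<And>n. s < n \<Longrightarrow> n < u \<Longrightarrow> A s n u \<le> c) \<Longrightarrow> start_angle s u \<le> c"
  unfolding start_angle_def by (rule cSUP_least) (auto simp: dense)

lemma end_angle_le: "s < u \<Longrightarrow> (\<And>n. s < n \<Longrightarrow> n < u \<Longrightarrow> A u n s \<le> c) \<Longrightarrow> end_angle s u \<le> c"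
  unfolding end_angle_def by (rule cSUP_least) (auto simp: dense)

lemma start_angle_nonneg: "s < u \<Longrightarrow> 0 \<le> start_angle s u"
  using dense[of s u] A_le_start_angle A_bounds(1) order_trans by blast

lemma end_angle_nonneg: "s < u \<Longrightarrow> 0 \<le> end_angle s u"
  using dense[of s u] A_le_end_angle A_bounds(1) order_trans by blast

text \<open>For a point \<open>n\<close> between \<open>s\<close> and \<open>t\<close>,
  superadditivity at \<open>s\<close> adds \<open>A s t u\<close> to \<open>A s n t\<close>; the
  supremum over \<open>n\<close> gives the claim.\<close>

lemma start_angle_extend:
  assumes "short_arc s u" "s < t" "t < u"
  shows "start_angle s t + A s t u \<le> start_angle s u"
proof -
  have "start_angle s t \<le> start_angle s u - A s t u"
  proof (rule start_angle_le[OF assms(2)])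
    fix n assume n: "s < n" "n < t"
    have "A s n t + A s t u \<le> A s n u" using superadditive_arc(1)[OF assms(1)] n assms by simp
    also have "\<dots> \<le> start_angle s u" using n assms by (intro A_le_start_angle) auto
    finally show "A s n t \<le> start_angle s u - A s t u" by simp
  qed
  then show ?thesis by simp
qed

lemma end_angle_extend:
  assumes "short_arc s u" "s < t" "t < u"
  shows "end_angle t u + A u t s \<le> end_angle s u"
proof -
  have "end_angle t u \<le> end_angle s u - A u t s"
  proof (rule end_angle_le[OF assms(3)])
    fix n assume n: "t < n" "n < u"
    have "A u s t + A u t n \<le> A u s n" using superadditive_arc(4)[OF assms(1)] n assms by simp
    also have "\<dots> \<le> end_angle s u" using A_le_end_angle[of s n u] n assms by (simp add: A_commute[of u s n])
    finally show "A u n t \<le> end_angle s u - A u t s" by (simp add: A_commute[of u t])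
  qed
  then show ?thesis by simp
qed

text \<open>Seen from \<open>t\<close>, the points \<open>m\<close>, \<open>u\<close>,
  \<open>s\<close>, \<open>n\<close> occur in this cyclic order. Superadditivity applied twice
  bounds the sum of the three angles by \<open>A t m n\<close>, at most \<open>pi\<close>, uniformly
  in \<open>m\<close> and \<open>n\<close>.\<close>

lemma angles_at_middle:
  assumes "short_arc s u" "s < t" "t < u"
  shows "end_angle s t + A t s u + start_angle t u \<le> pi"
proof -
  have "end_angle s t \<le> pi - A t s u - start_angle t u"
  proof (rule end_angle_le[OF assms(2)])
    fix n assume n: "s < n" "n < t"
    have "start_angle t u \<le> pi - A t s u - A t n s"
    proof (rule start_angle_le[OF assms(3)])
      fix m assume m: "t < m" "m < u"
      have "A t m u + A t u s \<le> A t m s" using superadditive_arc(2)[OF assms(1)] m assms by simp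
      moreover have "A t m s + A t s n \<le> A t m n"
        using superadditive_arc(3)[OF short_arc_sub[OF assms(1)], of s m n t] m n assms by simp
      ultimately show "A t m u \<le> pi - A t s u - A t n s"
        using A_bounds(2)[of t m n] by (simp add: A_commute[of t u s] A_commute[of t s n])
    qed
    then show "A t n s \<le> pi - A t s u - start_angle t u" by simp
  qed
  then show ?thesis by simp
qed

text \<open>The angles lost at \<open>t\<close> total at most \<open>pi - A t s u\<close>. The
  comparison triangle has angle sum at least \<open>pi\<close>, so its angles at \<open>s\<close>
  and \<open>u\<close>, which are gained there, make up for the loss.\<close>

lemma turning_superadditive:
  assumes "short_arc s u" "s < t" "t < u"
  shows "start_angle s t + end_angle s t + (start_angle t u + end_angle t u) \<le> start_angle s u + end_angle s u"
  using start_angle_extend[OF assms] end_angle_extend[OF assms] angles_at_middle[OF assms] angle_sum_arc[OF assms]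
  by (simp add: A_commute[of u s t])

lemma turning_mono:
  assumes "short_arc s u" "s \<le> a" "a < b" "b \<le> u"
  shows "start_angle a b + end_angle a b \<le> start_angle s u + end_angle s u"
proof -
  have 1: "start_angle a b + end_angle a b \<le> start_angle a u + end_angle a u"
  proof (cases "b = u")
    case False
    then show ?thesis using turning_superadditive[OF short_arc_sub[OF assms(1)], of a u b] assms
      start_angle_nonneg[of b u] end_angle_nonneg[of b u] by simp
  qed simp
  have "start_angle a u + end_angle a u \<le> start_angle s u + end_angle s u"
  proof (cases "a = s")
    case False
    then show ?thesis using turning_superadditive[OF assms(1), of a] assms
      start_angle_nonneg[of s a] end_angle_nonneg[of s a] by simp
  qed simp
  then show ?thesis using 1 by simp
qed

text \<open>Vertices are added one at a time. At the last one the comparison angle with the diagonal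
  is kept instead of \<open>end_angle\<close>, because the next step has to split the polygon angle
  there along this diagonal.\<close>

lemma turning_ge_exterior_angles_aux:
  assumes arc: "short_arc (x 0) (x n)" and inc: "strict_mono x" and n: "2 \<le> n"
  shows "(\<Sum>i\<in>{1..<n}. pi - A (x i) (x (i - 1)) (x (Suc i))) \<le> start_angle (x 0) (x n) + A (x n) (x 0) (x (n - 1))"
  using n arc
proof (induction n rule: nat_induct_at_least)
  case base
  have lt: "x 0 < x 1" "x 1 < x 2" using inc by (auto simp: strict_mono_def)
  have "pi \<le> A (x 0) (x 1) (x 2) + A (x 1) (x 0) (x 2) + A (x 2) (x 0) (x 1)" by (rule angle_sum_arc[OF base lt])
  moreover have "A (x 0) (x 1) (x 2) \<le> start_angle (x 0) (x 2)" using lt by (rule A_le_start_angle)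
  moreover have "{1..<2} = {1::nat}" by auto
  ultimately show ?case by (simp add: numeral_2_eq_2)
next
  case (Suc n)
  have lt: "x 0 < x n" "x n < x (Suc n)" "x 0 < x (n - 1)" "x (n - 1) < x n" using inc Suc(1) by (auto simp: strict_mono_def)
  have arc: "short_arc (x 0) (x n)" using short_arc_sub[OF Suc(3)] lt by auto
  have IH: "(\<Sum>i\<in>{1..<n}. pi - A (x i) (x (i - 1)) (x (Suc i))) \<le> start_angle (x 0) (x n) + A (x n) (x 0) (x (n - 1))"
    using Suc(2) arc by simp
  have 1: "start_angle (x 0) (x n) + A (x 0) (x n) (x (Suc n)) \<le> start_angle (x 0) (x (Suc n))"
    by (rule start_angle_extend[OF Suc(3) lt(1,2)])
  have 2: "pi \<le> A (x 0) (x n) (x (Suc n)) + A (x n) (x 0) (x (Suc n)) + A (x (Suc n)) (x 0) (x n)"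
    by (rule angle_sum_arc[OF Suc(3) lt(1,2)])
  have 3: "A (x n) (x (Suc n)) (x 0) + A (x n) (x 0) (x (n - 1)) \<le> A (x n) (x (Suc n)) (x (n - 1))"
    by (rule superadditive_arc(3)[OF Suc(3) lt(3,4,2)])
  have "{1..<Suc n} = insert n {1..<n}" using Suc(1) by auto
  then have "(\<Sum>i\<in>{1..<Suc n}. pi - A (x i) (x (i - 1)) (x (Suc i))) = (pi - A (x n) (x (n - 1)) (x (Suc n))) + (\<Sum>i\<in>{1..<n}. pi - A (x i) (x (i - 1)) (x (Suc i)))"
    by simp
  then show ?case using IH 1 2 3 by (simp add: A_commute[of "x n" "x (Suc n)"])
qed

lemma turning_ge_exterior_angles:
  assumes arc: "short_arc (x 0) (x n)" and inc: "strict_mono x" and n: "2 \<le> n"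
  shows "(\<Sum>i\<in>{1..<n}. pi - A (x i) (x (i - 1)) (x (Suc i))) \<le> start_angle (x 0) (x n) + end_angle (x 0) (x n)"
proof -
  have "x 0 < x (n - 1)" "x (n - 1) < x n" using inc n by (auto simp: strict_mono_def)
  then have "A (x n) (x (n - 1)) (x 0) \<le> end_angle (x 0) (x n)" by (rule A_le_end_angle)
  then show ?thesis using turning_ge_exterior_angles_aux[OF assms] by (simp add: A_commute[of "x n" "x 0"])
qed

text \<open>The pointwise curvature bound as a bound on exterior angles. The factor is
  \<open>k / 2\<close> because each chord of a polygon is shared by two vertices, so that the sum
  becomes \<open>k\<close> times the length.\<close>

definition good_at :: "real \<Rightarrow> real \<Rightarrow> bool" where
  "good_at k t \<longleftrightarrow> (\<exists>e>0. \<forall>a b. t - e < a \<longrightarrow> a < t \<longrightarrow> t < b \<longrightarrow> b < t + e \<longrightarrow> A t a b \<le> pi - k / 2 * (D a t + D t b))"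

text \<open>Makes the bad sets in \<open>turning_ge_chord\<close> open, hence measurable.\<close>

lemma continuous_on_A:
  assumes "short_arc s u" "s \<le> a" "a < b" "b \<le> u"
  shows "continuous_on {a<..<b} (\<lambda>t. A t a b)"
proof -
  have nz: "D t a \<noteq> 0 \<and> D t b \<noteq> 0 \<and> (K \<noteq> 0 \<longrightarrow> sin (sqrt K * D t a) \<noteq> 0 \<and> sin (sqrt K * D t b) \<noteq> 0)" if "t \<in> {a<..<b}" for t
  proof -
    have arc: "short_arc a b" using short_arc_sub assms by blast
    have ts: "triangle_sides K (D t a) (D t b) (D a b)" using triangle_sides_arc(2)[OF arc, of t] that by simp
    have "sin (sqrt K * D t a) > 0" "sin (sqrt K * D t b) > 0" if "K \<noteq> 0"
      using triangle_sides_scaled[OF _ ts] that K_nonneg by (auto intro!: sin_gt_zero)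
    then show ?thesis using ts unfolding triangle_sides_def by fastforce
  qed
  have "continuous_on {a<..<b} (\<lambda>t. cos_angle K (D t a) (D t b) (D a b))"
  proof (cases "K = 0")
    case True
    then show ?thesis unfolding cos_angle_def using nz by (simp; intro continuous_intros) auto
  next
    case False
    then show ?thesis unfolding cos_angle_def using nz by (simp; intro continuous_intros) auto
  qed
  then show ?thesis unfolding A_def model_angle_def
    by (rule continuous_on_compose2[OF continuous_on_clamped_arccos[of UNIV]]) auto
qed

text \<open>Every vertex of a fine polygon with good vertices contributes its share to the total turning, and some
  equidistant subdivision has few bad vertices because the bad set has small measure.\<close>

lemma turning_ge_chord:
  assumes arc: "short_arc s u" and su: "s < u" and k: "0 \<le> k" and good: "AE t in lborel. good_at k t"
  shows "k * D s u \<le> start_angle s u + end_angle s u"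
proof -
  \<comment> \<open>The points violating the bound at scale \<open>1 / Suc j\<close>. These sets
    decrease with \<open>j\<close>, and no good point lies in all of them, so their measures tend to
    0.\<close>
  define bad where "bad j = {t. \<exists>a b. s < a \<and> a < t \<and> t < b \<and> b < u \<and> t - a < 1 / Suc j \<and> b - t < 1 / Suc j \<and> A t a b > pi - k / 2 * (D a t + D t b)}" for j
  have op: "open (bad j)" for j
  proof -
    have eq: "bad j = (\<Union>a\<in>{s<..<u}. \<Union>b\<in>{a<..<u}. {t \<in> {a<..<b} \<inter> {b - 1 / Suc j<..<a + 1 / Suc j}. 0 < A t a b - (pi - k / 2 * (D a t + D t b))})"
      (is "_ = ?U")
    proof (intro equalityI subsetI)
      fix t assume "t \<in> bad j"
      then obtain a b where "s < a" "a < t" "t < b" "b < u" "t - a < 1 / Suc j" "b - t < 1 / Suc j" "A t a b > pi - k / 2 * (D a t + D t b)"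
        unfolding bad_def by blast
      then show "t \<in> ?U" by (intro UN_I[of a] UN_I[of b]) auto
    next
      fix t assume "t \<in> ?U"
      then obtain a b where "a \<in> {s<..<u}" "b \<in> {a<..<u}" "t \<in> {a<..<b} \<inter> {b - 1 / Suc j<..<a + 1 / Suc j}"
          "0 < A t a b - (pi - k / 2 * (D a t + D t b))" by blast
      then show "t \<in> bad j" unfolding bad_def by (intro CollectI exI[of _ a] exI[of _ b]) auto
    qed
    have o: "open {t \<in> {a<..<b} \<inter> {b - 1 / Suc j<..<a + 1 / Suc j}. 0 < A t a b - (pi - k / 2 * (D a t + D t b))}"
      if "a \<in> {s<..<u}" "b \<in> {a<..<u}" for a b
    proof -
      have "continuous_on ({a<..<b} \<inter> {b - 1 / Suc j<..<a + 1 / Suc j}) (\<lambda>t. A t a b - (pi - k / 2 * (D a t + D t b)))"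
        using that by (intro continuous_intros continuous_on_subset[OF continuous_on_A[OF arc, of a b]]) auto
      then have "open (({a<..<b} \<inter> {b - 1 / Suc j<..<a + 1 / Suc j}) \<inter> (\<lambda>t. A t a b - (pi - k / 2 * (D a t + D t b))) -` {0<..})"
        by (rule continuous_open_preimage) auto
      then show ?thesis by (simp add: vimage_def Int_def)
    qed
    show ?thesis unfolding eq by (intro open_UN ballI o)
  qed
  have sub: "bad j \<subseteq> {s<..<u}" for j unfolding bad_def by auto
  have fin: "emeasure lborel (bad j) < \<infinity>" for j
  proof -
    have "emeasure lborel (bad j) \<le> emeasure lborel {s<..<u}" using sub by (intro emeasure_mono) auto
    also have "\<dots> < \<infinity>" using su by simp
    finally show ?thesis .
  qed
  have "(\<lambda>j. emeasure lborel (bad j)) \<longlonglongrightarrow> emeasure lborel (\<Inter>j. bad j)"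
  proof (rule Lim_emeasure_decseq)
    show "range bad \<subseteq> sets lborel" using op by auto
    show "decseq bad"
    proof (rule decseq_SucI)
      fix j
      have "1 / real (Suc (Suc j)) \<le> 1 / real (Suc j)" by (simp add: field_simps)
      then show "bad (Suc j) \<subseteq> bad j" unfolding bad_def by (smt (verit) mem_Collect_eq subsetI)
    qed
    show "emeasure lborel (bad j) \<noteq> \<infinity>" for j using fin[of j] by simp
  qed
  moreover have "emeasure lborel (\<Inter>j. bad j) = 0"
  proof -
    obtain N where N: "{t. \<not> good_at k t} \<subseteq> N" "emeasure lborel N = 0" "N \<in> sets lborel"
      using AE_E[OF good] by (metis (mono_tags, lifting) Collect_cong UNIV_I space_borel space_lborel)
    have "\<not> good_at k t" if t: "t \<in> (\<Inter>j. bad j)" for t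
    proof
      assume "good_at k t"
      then obtain e where e: "e > 0" "\<And>a b. t - e < a \<Longrightarrow> a < t \<Longrightarrow> t < b \<Longrightarrow> b < t + e \<Longrightarrow> A t a b \<le> pi - k / 2 * (D a t + D t b)"
        unfolding good_at_def by blast
      obtain j where j: "1 / real (Suc j) < e" using e(1) nat_approx_posE by blast
      obtain a b where "a < t" "t < b" "t - a < 1 / Suc j" "b - t < 1 / Suc j" "A t a b > pi - k / 2 * (D a t + D t b)"
        using t unfolding bad_def by blast
      then show False using e(2)[of a b] j by fastforce
    qed
    then have "(\<Inter>j. bad j) \<subseteq> N" using N(1) by auto
    then have "emeasure lborel (\<Inter>j. bad j) \<le> 0" using N emeasure_mono by metis
    then show ?thesis by simp
  qed
  ultimately have lim: "(\<lambda>j. emeasure lborel (bad j)) \<longlonglongrightarrow> 0" by simp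
  \<comment> \<open>\<open>3 * k * e\<close> pays for the two end pieces of the arc missed by the
    polygon and for the half chords missing at its ends, \<open>k * e\<close> for the bad
    vertices.\<close>
  have main: "k * D s u \<le> start_angle s u + end_angle s u + 4 * k * e" if e: "e > 0" for e
  proof -
    have "\<forall>\<^sub>F j in sequentially. emeasure lborel (bad j) < ennreal e" using order_tendstoD(2)[OF lim] e by simp
    then obtain j where j: "emeasure lborel (bad j) < ennreal e" by (auto simp: eventually_sequentially)
    then have je: "measure lborel (bad j) < e"
      using fin[of j] e by (simp add: emeasure_eq_ennreal_measure top.not_eq_extremum ennreal_less_iff)
    define d where "d = min e (1 / Suc j)"
    have d: "d > 0" using e unfolding d_def by simp
    obtain n0 :: nat where n0: "(u - s) / d < real n0" using reals_Archimedean2 by blast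
    \<comment> \<open>Three lattice points at least, so that the polygon has an inner
      vertex.\<close>
    define n where "n = n0 + 3"
    define \<eta> where "\<eta> = (u - s) / n"
    have n: "3 \<le> n" "(u - s) / d < real n" unfolding n_def using n0 by auto
    have eta: "0 < \<eta>" "\<eta> < d" "real n * \<eta> = u - s" using n su d unfolding \<eta>_def by (auto simp: field_simps)
    obtain r where r: "0 < r" "r < \<eta>" "\<eta> * card {i. i < n \<and> s + r + real i * \<eta> \<in> bad j} \<le> measure lborel (bad j)"
      using lattice_hits[of "bad j" \<eta> n s] op fin[of j] eta by auto
    define x where "x i = s + r + real i * \<eta>" for i
    have inc: "strict_mono x" unfolding x_def strict_mono_def using eta by simp
    define m where "m = n - 1"
    have m: "2 \<le> m" "m < n" "n = Suc m" using n unfolding m_def by auto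
    have x0: "s < x 0" "x 0 < s + \<eta>" unfolding x_def using r by auto
    have xm: "x m < u" "u - \<eta> < x m"
    proof -
      have "x m = s + r + (real n - 1) * \<eta>" unfolding x_def m(3) by simp
      also have "\<dots> = u + r - \<eta>" using eta(3) by (simp add: algebra_simps)
      finally show "x m < u" "u - \<eta> < x m" using r by auto
    qed
    have arcx: "short_arc (x 0) (x m)" using short_arc_sub[OF arc] x0 xm by simp
    have xm0: "x 0 < x m" using inc m by (simp add: strict_mono_def)
    define dd where "dd i = D (x i) (x (Suc i))" for i
    have dd: "0 \<le> dd i" "dd i \<le> \<eta>" for i unfolding dd_def using D_nonneg D_le[of "x i" "x (Suc i)"] eta 
      by (auto simp: x_def algebra_simps)
    define Bd where "Bd = {i. i < n \<and> x i \<in> bad j}"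
    \<comment> \<open>At a bad vertex only the sign of the exterior angle is known; since chords are
      at most as long as the mesh, the correction \<open>k * \<eta>\<close> cancels its
      share.\<close>
    have ei: "k / 2 * (dd (i - 1) + dd i) - k * \<eta> * (if i \<in> Bd then 1 else 0) \<le> pi - A (x i) (x (i - 1)) (x (Suc i))"
      if i: "i \<in> {1..<m}" for i
    proof (cases "i \<in> Bd")
      case True
      have "k / 2 * (dd (i - 1) + dd i) \<le> k / 2 * (2 * \<eta>)" using dd[of i] dd[of "i - 1"] k by (intro mult_left_mono) auto
      then show ?thesis using True A_bounds(2)[of "x i" "x (i - 1)" "x (Suc i)"] by simp
    next
      case False
      have xi: "x (i - 1) = x i - \<eta>" "x (Suc i) = x i + \<eta>" unfolding x_def using i by (auto simp: algebra_simps of_nat_diff)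
      have "x 0 \<le> x (i - 1)" "x (Suc i) \<le> x m" using inc i by (auto simp: strict_mono_less_eq)
      then have "s < x (i - 1)" "x (Suc i) < u" using x0 xm by auto
      moreover have "x i \<notin> bad j" using False i m unfolding Bd_def by auto
      moreover have "\<eta> < 1 / Suc j" using eta unfolding d_def by simp
      ultimately have "A (x i) (x (i - 1)) (x (Suc i)) \<le> pi - k / 2 * (D (x (i - 1)) (x i) + D (x i) (x (Suc i)))"
        unfolding bad_def using eta xi by (simp add: not_less) (metis add.commute add_diff_cancel_left' diff_add_cancel diff_gt_0_iff_gt less_add_same_cancel1 not_less)
      then show ?thesis using False i unfolding dd_def by simp
    qed
    have "(\<Sum>i\<in>{1..<m}. k / 2 * (dd (i - 1) + dd i) - k * \<eta> * (if i \<in> Bd then 1 else 0)) \<le> (\<Sum>i\<in>{1..<m}. pi - A (x i) (x (i - 1)) (x (Suc i)))"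
      using ei by (rule sum_mono)
    also have "\<dots> \<le> start_angle (x 0) (x m) + end_angle (x 0) (x m)" by (rule turning_ge_exterior_angles[OF arcx inc m(1)])
    also have "\<dots> \<le> start_angle s u + end_angle s u" using turning_mono[OF arc _ xm0] x0 xm by simp
    finally have S: "(\<Sum>i\<in>{1..<m}. k / 2 * (dd (i - 1) + dd i)) - k * \<eta> * (\<Sum>i\<in>{1..<m}. if i \<in> Bd then 1 else 0) \<le> start_angle s u + end_angle s u"
      by (simp add: sum_subtractf sum_distrib_left)
    have "(\<Sum>i\<in>{1..<m}. if i \<in> Bd then 1 else 0 :: real) = real (card ({1..<m} \<inter> Bd))" by (simp add: sum.If_cases)
    also have "\<dots> \<le> real (card Bd)" unfolding Bd_def by (intro of_nat_mono card_mono) auto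
    finally have "\<eta> * (\<Sum>i\<in>{1..<m}. if i \<in> Bd then 1 else 0) \<le> \<eta> * real (card Bd)" using eta by (intro mult_left_mono) auto
    also have "\<dots> \<le> e" using r(3) je unfolding Bd_def x_def by simp
    finally have bd: "k * \<eta> * (\<Sum>i\<in>{1..<m}. if i \<in> Bd then 1 else 0) \<le> k * e" using k by (simp add: mult.assoc mult_left_mono)
    \<comment> \<open>Inner chords are counted from both ends, which turns \<open>k / 2\<close> into
      \<open>k\<close>; the first and the last chord are counted once.\<close>
    have s1: "(\<Sum>i\<in>{1..<m}. dd i) = (\<Sum>i<m. dd i) - dd 0"
    proof -
      have "{..<m} = insert 0 {1..<m}" using m by auto
      then show ?thesis by simp
    qed
    have s2: "(\<Sum>i\<in>{1..<m}. dd (i - 1)) = (\<Sum>i<m. dd i) - dd (m - 1)"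
    proof -
      have "(\<Sum>i\<in>{1..<m}. dd (i - 1)) = (\<Sum>i\<in>{..<m - 1}. dd i)"
        by (rule sum.reindex_bij_witness[of _ Suc "\<lambda>i. i - 1"]) auto
      moreover have "{..<m} = insert (m - 1) {..<m - 1}" using m by auto
      ultimately show ?thesis by simp
    qed
    have tel: "D (x 0) (x m) \<le> (\<Sum>i<m. dd i)" for m
    proof (induction m)
      case (Suc m)
      then show ?case using D_triangle[of "x 0" "x (Suc m)" "x m"] unfolding dd_def by simp
    qed simp
    have "(\<Sum>i\<in>{1..<m}. k / 2 * (dd (i - 1) + dd i)) = k / 2 * ((\<Sum>i\<in>{1..<m}. dd (i - 1)) + (\<Sum>i\<in>{1..<m}. dd i))"
      by (simp add: sum_distrib_left sum.distrib distrib_left)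
    also have "\<dots> = k * ((\<Sum>i<m. dd i) - (dd 0 + dd (m - 1)) / 2)" unfolding s1 s2 by (simp add: field_simps)
    also have "\<dots> \<ge> k * (D (x 0) (x m) - \<eta>)" by (rule mult_left_mono[OF _ k]) (use tel[of m] dd(2)[of 0] dd(2)[of "m - 1"] in \<open>unfold add_divide_distrib, linarith\<close>)
    finally have low: "k * (D (x 0) (x m) - \<eta>) \<le> (\<Sum>i\<in>{1..<m}. k / 2 * (dd (i - 1) + dd i))" .
    have "D s u \<le> D s (x 0) + D (x 0) (x m) + D (x m) u" using D_triangle[of s u "x 0"] D_triangle[of "x 0" u "x m"] by simp
    also have "\<dots> \<le> D (x 0) (x m) + 2 * \<eta>" using D_le[of s "x 0"] D_le[of "x m" u] x0 xm by simp
    finally have "D s u - 3 * \<eta> \<le> D (x 0) (x m) - \<eta>" by simp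
    moreover have "\<eta> \<le> e" using eta unfolding d_def by simp
    ultimately have "D s u - 3 * e \<le> D (x 0) (x m) - \<eta>" by simp
    then have "k * (D s u - 3 * e) \<le> k * (D (x 0) (x m) - \<eta>)" using k by (rule mult_left_mono)
    then show ?thesis using low S bd by (simp add: algebra_simps)
  qed
  show ?thesis
  proof (rule field_le_epsilon)
    fix e :: real assume e: "0 < e"
    have "k * D s u \<le> start_angle s u + end_angle s u + 4 * k * (e / (4 * k + 1))" using e k by (intro main) simp
    also have "4 * k * (e / (4 * k + 1)) \<le> e" using k e by (simp add: field_simps)
    finally show "k * D s u \<le> start_angle s u + end_angle s u + e" by simp
  qed
qed


section \<open>Halving arcs: from the total turning to the angle at each end\<close>

lemma equidistant_point:
  assumes "s < u" "u < s + L"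
  shows "\<exists>t. s < t \<and> t < u \<and> D s t = D t u"
proof -
  have p: "0 < D s u" using assms by (rule D_pos)
  have "\<exists>t\<ge>s. t \<le> u \<and> D s t - D t u = 0"
    by (rule IVT') (use assms p in \<open>auto intro!: continuous_intros simp: D_nonneg\<close>)
  then obtain t where t: "s \<le> t" "t \<le> u" "D s t = D t u" by auto
  then have "t \<noteq> s" "t \<noteq> u" using p by auto
  then show ?thesis using t by (intro exI[of _ t]) auto
qed

text \<open>The comparison triangle is isosceles, and its two base angles together are at least
  \<open>pi - A t s u\<close>, which bounds the angles of the halves at \<open>t\<close>. So each
  base angle is at least half of these, and it is added to the angle at its end.\<close>

lemma end_angles_halving:
  assumes arc: "short_arc s u" and t: "s < t" "t < u" "D s t = D t u"
  shows "start_angle s t + (end_angle s t + start_angle t u) / 2 \<le> start_angle s u"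
    "end_angle t u + (end_angle s t + start_angle t u) / 2 \<le> end_angle s u"
proof -
  have eq: "A s t u = A u t s" unfolding A_def using t(3) by (simp add: D_commute)
  have "(end_angle s t + start_angle t u) / 2 \<le> A s t u"
    using angle_sum_arc[OF arc t(1,2)] angles_at_middle[OF arc t(1,2)] eq by (simp add: A_commute[of u s t])
  then show "start_angle s t + (end_angle s t + start_angle t u) / 2 \<le> start_angle s u"
    "end_angle t u + (end_angle s t + start_angle t u) / 2 \<le> end_angle s u"
    using start_angle_extend[OF arc t(1,2)] end_angle_extend[OF arc t(1,2)] eq by linarith+
qed

text \<open>If both end angles have slope \<open>c\<close>, then halving the arc gives slope
  \<open>k / 4 + c / 2\<close>: half of the total turning of one piece, plus half of one end angle
  of each piece. The fixed point \<open>k / 2\<close> is approached geometrically from 0.\<close>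

lemma end_angles_linear_approx:
  assumes arc: "short_arc s u" and k: "0 \<le> k"
    and S: "\<And>a b. s \<le> a \<Longrightarrow> a < b \<Longrightarrow> b \<le> u \<Longrightarrow> k * D a b \<le> start_angle a b + end_angle a b"
    and ab: "s \<le> a" "a < b" "b \<le> u"
  shows "k / 2 * (1 - (1 / 2) ^ n) * D a b \<le> start_angle a b \<and> k / 2 * (1 - (1 / 2) ^ n) * D a b \<le> end_angle a b"
  using ab
proof (induction n arbitrary: a b)
  case 0
  then show ?case by (simp add: start_angle_nonneg end_angle_nonneg)
next
  case (Suc n)
  have arc': "short_arc a b" using short_arc_sub[OF arc] Suc.prems by simp
  then obtain t where t: "a < t" "t < b" "D a t = D t b"
    using equidistant_point[of a b] Suc.prems unfolding short_arc_def by auto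
  define c x where "c = k / 2 * (1 - (1 / 2) ^ n)" "x = D a t"
  have c: "0 \<le> c" unfolding c_x_def using k by (simp add: power_le_one)
  have x: "D a t = x" "D t b = x" "D a b \<le> 2 * x" using t(3) D_triangle[of a b t] unfolding c_x_def(2) by linarith+
  have 1: "c * x \<le> start_angle a t" "c * x \<le> end_angle a t" "c * x \<le> start_angle t b" "c * x \<le> end_angle t b"
    using Suc.IH[of a t] Suc.IH[of t b] t(1,2) Suc.prems unfolding c_x_def(1)[symmetric] x by auto
  have 2: "k * x \<le> start_angle a t + end_angle a t" "k * x \<le> start_angle t b + end_angle t b"
    using S[of a t] S[of t b] t(1,2) Suc.prems unfolding x by auto
  have "(k / 4 + c / 2) * D a b \<le> (k / 4 + c / 2) * (2 * x)" using x(3) k c by (intro mult_left_mono) auto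
  then have 3: "(k / 4 + c / 2) * D a b \<le> k * x / 2 + c * x" by (simp add: algebra_simps)
  have 4: "k / 2 * (1 - (1 / 2) ^ Suc n) = k / 4 + c / 2" unfolding c_x_def by (simp add: field_simps)
  show ?case unfolding 4 
    using 3 1 2 end_angles_halving[OF arc' t, unfolded add_divide_distrib] by (intro conjI) linarith+
qed

lemma end_angles_linear:
  assumes arc: "short_arc s u" and k: "0 \<le> k" and su: "s < u" and good: "AE t in lborel. good_at k t"
  shows "k / 2 * D s u \<le> start_angle s u" "k / 2 * D s u \<le> end_angle s u"
proof -
  have S: "k * D a b \<le> start_angle a b + end_angle a b" if "s \<le> a" "a < b" "b \<le> u" for a b
    using turning_ge_chord[OF short_arc_sub[OF arc that(1,3)] that(2) k good] .
  have "(\<lambda>n. (1 / 2 :: real) ^ n) \<longlonglongrightarrow> 0" by (rule LIMSEQ_power_zero) simp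
  then have lim: "(\<lambda>n. k / 2 * (1 - (1 / 2) ^ n) * D s u) \<longlonglongrightarrow> k / 2 * (1 - 0) * D s u"
    by (intro tendsto_mult tendsto_diff tendsto_const)
  have le: "k / 2 * (1 - (1 / 2) ^ n) * D s u \<le> start_angle s u" "k / 2 * (1 - (1 / 2) ^ n) * D s u \<le> end_angle s u" for n
    using end_angles_linear_approx[OF arc k S order.refl su order.refl] by auto
  show "k / 2 * D s u \<le> start_angle s u" "k / 2 * D s u \<le> end_angle s u"
    using LIMSEQ_le_const2[OF lim, of "start_angle s u"] LIMSEQ_le_const2[OF lim, of "end_angle s u"] le by auto
qed

text \<open>The end angles are at least those of a circle of curvature \<open>k\<close> with the
  same chord. The first conjunct says that such a circle has a chord of this length; otherwise the
  \<open>arcsin\<close> would be meaningless.\<close>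

definition chord_angle_ge :: "real \<Rightarrow> real \<Rightarrow> real \<Rightarrow> bool" where
  "chord_angle_ge k s u \<longleftrightarrow> k * half_tan K (D s u) \<le> 1 \<and> arcsin (k * half_tan K (D s u)) \<le> start_angle s u
     \<and> arcsin (k * half_tan K (D s u)) \<le> end_angle s u"

lemma chord_angle_ge_halving:
  assumes k: "0 < k" and arc: "short_arc s u" and t: "s < t" "t < u" "D s t = D t u"
    and g: "chord_angle_ge k s t" "chord_angle_ge k t u"
  shows "chord_angle_ge k s u"
proof -
  define x where "x = D s t"
  have x: "D t u = x" "D s t = x" "D u t = x" "D t s = x" using t(3) unfolding x_def by (auto simp: D_commute)
  have ts: "triangle_sides K x x (D s u)" using triangle_sides_arc(2)[OF arc t(1,2)] x by simp
  have D0: "0 < D s u" using arc t by (intro D_pos) (auto simp: short_arc_def)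
  have gg: "k * half_tan K x \<le> 1" "arcsin (k * half_tan K x) \<le> start_angle s t" "arcsin (k * half_tan K x) \<le> end_angle s t"
    "arcsin (k * half_tan K x) \<le> start_angle t u" "arcsin (k * half_tan K x) \<le> end_angle t u"
    using g x unfolding chord_angle_ge_def by auto
  have "A t s u \<le> pi - 2 * arcsin (k * half_tan K x)" using angles_at_middle[OF arc t(1,2)] gg by simp
  then have "model_angle K x x (D s u) \<le> pi - 2 * arcsin (k * half_tan K x)" unfolding A_def using x by simp
  note cd = chord_doubling[OF K_nonneg k ts D0 gg(1) this]
  have "A s t u = model_angle K x (D s u) x" "A u t s = model_angle K x (D s u) x"
    unfolding A_def using x by (auto simp: D_commute[of u s])
  then show ?thesis unfolding chord_angle_ge_def
    using cd start_angle_extend[OF arc t(1,2)] end_angle_extend[OF arc t(1,2)] gg by auto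
qed

lemma short_arc_of_short_length:
  assumes "u < s + L" "K > 0 \<Longrightarrow> u - s \<le> pi / (2 * sqrt K)"
  shows "short_arc s u"
  unfolding short_arc_def
proof (intro conjI allI impI assms(1))
  fix a b c assume abc: "s \<le> a" "a \<le> b" "b \<le> c" "c \<le> u"
  have "perim a b c \<le> 3 * (u - s)" unfolding perim_def using D_le[of a b] D_le[of b c] D_le[of c a] abc by simp
  moreover have "3 * (u - s) < 2 * pi / sqrt K" if "K > 0"
  proof -
    have "3 * (u - s) \<le> 3 * (pi / (2 * sqrt K))" using assms(2)[OF that] by simp
    also have "\<dots> < 2 * pi / sqrt K" using that by (simp add: field_simps)
    finally show ?thesis .
  qed
  ultimately show "small_perimeter K (perim a b c)" unfolding small_perimeter_def by fastforce
qed

text \<open>By compactness. It keeps the pieces cut off by an equidistant point from being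
  arbitrarily short, so that the induction over arc lengths can take steps of fixed size.\<close>

lemma D_bounded_below:
  assumes "u < s + L" "0 < r" "r \<le> u - s"
  shows "\<exists>m>0. \<forall>a b. s \<le> a \<longrightarrow> b \<le> u \<longrightarrow> r \<le> b - a \<longrightarrow> m \<le> D a b"
proof -
  define S where "S = ({s..u} \<times> {s..u}) \<inter> {p. r \<le> snd p - fst p}"
  have "compact S" unfolding S_def
    by (intro compact_Int_closed compact_Times closed_Collect_le continuous_intros) auto
  moreover have "S \<noteq> {}"
  proof -
    have "(s, u) \<in> S" unfolding S_def using assms by auto
    then show ?thesis by blast
  qed
  moreover have "continuous_on S (\<lambda>p. D (fst p) (snd p))" by (intro continuous_intros)
  ultimately obtain p where p: "p \<in> S" "\<And>q. q \<in> S \<Longrightarrow> D (fst p) (snd p) \<le> D (fst q) (snd q)"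
    using continuous_attains_inf[of S "\<lambda>p. D (fst p) (snd p)"] by blast
  have "0 < D (fst p) (snd p)" using p(1) assms unfolding S_def by (intro D_pos) auto
  moreover have "D (fst p) (snd p) \<le> D a b" if "s \<le> a" "b \<le> u" "r \<le> b - a" for a b
    using p(2)[of "(a, b)"] that assms unfolding S_def by auto
  ultimately show ?thesis by blast
qed

text \<open>Halving equidistantly reduces a long arc to short ones; the gap in the perimeter keeps all triangles
  comparable with triangles in the model space while the arc length grows.\<close>

lemma chord_angle_ge_all:
  assumes k: "0 < k" "k < k1" and good: "AE t in lborel. good_at k1 t" and su: "s < u" "u < s + L"
  shows "chord_angle_ge k s u" "short_arc s u"
proof -
  obtain e where e: "e > 0"
    "K > 0 \<Longrightarrow> b \<ge> 0 \<Longrightarrow> sqrt K * b < pi \<Longrightarrow> k * half_tan K b \<le> 1 \<Longrightarrow> 2 * b \<le> 2 * pi / sqrt K - e"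
    "K > 0 \<Longrightarrow> triangle_sides K b c a \<Longrightarrow> k * half_tan K b \<le> 1 \<Longrightarrow> k * half_tan K c \<le> 1 \<Longrightarrow> k * half_tan K a \<le> 1 \<Longrightarrow>
       model_angle K b c a \<le> pi - arcsin (k * half_tan K b) - arcsin (k * half_tan K c) \<Longrightarrow> a + b + c \<le> 2 * pi / sqrt K - e"
    for a b c
  proof (cases "K > 0")
    case True
    then show ?thesis using perimeter_gap[OF True k(1)] that by blast
  next
    case False
    then show ?thesis using that[of 1] by simp
  qed
  obtain r0 where r0: "r0 > 0" "\<And>x. 0 < x \<Longrightarrow> x < r0 \<Longrightarrow> k * half_tan K x \<le> 1 \<and> arcsin (k * half_tan K x) \<le> k1 / 2 * x"
    using short_chord_angle[OF K_nonneg k] by blast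
  \<comment> \<open>The starting length: below \<open>r\<close>, arcs are short for
    \<open>short_arc_of_short_length\<close>, and their linear angle bounds dominate those of the
    circle.\<close>
  define r where "r = min (r0 / 2) (min (u - s) (if K > 0 then pi / (2 * sqrt K) else 1))"
  have r: "0 < r" "r < r0" "r \<le> u - s" "K > 0 \<Longrightarrow> r \<le> pi / (2 * sqrt K)" using r0 su unfolding r_def by auto
  obtain m where m: "m > 0" "\<And>a b. s \<le> a \<Longrightarrow> b \<le> u \<Longrightarrow> r \<le> b - a \<Longrightarrow> m \<le> D a b"
    using D_bounded_below[OF su(2) r(1,3)] by blast
  \<comment> \<open>With \<open>m / 2\<close>, both equidistant pieces of an arc of length at least
    \<open>r\<close> are at least \<open>c\<close> long; with \<open>e / 5\<close>, a change of
    \<open>4 * c\<close> in the perimeter stays below the gap \<open>e\<close>.\<close>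
  define c where "c = min (m / 2) (e / 5)"
  have c: "0 < c" "c \<le> m / 2" "c \<le> e / 5" unfolding c_def using m e by auto
  define G where "G l \<longleftrightarrow> (\<forall>a b. s \<le> a \<longrightarrow> a < b \<longrightarrow> b \<le> u \<longrightarrow> b - a \<le> l \<longrightarrow> chord_angle_ge k a b)" for l
  \<comment> \<open>The gap \<open>e\<close> is carried along so that triangles in slightly longer
    arcs still have small perimeter; only then can \<open>G\<close> be extended.\<close>
  define R where "R l \<longleftrightarrow> (K > 0 \<longrightarrow> (\<forall>x y z. s \<le> x \<longrightarrow> x \<le> y \<longrightarrow> y \<le> z \<longrightarrow> z \<le> u \<longrightarrow> z - x \<le> l \<longrightarrow> perim x y z \<le> 2 * pi / sqrt K - e))" for l
  have GR: "R l" if g: "G l" and arc: "\<And>a b. s \<le> a \<Longrightarrow> a \<le> b \<Longrightarrow> b \<le> u \<Longrightarrow> b - a \<le> l \<Longrightarrow> short_arc a b" for l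
    unfolding R_def
  proof (intro impI allI)
    fix x y z assume K0: "K > 0" and xyz: "s \<le> x" "x \<le> y" "y \<le> z" "z \<le> u" "z - x \<le> l"
    have two: "2 * D a b \<le> 2 * pi / sqrt K - e" if "x \<le> a" "a \<le> b" "b \<le> z" for a b
    proof (cases "a = b")
      case True
      then show ?thesis using e(2)[of 0] K0 by (simp add: half_tan_def)
    next
      case False
      have "small_perimeter K (perim a b b)" using arc[of a b] that xyz unfolding short_arc_def by auto
      then have "sqrt K * D a b < pi" using small_perimeter_scaled[OF K0] unfolding perim_def by (simp add: D_commute[of b a])
      moreover have "k * half_tan K (D a b) \<le> 1" using g that xyz False unfolding G_def chord_angle_ge_def by auto
      ultimately show ?thesis using e(2)[OF K0 D_nonneg] by simp
    qed
    show "perim x y z \<le> 2 * pi / sqrt K - e"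
    proof (cases "x = y \<or> y = z")
      case True
      then show ?thesis using two[of x z] xyz unfolding perim_def by (auto simp: D_commute)
    next
      case False
      then have lt: "x < y" "y < z" using xyz by auto
      have ar: "short_arc x z" using arc xyz by simp
      have gs: "chord_angle_ge k x y" "chord_angle_ge k y z" "chord_angle_ge k x z" using g lt xyz unfolding G_def by auto
      have "A y x z \<le> pi - arcsin (k * half_tan K (D x y)) - arcsin (k * half_tan K (D y z))"
        using angles_at_middle[OF ar lt] gs unfolding chord_angle_ge_def by simp
      then have "D x z + D y x + D y z \<le> 2 * pi / sqrt K - e"
        using e(3)[OF K0 triangle_sides_arc(2)[OF ar lt]] gs unfolding chord_angle_ge_def A_def by (simp add: D_commute)
      then show ?thesis unfolding perim_def by (simp add: D_commute)
    qed
  qed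
  have main: "G (r + real n * c) \<and> R (r + real n * c)" for n
  proof (induction n)
    case 0
    have arc: "short_arc a b" if "s \<le> a" "a \<le> b" "b \<le> u" "b - a \<le> r" for a b
      using that su r by (intro short_arc_of_short_length) auto
    have "G r" unfolding G_def
    proof (intro allI impI)
      fix a b assume ab: "s \<le> a" "a < b" "b \<le> u" "b - a \<le> r"
      have "0 < D a b" "D a b < r0" using ab su r D_le[of a b] by (auto intro!: D_pos)
      then show "chord_angle_ge k a b" unfolding chord_angle_ge_def
        using r0(2)[of "D a b"] end_angles_linear[OF arc _ ab(2) good] ab k by fastforce
    qed
    then show ?case using GR arc by simp
  next
    case (Suc n)
    define l where "l = r + real n * c"
    have l: "G l" "R l" "r \<le> l" "r + real (Suc n) * c = l + c" using Suc c unfolding l_def by (auto simp: algebra_simps)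
    have arc: "short_arc a b" if ab: "s \<le> a" "a \<le> b" "b \<le> u" "b - a \<le> l + c" for a b
      unfolding short_arc_def
    proof (intro conjI allI impI)
      show "b < a + L" using ab su by simp
      fix x y z assume xyz: "a \<le> x" "x \<le> y" "y \<le> z" "z \<le> b"
      \<comment> \<open>Moving \<open>z\<close> and \<open>y\<close> back by at most
        \<open>c\<close> puts the triangle into an arc of length \<open>l\<close>, at the cost of at
        most \<open>4 * c\<close> in its perimeter.\<close>
      define z' y' where "z' = max x (z - c)" "y' = min y z'"
      have zy: "x \<le> y'" "y' \<le> z'" "z' - x \<le> l" "\<bar>z - z'\<bar> \<le> c" "\<bar>y - y'\<bar> \<le> c" "z' \<le> u"
        using xyz ab c l r unfolding z'_y'_def by auto
      have "perim x y z \<le> perim x y' z' + 4 * c"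
        using D_triangle[of x y y'] D_triangle[of y z y'] D_triangle[of y' z z'] D_triangle[of z x z']
          D_le[of y y'] D_le[of z z'] zy unfolding perim_def by (simp add: D_commute)
      moreover have "perim x y' z' \<le> 2 * pi / sqrt K - e" if "K > 0" using l(2) that zy xyz ab unfolding R_def by auto
      ultimately show "small_perimeter K (perim x y z)" unfolding small_perimeter_def using c e by force
    qed
    have "G (l + c)" unfolding G_def
    proof (intro allI impI)
      fix a b assume ab: "s \<le> a" "a < b" "b \<le> u" "b - a \<le> l + c"
      show "chord_angle_ge k a b"
      proof (cases "b - a \<le> l")
        case True
        then show ?thesis using l(1) ab unfolding G_def by simp
      next
        case False
        have ar: "short_arc a b" using arc ab by simp
        obtain t where t: "a < t" "t < b" "D a t = D t b" using equidistant_point[of a b] ab su by auto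
        have "m \<le> D a b" using m(2)[of a b] ab False l by simp
        then have "m / 2 \<le> D a t" "m / 2 \<le> D t b" using D_triangle[of a b t] t by auto
        \<comment> \<open>Each piece has at least length \<open>c\<close>, so the other one has at
          most length \<open>l\<close>, and both are covered by \<open>G l\<close>.\<close>
        then have "c \<le> t - a" "c \<le> b - t" using D_le[of a t] D_le[of t b] t c by auto
        then have "chord_angle_ge k a t" "chord_angle_ge k t b" using l(1) ab t unfolding G_def by auto
        then show ?thesis by (rule chord_angle_ge_halving[OF k(1) ar t])
      qed
    qed
    then show ?case unfolding l(4) using GR arc by blast
  qed
  obtain n :: nat where n: "(u - s) / c < real n" using reals_Archimedean2 by blast
  then have us: "u - s \<le> r + real n * c" using c r by (simp add: field_simps)
  show "chord_angle_ge k s u" using main[of n] us su unfolding G_def by auto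
  show "short_arc s u" unfolding short_arc_def
  proof (intro conjI allI impI su)
    fix x y z assume "s \<le> x" "x \<le> y" "y \<le> z" "z \<le> u"
    then have "K > 0 \<Longrightarrow> perim x y z \<le> 2 * pi / sqrt K - e" using main[of n] us unfolding R_def by auto
    then show "small_perimeter K (perim x y z)" unfolding small_perimeter_def using e by force
  qed
qed

lemma chi_ge_largest_side:
  assumes k: "0 < k" "k < k1" and good: "AE t in lborel. good_at k1 t" and stu: "s < t" "t < u" "u < s + L"
    and lar: "D s t \<le> D u s" "D t u \<le> D u s"
  shows "k \<le> chi K (g s) (g t) (g u)"
proof (rule chi_ge_of_model_angle_le[OF K_nonneg _ _ _ k(1)])
  have arc: "short_arc s u" using chord_angle_ge_all(2)[OF k good, of s u] stu by simp
  have gs: "chord_angle_ge k s t" "chord_angle_ge k t u" using chord_angle_ge_all(1)[OF k good] stu by auto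
  show "g s \<noteq> g t" "g t \<noteq> g u" "g s \<noteq> g u" using injective stu by auto
  have "small_perimeter K (perim s t u)" using arc stu unfolding short_arc_def by auto
  then show "small_perimeter K (dist (g s) (g t) + dist (g t) (g u) + dist (g u) (g s))" unfolding perim_def D_def .
  show "dist (g s) (g t) \<le> dist (g u) (g s)" "dist (g t) (g u) \<le> dist (g u) (g s)" using lar unfolding D_def .
  show "k * half_tan K (dist (g s) (g t)) \<le> 1" "k * half_tan K (dist (g t) (g u)) \<le> 1"
    using gs unfolding chord_angle_ge_def D_def by auto
  show "model_angle K (dist (g s) (g t)) (dist (g t) (g u)) (dist (g u) (g s)) \<le>
      pi - arcsin (k * half_tan K (dist (g s) (g t))) - arcsin (k * half_tan K (dist (g t) (g u)))"
    using angles_at_middle[OF arc stu(1,2)] gs unfolding chord_angle_ge_def A_def D_def by (simp add: dist_commute)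
qed

text \<open>A cyclic shift, using parameters beyond one period, brings the vertex opposite to the
  largest side into the middle.\<close>

lemma chi_ge_ordered:
  assumes k: "0 < k" "k < k1" and good: "AE t in lborel. good_at k1 t" and stu: "s < t" "t < u" "u < s + L"
  shows "k \<le> chi K (g s) (g t) (g u)"
proof -
  consider "D s t \<le> D u s" "D t u \<le> D u s" | "D u s \<le> D s t" "D t u \<le> D s t" | "D u s \<le> D t u" "D s t \<le> D t u" by linarith
  then show ?thesis
  proof cases
    case 1
    then show ?thesis using chi_ge_largest_side[OF k good stu] by simp
  next
    case 2
    then have "k \<le> chi K (g t) (g u) (g (s + L))" using stu by (intro chi_ge_largest_side[OF k good]) auto
    then show ?thesis by (simp add: periodic chi_rotate[of K "g s"])
  next
    case 3
    then have "k \<le> chi K (g u) (g (s + L)) (g (t + L))" using stu by (intro chi_ge_largest_side[OF k good]) (auto simp: D_commute)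
    then show ?thesis by (simp add: periodic chi_rotate[of K "g u"])
  qed
qed

end

section \<open>Pointwise and global curvature of the boundary\<close>

lemma periodic_int:
  fixes g :: "real \<Rightarrow> 'a"
  assumes "\<And>t. g (t + L) = g t"
  shows "g (t + of_int n * L) = g t"
proof (induction n arbitrary: t rule: int_induct[of _ 0])
  case (step1 i)
  then show ?case using assms[of "t + of_int i * L"] by (simp add: distrib_right add.assoc)
next
  case (step2 i)
  then show ?case using assms[of "t + of_int (i - 1) * L"] by (simp add: algebra_simps)
qed simp

lemma periodic_representative:
  fixes L a t :: real
  assumes "L > 0" shows "\<exists>n::int. a \<le> t + of_int n * L \<and> t + of_int n * L < a + L"
proof -
  define n where "n = \<lceil>(a - t) / L\<rceil>"
  have "(a - t) / L \<le> of_int n" "of_int n < (a - t) / L + 1" unfolding n_def by linarith+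
  then have "a - t \<le> of_int n * L" "of_int n * L < a - t + L" using assms by (auto simp: field_simps)
  then show ?thesis by (intro exI[of _ n]) auto
qed

lemma periodic_inj:
  fixes g :: "real \<Rightarrow> 'a"
  assumes per: "\<And>t. g (t + L) = g t" and inj: "inj_on g {0..<L}" and L: "L > 0" and st: "s < t" "t < s + L"
  shows "g s \<noteq> g t"
proof
  assume eq: "g s = g t"
  obtain n where n: "0 \<le> s + of_int n * L" "s + of_int n * L < 0 + L" using periodic_representative[OF L] by blast
  define s' t' where "s' = s + of_int n * L" "t' = t + of_int n * L"
  have eq': "g s' = g t'" unfolding s'_t'_def using eq periodic_int[of g L, OF per] by simp
  have b: "0 \<le> s'" "s' < L" "s' < t'" "t' < s' + L" using n st unfolding s'_t'_def by auto
  show False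
  proof (cases "t' < L")
    case True
    then show False using inj_onD[OF inj eq'] b by auto
  next
    case False
    have "g s' = g (t' - L)" using eq' per[of "t' - L"] by simp
    then show False using inj_onD[OF inj, of s' "t' - L"] b False by auto
  qed
qed

lemma periodic_image:
  fixes g :: "real \<Rightarrow> 'a"
  assumes per: "\<And>t. g (t + L) = g t" and L: "L > 0"
  shows "g ` {a..<a + L} = range g"
proof (intro equalityI subsetI)
  fix y assume "y \<in> range g"
  then obtain t where t: "y = g t" by blast
  obtain n where n: "a \<le> t + of_int n * L" "t + of_int n * L < a + L" using periodic_representative[OF L] by blast
  have "y = g (t + of_int n * L)" unfolding t using periodic_int[of g L, OF per] by simp
  then show "y \<in> g ` {a..<a + L}" using n by auto
qed auto

text \<open>The homeomorphism makes \<open>X\<close> compact, which gives shortest paths, and pulls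
  them back to the disk. There \<open>c\<close> runs once around the circle, so the paths from
  \<open>p\<close> to \<open>y\<close> and from \<open>x\<close> to \<open>z\<close> have
  alternating ends and cross.\<close>

lemma disk_boundary_convex_curve:
  fixes K L :: real and X :: "'a::metric_space set"
    and h :: "complex \<Rightarrow> 'a" and h' :: "'a \<Rightarrow> complex" and g :: "real \<Rightarrow> 'a"
  assumes K: "0 \<le> K" and X: "alexandrov_curv_ge K X" and hom: "homeomorphism (cball 0 1) X h h'"
    and L: "0 < L" and per: "\<forall>t. g (t + L) = g t" and inj: "inj_on g {0..<L}" and im: "g ` {0..<L} = h ` sphere 0 1"
    and len: "\<forall>s t. s \<le> t \<longrightarrow> curve_length g s t = ereal (t - s)"
  shows "convex_curve K L g"
proof
  show "0 \<le> K" "0 < L" by fact+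
  show pg: "g (t + L) = g t" for t using per by blast
  have d: "dist (g s) (g t) \<le> t - s" if "s \<le> t" for s t
    using curve_length_ge_dist[OF that, of g] len that by simp
  show dl: "dist (g s) (g t) \<le> \<bar>s - t\<bar>" for s t
    using d[of s t] d[of t s] by (cases "s \<le> t") (auto simp: dist_commute)
  show ig: "g s \<noteq> g t" if "s < t" "t < s + L" for s t using periodic_inj[OF pg inj L that] .
  have rg: "range g = h ` sphere 0 1" using periodic_image[of g L 0] pg L im by simp
  have hX: "h ` cball 0 1 = X" "continuous_on (cball 0 1) h" "continuous_on X h'" "\<And>y. y \<in> X \<Longrightarrow> h (h' y) = y" "\<And>z. z \<in> cball 0 1 \<Longrightarrow> h' (h z) = z" "h' ` X = cball 0 1"
    using hom unfolding homeomorphism_def by auto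
  have cX: "compact X" unfolding hX(1)[symmetric] by (rule compact_continuous_image[OF hX(2) compact_cball])
  have lX: "length_space X" using X unfolding alexandrov_curv_ge_def by blast
  have gX: "g t \<in> X" for t
  proof -
    have "g t \<in> h ` sphere 0 1" using rg by blast
    then show ?thesis unfolding hX(1)[symmetric] by auto
  qed
  have cg: "continuous_on UNIV g" by (rule continuous_onI) (metis dl dist_real_def le_less_trans less_imp_le)
  define c where "c = h' \<circ> g"
  have cc: "continuous_on UNIV c" unfolding c_def
    by (rule continuous_on_compose[OF cg continuous_on_subset[OF hX(3)]]) (use gX in auto)
  have ci: "c s \<noteq> c t" if "s < t" "t < s + L" for s t
    using ig[OF that] hX(4)[OF gX] unfolding c_def o_def by metis
  have cp: "c (t + L) = c t" for t unfolding c_def by (simp add: pg)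
  have cs: "c ` {a..<a + L} = sphere 0 1" for a
  proof -
    have "c ` {a..<a + L} = h' ` (g ` {a..<a + L})" unfolding c_def by (simp add: image_comp)
    also have "\<dots> = h' ` h ` sphere 0 1" using periodic_image[of g L a] pg L rg by simp
    also have "\<dots> = (\<lambda>z. z) ` sphere 0 1" unfolding image_image by (rule image_cong) (use hX(5) in auto)
    finally show ?thesis by simp
  qed
  fix p x y z assume o: "p < x" "x < y" "y < z" "z < p + L"
    and sm: "small_perimeter K (dist (g p) (g x) + dist (g x) (g y) + dist (g y) (g p))"
        "small_perimeter K (dist (g p) (g y) + dist (g y) (g z) + dist (g z) (g p))"
        "small_perimeter K (dist (g p) (g x) + dist (g x) (g z) + dist (g z) (g p))"
        "small_perimeter K (dist (g x) (g y) + dist (g y) (g z) + dist (g z) (g x))"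
  obtain f where f: "shortest_path X f (g p) (g y)" "\<And>a b. a \<in> {0..1} \<Longrightarrow> b \<in> {0..1} \<Longrightarrow> dist (f a) (f b) = \<bar>a - b\<bar> * dist (g p) (g y)"
    using shortest_path_exists[OF cX lX gX gX, of p y] by blast
  obtain e where e: "shortest_path X e (g x) (g z)" "\<And>a b. a \<in> {0..1} \<Longrightarrow> b \<in> {0..1} \<Longrightarrow> dist (e a) (e b) = \<bar>a - b\<bar> * dist (g x) (g z)"
    using shortest_path_exists[OF cX lX gX gX, of x z] by blast
  note fe = f(1)[unfolded shortest_path_def] e(1)[unfolded shortest_path_def]
  have pf: "path (h' \<circ> f)" "path (h' \<circ> e)"
    using fe by (auto intro!: path_continuous_image[unfolded path_def path_image_def] continuous_on_subset[OF hX(3)] simp only: path_def)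
  have "path_image (h' \<circ> f) \<inter> path_image (h' \<circ> e) \<noteq> {}"
  proof (rule alternating_paths_meet_disk[OF cc ci cp cs o pf(1) _ _ _ pf(2)])
    show "path_image (h' \<circ> f) \<subseteq> cball 0 1" "path_image (h' \<circ> e) \<subseteq> cball 0 1"
      using fe hX(6) unfolding path_image_def by (auto simp flip: hX(6))
  qed (use fe in \<open>auto simp: pathstart_def pathfinish_def c_def\<close>)
  then obtain r q where rq: "r \<in> {0..1}" "q \<in> {0..1}" "h' (f r) = h' (e q)" unfolding path_image_def o_def by blast
  have feX: "f r \<in> X" "e q \<in> X" using fe rq by auto
  have w: "f r = e q" using rq(3) hX(4)[OF feX(1)] hX(4)[OF feX(2)] by metis
  have f01: "f 0 = g p" "f 1 = g y" "e 0 = g x" "e 1 = g z" using fe by auto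
  show "model_angle K (dist (g p) (g x)) (dist (g p) (g y)) (dist (g x) (g y))
      + model_angle K (dist (g p) (g y)) (dist (g p) (g z)) (dist (g y) (g z))
      \<le> model_angle K (dist (g p) (g x)) (dist (g p) (g z)) (dist (g x) (g z))"
  proof (rule angles_superadditive[OF K X gX gX gX gX f(1) rq(1) _ e(1) rq(2) _ w _ _ _ _ sm])
    have "dist (f 0) (f r) + dist (f r) (f 1) = dist (f 0) (f 1)"
      using f(2)[of 0 r] f(2)[of r 1] f01 rq(1) by (simp flip: distrib_right)
    then show "dist (g p) (f r) + dist (f r) (g y) = dist (g p) (g y)" unfolding f01 .
    have "dist (e 0) (e q) + dist (e q) (e 1) = dist (e 0) (e 1)"
      using e(2)[of 0 q] e(2)[of q 1] f01 rq(2) by (simp flip: distrib_right)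
    then show "dist (g x) (e q) + dist (e q) (g z) = dist (g x) (g z)" unfolding f01 .
  qed (use ig o in auto)
qed

context convex_curve
begin

text \<open>The strict inequality gives \<open>chi > k\<close> for all pairs of points close to
  \<open>t\<close> on opposite sides, and the angle estimate for the circumscribed circle applies to
  each.\<close>

lemma good_at_of_lower_chi:
  assumes k: "0 < k" "ereal k < lower_chi K g t"
  shows "good_at k t"
proof -
  have "\<forall>\<^sub>F p in at_left t \<times>\<^sub>F at_right t. ereal k < (case p of (s, u) \<Rightarrow> ereal (chi K (g s) (g t) (g u)))"
    using k(2) unfolding lower_chi_def by (rule less_LiminfD)
  then obtain P Q where PQ: "eventually P (at_left t)" "eventually Q (at_right t)"
      "\<And>s u. P s \<Longrightarrow> Q u \<Longrightarrow> k < chi K (g s) (g t) (g u)"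
    unfolding eventually_prod_filter by auto
  obtain b where b: "b < t" "\<And>s. b < s \<Longrightarrow> s < t \<Longrightarrow> P s" using PQ(1) unfolding eventually_at_left_field by blast
  obtain d where d: "t < d" "\<And>u. t < u \<Longrightarrow> u < d \<Longrightarrow> Q u" using PQ(2) unfolding eventually_at_right_field by blast
  \<comment> \<open>\<open>L / 2\<close> keeps the three points within one period, and
    \<open>pi / (4 * sqrt K)\<close> makes the arc between the outer two a short one.\<close>
  define e where "e = min (min (t - b) (d - t)) (min (L / 2) (if K > 0 then pi / (4 * sqrt K) else 1))"
  have e: "0 < e" "e \<le> t - b" "e \<le> d - t" "e \<le> L / 2" "K > 0 \<Longrightarrow> e \<le> pi / (4 * sqrt K)"
    using b(1) d(1) L_pos unfolding e_def by (simp_all add: min.coboundedI1 min.coboundedI2 del: le_divide_eq_numeral1 divide_le_eq_numeral1)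
  show ?thesis unfolding good_at_def
  proof (intro exI[of _ e] conjI allI impI e(1))
    fix s u assume su: "t - e < s" "s < t" "t < u" "u < t + e"
    have ch: "k \<le> chi K (g s) (g t) (g u)" using PQ(3)[OF b(2) d(2), of s u] su e by simp
    have "u - s \<le> pi / (2 * sqrt K)" if "K > 0"
    proof -
      have "u - s \<le> 2 * e" using su by simp
      also have "\<dots> \<le> 2 * (pi / (4 * sqrt K))" using e(5)[OF that] by simp
      finally show ?thesis by simp
    qed
    then have "short_arc s u" using su e by (intro short_arc_of_short_length) auto
    then have sm: "small_perimeter K (dist (g s) (g t) + dist (g t) (g u) + dist (g u) (g s))"
      using su unfolding short_arc_def perim_def D_def by auto
    have "g s \<noteq> g t" "g t \<noteq> g u" "g s \<noteq> g u" using su e injective[of s t] injective[of t u] injective[of s u] by auto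
    from model_angle_le_of_chi_ge[OF K_nonneg this k(1) ch sm]
    show "A t s u \<le> pi - k / 2 * (D s t + D t u)" unfolding A_def D_def by (simp add: dist_commute)
  qed
qed

lemma good_at_shift: "good_at k (t + of_int n * L) \<longleftrightarrow> good_at k t"
proof -
  have D_shift: "D (s + of_int n * L) u = D s u" "D s (u + of_int n * L) = D s u" for s u n
    unfolding D_def by (simp_all add: periodic_int[of g L, OF periodic])
  have sh: "good_at k (t + of_int n * L)" if g: "good_at k t" for t n
  proof -
    obtain e where e: "e > 0" "\<And>a b. t - e < a \<Longrightarrow> a < t \<Longrightarrow> t < b \<Longrightarrow> b < t + e \<Longrightarrow> A t a b \<le> pi - k / 2 * (D a t + D t b)"
      using g unfolding good_at_def by blast
    show ?thesis unfolding good_at_def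
    proof (intro exI[of _ e] conjI allI impI e(1))
      fix a b assume ab: "t + of_int n * L - e < a" "a < t + of_int n * L" "t + of_int n * L < b" "b < t + of_int n * L + e"
      define a' b' where "a' = a - of_int n * L" "b' = b - of_int n * L"
      have eq: "a = a' + of_int n * L" "b = b' + of_int n * L" unfolding a'_b'_def by auto
      have "A t a' b' \<le> pi - k / 2 * (D a' t + D t b')" using ab unfolding a'_b'_def by (intro e(2)) auto
      then show "A (t + of_int n * L) a b \<le> pi - k / 2 * (D a (t + of_int n * L) + D (t + of_int n * L) b)"
        unfolding eq A_def D_shift .
    qed
  qed
  show ?thesis using sh[of t n] sh[of "t + of_int n * L" "- n"] by auto
qed

text \<open>Goodness is periodic, so the exceptional set is covered by countably many translates of
  a null set.\<close>

lemma AE_good_at: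
  assumes "AE t in lborel. 0 \<le> t \<and> t \<le> L \<longrightarrow> good_at k t"
  shows "AE t in lborel. good_at k t"
proof -
  obtain N where N: "{t. \<not> (0 \<le> t \<and> t \<le> L \<longrightarrow> good_at k t)} \<subseteq> N" "N \<in> null_sets lborel"
    using assms unfolding eventually_ae_filter by auto
  have "(\<Union>n::int. {x. x - of_int n * L \<in> N}) \<in> null_sets lborel"
    using null_sets_translation[OF N(2)] by (intro null_sets_UN) auto
  moreover have "{t \<in> space lborel. \<not> good_at k t} \<subseteq> (\<Union>n::int. {x. x - of_int n * L \<in> N})"
  proof safe
    fix t assume t: "\<not> good_at k t"
    obtain n where n: "0 \<le> t + of_int n * L" "t + of_int n * L < 0 + L" using periodic_representative[OF L_pos] by blast
    have "t + of_int n * L \<in> N" using N(1) n t good_at_shift[of k t n] by auto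
    then show "t \<in> (\<Union>n::int. {x. x - of_int n * L \<in> N})" by (intro UN_I[of "- n"]) auto
  qed
  ultimately show ?thesis unfolding eventually_ae_filter by blast
qed

lemma chi_global_ge_of_AE:
  assumes kap: "0 \<le> \<kappa>" and ae: "AE t in lborel. 0 \<le> t \<and> t \<le> L \<longrightarrow> ereal \<kappa> \<le> lower_chi K g t"
  shows "chi_global_ge K (range g) \<kappa>"
  unfolding chi_global_ge_def
proof (intro ballI impI, elim conjE)
  fix p q m assume pqm: "p \<in> range g" "q \<in> range g" "m \<in> range g" and ne: "p \<noteq> q" "q \<noteq> m" "p \<noteq> m"
    and per: "0 < K \<longrightarrow> dist p q + dist q m + dist m p \<le> 2 * pi / sqrt K"
  show "\<kappa> \<le> chi K p q m"
  \<comment> \<open>The turning argument needs a positive \<open>k\<close> below the bound; for the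
    bound 0 nonnegativity of \<open>chi\<close> suffices.\<close>
  proof (cases "\<kappa> = 0")
    case True
    then show ?thesis using chi_eq(1)[OF K_nonneg ne] per by simp
  next
    case False
    then have kp: "0 < \<kappa>" using kap by simp
    obtain s where s: "p = g s" using pqm by blast
    have rep: "\<exists>t. s < t \<and> t < s + L \<and> x = g t" if "x \<in> range g" "x \<noteq> p" for x
    proof -
      have "x \<in> g ` {s..<s + L}" using periodic_image[of g L s] periodic L_pos that by simp
      then obtain t where "s \<le> t" "t < s + L" "x = g t" by auto
      then show ?thesis using that s by (intro exI[of _ t]) (auto simp: order.order_iff_strict)
    qed
    obtain t where t: "s < t" "t < s + L" "q = g t" using rep[of q] pqm ne by auto
    obtain u where u: "s < u" "u < s + L" "m = g u" using rep[of m] pqm ne by auto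
    show ?thesis
    proof (rule dense_le_bounded[OF kp])
      fix k assume k: "0 < k" "k < \<kappa>"
      \<comment> \<open>The gap above \<open>k1\<close> is used by
        \<open>good_at_of_lower_chi\<close>, the one below it by
        \<open>short_chord_angle\<close>.\<close>
      obtain k1 where k1: "k < k1" "k1 < \<kappa>" using dense k by blast
      have "AE t in lborel. 0 \<le> t \<and> t \<le> L \<longrightarrow> good_at k1 t"
        using ae
      proof eventually_elim
        case (elim t)
        then show ?case using good_at_of_lower_chi[of k1 t] k1 k less_le_trans[of "ereal k1" "ereal \<kappa>"] by auto
      qed
      then have good: "AE t in lborel. good_at k1 t" by (rule AE_good_at)
      consider "t < u" | "u < t" using t u ne by (cases t u rule: linorder_cases) auto
      then show "k \<le> chi K p q m"
      proof cases
        case 1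
        then show ?thesis using chi_ge_ordered[OF k(1) k1(1) good t(1) 1 u(2)] s t u by simp
      next
        case 2
        have "k \<le> chi K (g s) (g u) (g t)" using chi_ge_ordered[OF k(1) k1(1) good u(1) 2 t(2)] .
        also have "\<dots> = chi K (g s) (g t) (g u)" using chi_swap[of K "g s" "g u" "g t"] chi_rotate[of K "g s" "g t" "g u"] by simp
        finally show ?thesis using s t u by simp
      qed
    qed
  qed
qed

lemma lower_chi_ge_of_global:
  assumes glob: "chi_global_ge K (range g) \<kappa>"
  shows "ereal \<kappa> \<le> lower_chi K g t"
  unfolding lower_chi_def
proof (rule Liminf_bounded)
  define e where "e = min (L / 2) (if K > 0 then pi / (4 * sqrt K) else 1)"
  have e: "0 < e" "e \<le> L / 2" "K > 0 \<Longrightarrow> e \<le> pi / (4 * sqrt K)" using L_pos unfolding e_def by auto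
  have "\<forall>\<^sub>F s in at_left t. t - e < s \<and> s < t" unfolding eventually_at_left_field using e by (intro exI[of _ "t - e"]) auto
  moreover have "\<forall>\<^sub>F u in at_right t. t < u \<and> u < t + e" unfolding eventually_at_right_field using e by (intro exI[of _ "t + e"]) auto
  moreover have "\<kappa> \<le> chi K (g s) (g t) (g u)" if su: "t - e < s \<and> s < t" "t < u \<and> u < t + e" for s u
  proof -
    have "u - s \<le> pi / (2 * sqrt K)" if "K > 0"
    proof -
      have "u - s \<le> 2 * e" using su by simp
      also have "\<dots> \<le> 2 * (pi / (4 * sqrt K))" using e(3)[OF that] by simp
      finally show ?thesis by simp
    qed
    then have "short_arc s u" using su e by (intro short_arc_of_short_length) auto
    then have sm: "small_perimeter K (dist (g s) (g t) + dist (g t) (g u) + dist (g u) (g s))"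
      using su unfolding short_arc_def perim_def D_def by auto
    have ne: "g s \<noteq> g t" "g t \<noteq> g u" "g s \<noteq> g u" using su e injective[of s t] injective[of t u] injective[of s u] by auto
    show ?thesis using glob ne sm unfolding chi_global_ge_def small_perimeter_def by auto
  qed
  ultimately show "\<forall>\<^sub>F p in at_left t \<times>\<^sub>F at_right t. ereal \<kappa> \<le> (case p of (s, u) \<Rightarrow> ereal (chi K (g s) (g t) (g u)))"
    unfolding eventually_prod_filter by auto
qed

end

theorem theorem5p2:
  fixes K kappa L :: real and X :: "'a::metric_space set"
    and h :: "complex \<Rightarrow> 'a" and h' :: "'a \<Rightarrow> complex" and g :: "real \<Rightarrow> 'a"
  assumes "0 \<le> K"
    and "alexandrov_curv_ge K X"
    and "homeomorphism (cball 0 1) X h h'"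
    and "0 < L"
    and "\<forall>t. g (t + L) = g t"
    and "inj_on g {0..<L}"
    and "g ` {0..<L} = h ` sphere 0 1"
    and "\<forall>s t. s \<le> t \<longrightarrow> curve_length g s t = ereal (t - s)"
    and "0 \<le> kappa"
  shows "(AE t in lborel. 0 \<le> t \<and> t \<le> L \<longrightarrow> ereal kappa \<le> lower_chi K g t)
         \<longleftrightarrow> chi_global_ge K (h ` sphere 0 1) kappa"
proof -
  interpret convex_curve K L g using assms(1-8) by (rule disk_boundary_convex_curve)
  have "range g = h ` sphere 0 1" using periodic_image[of g L 0] assms(4,5,7) by simp
  then show ?thesis using chi_global_ge_of_AE[OF assms(9)] lower_chi_ge_of_global[of kappa] by auto
qed

end
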